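(* Consider the planar ($\mathbb Z^2$-periodic) infinite horizon billiard and the associated collapsed Young tower $(\Delta,f,\mu_\Delta)$, the spectral family $\Pi_t$ ($t\in\mathbb R^2$ close to $0$) and the Banach space $\mathcal B_0$ of bounded functions defined in the context. There exists $\Pi_0'$, belonging (componentwise) to $\mathcal L(\mathcal B_0\to L^s(\mu_\Delta))$ for every $s\in[1,2)$, such that, for any $p>2$, any $p'\in[1,\frac43)$ and any $\gamma\in\left(1,\min\left(2\frac{p-1}p,\frac4{p'}-2\right)\right)$, there exists $C>0$ such that $$\|\Pi_t-\Pi_0-t\cdot\Pi_0'\|_{\mathcal L(\mathcal B_0\to L^{p'}(\mu_\Delta))}\le C|t|^\gamma\quad\text{as }t\to0.$$
   Context: Billiard ($d=2$). $\mathcal J$ is a nonempty finite set and $(\mathcal O_j)_{j\in\mathcal J}$ are open convex subsets of $\mathbb R^2$ with $C^3$ boundary of nonzero curvature, such that the sets $\mathcal O_j+\ell$ ($j\in\mathcal J,\ell\in\mathbb Z^2$) have pairwise disjoint closures; $Q:=\mathbb R^2\setminus\bigcup_{j,\ell}(\mathcal O_j+\ell)$ contains at least one line (infinite horizon). $(\bar M,\bar T,\bar\mu)$ is the billiard map (post-collisional vectors) in $\bar Q=Q/\mathbb Z^2$ with its invariant probability measure of density proportional to $\cos\varphi$, and $\kappa:\bar M\to\mathbb Z^2$ is the cell change: lifting to $Q$, a particle leaving an obstacle of the cell $N$ (obstacles $\mathcal O_j+N$, $j\in\mathcal J$) has its next collision in the cell $N+\kappa$. Tower. $(\bar M,\bar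 T,\bar\mu)$ is a factor, by $\mathfrak p_1:\bar\Delta\to\bar M$, of a Young tower $(\bar\Delta,\bar f,\mu_{\bar\Delta})$ with stable and unstable curves (Young, Chernov). Collapsing stable curves gives $\mathfrak p_2:\bar\Delta\to\Delta$ onto a one-dimensional tower $(\Delta,f,\mu_\Delta)$: there are a base $Y=\Delta_0$ with a countable partition $\mathcal Y$ and a height $\sigma:Y\to\{1,2,\dots\}$ constant on atoms of $\mathcal Y$ with $\mu_Y(\sigma>n)=O(\theta_1^n)$ for some $\theta_1<1$ (where $\mu_Y=\mu_\Delta(\cdot|Y)$), $\Delta=\{(y,\ell):y\in Y,0\le\ell<\sigma(y)\}$, $f(y,\ell)=(y,\ell+1)$ if $\ell<\sigma(y)-1$ and $f(y,\sigma(y)-1)=(Fy,0)$, with $F=f^\sigma:Y\to Y$ a full-branch Gibbs–Markov map for $\mathcal Y$; $\mu_\Delta$ is an $f$-invariant mixing probability. $\Delta_\ell$ is the $\ell$-th floor. $\kappa$ is constant on stable curves; $\hat\kappa:\Delta\to\mathbb Z^2$ is defined by $\hat\kappa\circ\mathfrak p_2=\kappa\circ\mathfrak p_1$. Operators and spaces. $P$ is the transfer operator of $(\Delta,f,\mu_\Delta)$, $Ph(x)=\sum_{f(y)=x}e^{-\alpha(y)}h(y)$, and $P_t:=P(e^{it\cdot\hat\kappa}\,\cdot)$, $t\in\mathbb R^2$. $s_0(x,y)$ is Young's separation time on $\Delta$ (the least $n\ge0$ such that $f^nx,f^ny$ lie in different elements of Young's Markov partition of the tower). $\beta\in(0,1)$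 is fixed close enough to $1$ so that $|\alpha(y_1)-\alpha(y_2)|\le C_\alpha\beta^{s_0(y_1,y_2)+1}$ when $s_0(y_1,y_2)\ge1$. $\mathcal B_0$ is the space of functions $h:\Delta\to\mathbb C$ with $\|h\|_{\mathcal B_0}:=\|h\|_\infty+\operatorname{ess\,sup}_{s_0(x,y)\ge1}\frac{|h(x)-h(y)|}{\beta^{s_0(x,y)}}<\infty$. Given $p>2$ and $\varepsilon>0$ small enough (in particular $\sum_\ell e^{p\ell\varepsilon}\mu_\Delta(\Delta_\ell)<\infty$), $\mathcal B$ is the space of $h$ with $\|h\|_{\mathcal B}:=\sup_{\ell\ge0}e^{-\ell\varepsilon}\big(\|h_{|\Delta_\ell}\|_\infty+\operatorname{ess\,sup}_{x,y\in\Delta_\ell,s_0(x,y)\ge1}\frac{|h(x)-h(y)|}{\beta^{s_0(x,y)}}\big)<\infty$; then $\mathcal B_0\subset\mathcal B\hookrightarrow L^p(\mu_\Delta)$. Known facts. There are $\beta_0\in(0,\pi]$, $\theta\in(0,1)$ such that for $t\in[-\beta_0,\beta_0]^2$, $P_t^n=\lambda_t^n\Pi_t+N_t^n$ on $\mathcal B$ ($n\ge1$), where $\lambda_t\in\mathbb C$ is the dominating simple eigenvalue of $P_t$, $\lambda_0=1$, and $\Pi_t$ the associated eigenprojector, with $\sup_{t\in[-\beta_0,\beta_0]^2}\|N_t^n\|_{\mathcal B}+\sup_{t\in[-\pi,\pi]^2\setminus[-\beta_0,\beta_0]^2}\|P_t^n\|_{\mathcal B}=O(\theta^n)$, $\Pi_0=\mathbb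 E_{\mu_\Delta}[\cdot]\mathbf 1$ and $\Pi_t\to\Pi_0$ in $\mathcal L(\mathcal B\to L^1(\mu_\Delta))$ as $t\to0$. *)

theory Defs
  imports "HOL-Probability.Probability"
begin

section \<open>The periodic billiard\<close>

type_synonym plane = "real ^ 2"

type_synonym phase = "plane \<times> plane"

definition lattice :: "plane set" where
  "lattice = {l. \<forall>i. l $ i \<in> \<int>}"

text \<open>
  \<open>c\<close> is an arc length parametrization, of class \<open>C\<^sup>3\<close>, of the boundary of \<open>K\<close>, a curve of
  length \<open>len\<close>. At unit speed the curvature is the norm of the second derivative. Requiring the
  boundary to be a closed curve loses nothing: an unbounded open convex set has infinite area and
  so meets one of its own lattice translates.
\<close>

definition C3_boundary :: "plane set \<Rightarrow> real \<Rightarrow> (real \<Rightarrow> plane) \<Rightarrow> bool" where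
  "C3_boundary K len c \<longleftrightarrow>
     0 < len \<and> (\<forall>r. c (r + len) = c r) \<and> inj_on c {0..<len} \<and> c ` {0..<len} = frontier K \<and>
     (\<exists>c1 c2 c3. (\<forall>r. (c has_vector_derivative c1 r) (at r)) \<and>
                 (\<forall>r. (c1 has_vector_derivative c2 r) (at r)) \<and>
                 (\<forall>r. (c2 has_vector_derivative c3 r) (at r)) \<and>
                 continuous_on UNIV c3 \<and>
                 (\<forall>r. norm (c1 r) = 1) \<and> (\<forall>r. c2 r \<noteq> 0))"

definition billiard_domain :: "'j set \<Rightarrow> ('j \<Rightarrow> plane set) \<Rightarrow> plane set" where
  "billiard_domain J Ob = - (\<Union>j\<in>J. \<Union>l\<in>lattice. (+) l ` Ob j)"

definition infinite_horizon_billiard ::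
  "'j set \<Rightarrow> ('j \<Rightarrow> plane set) \<Rightarrow> ('j \<Rightarrow> real) \<Rightarrow> ('j \<Rightarrow> real \<Rightarrow> plane) \<Rightarrow> bool" where
  "infinite_horizon_billiard J Ob len c \<longleftrightarrow>
     finite J \<and> J \<noteq> {} \<and>
     (\<forall>j\<in>J. open (Ob j) \<and> convex (Ob j) \<and> C3_boundary (Ob j) (len j) (c j)) \<and>
     (\<forall>j\<in>J. \<forall>j'\<in>J. \<forall>l\<in>lattice. \<forall>l'\<in>lattice. (j, l) \<noteq> (j', l') \<longrightarrow>
        closure ((+) l ` Ob j) \<inter> closure ((+) l' ` Ob j') = {}) \<and>
     (\<exists>a u. u \<noteq> 0 \<and> (\<forall>s. a + s *\<^sub>R u \<in> billiard_domain J Ob))"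

definition outer_normal :: "plane set \<Rightarrow> plane \<Rightarrow> plane" where
  "outer_normal K q = (THE n. norm n = 1 \<and> (\<forall>z\<in>K. n \<bullet> (z - q) \<le> 0))"

text \<open>
  The boundary of the quotient of the billiard domain by the lattice is represented by the
  boundaries of the obstacles of the cell 0. Tangential (grazing) contacts are collisions.
\<close>

definition phase_space :: "'j set \<Rightarrow> ('j \<Rightarrow> plane set) \<Rightarrow> phase set" where
  "phase_space J Ob =
     {(q, v). norm v = 1 \<and> (\<exists>j\<in>J. q \<in> frontier (Ob j) \<and> 0 \<le> outer_normal (Ob j) q \<bullet> v)}"

definition grazing :: "'j set \<Rightarrow> ('j \<Rightarrow> plane set) \<Rightarrow> phase \<Rightarrow> bool" where
  "grazing J Ob = (\<lambda>(q, v). \<exists>j\<in>J. q \<in> frontier (Ob j) \<and> outer_normal (Ob j) q \<bullet> v = 0)"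

definition free_flight :: "'j set \<Rightarrow> ('j \<Rightarrow> plane set) \<Rightarrow> phase \<Rightarrow> real" where
  "free_flight J Ob = (\<lambda>(q, v).
     Inf {s. 0 < s \<and> (\<exists>j\<in>J. \<exists>l\<in>lattice. q + s *\<^sub>R v - l \<in> frontier (Ob j))})"

definition cell_change :: "'j set \<Rightarrow> ('j \<Rightarrow> plane set) \<Rightarrow> phase \<Rightarrow> plane" where
  "cell_change J Ob = (\<lambda>(q, v).
     THE l. l \<in> lattice \<and> (\<exists>j\<in>J. q + free_flight J Ob (q, v) *\<^sub>R v - l \<in> frontier (Ob j)))"

definition billiard_map :: "'j set \<Rightarrow> ('j \<Rightarrow> plane set) \<Rightarrow> phase \<Rightarrow> phase" where
  "billiard_map J Ob = (\<lambda>(q, v).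
     let q' = q + free_flight J Ob (q, v) *\<^sub>R v - cell_change J Ob (q, v);
         n = outer_normal (Ob (THE j. j \<in> J \<and> q' \<in> frontier (Ob j))) q'
     in (q', v - (2 * (n \<bullet> v)) *\<^sub>R n))"

text \<open>Each obstacle carries the mass \<open>2 * len j\<close> of \<open>cos \<phi> dr d\<phi>\<close>.\<close>

definition billiard_measure ::
  "'j set \<Rightarrow> ('j \<Rightarrow> plane set) \<Rightarrow> ('j \<Rightarrow> real) \<Rightarrow> ('j \<Rightarrow> real \<Rightarrow> plane) \<Rightarrow> phase measure" where
  "billiard_measure J Ob len c =
     distr
       (density (count_space J \<Otimes>\<^sub>M (lborel \<Otimes>\<^sub>M lborel))
         (\<lambda>(j, r, \<phi>). ennreal (cos \<phi> / (2 * (\<Sum>i\<in>J. len i))) *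
            indicator ({0..<len j} \<times> {- (pi / 2)..pi / 2}) (r, \<phi>)))
       borel
       (\<lambda>(j, r, \<phi>). (c j r, cos \<phi> *\<^sub>R outer_normal (Ob j) (c j r) +
                             sin \<phi> *\<^sub>R vector_derivative (c j) (at r)))"


section \<open>Towers\<close>

definition measure_preserving_map :: "'a measure \<Rightarrow> 'b measure \<Rightarrow> ('a \<Rightarrow> 'b) \<Rightarrow> bool" where
  "measure_preserving_map M N g \<longleftrightarrow> g \<in> measurable M N \<and> distr M N g = N"

definition mixing_map :: "'a measure \<Rightarrow> ('a \<Rightarrow> 'a) \<Rightarrow> bool" where
  "mixing_map M g \<longleftrightarrow> (\<forall>A\<in>sets M. \<forall>B\<in>sets M.
     (\<lambda>n. measure M (A \<inter> ((g ^^ n) -` B \<inter> space M))) \<longlonglongrightarrow> measure M A * measure M B)"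

definition tower :: "'a set \<Rightarrow> ('a \<Rightarrow> nat) \<Rightarrow> ('a \<times> nat) set" where
  "tower X r = {(x, l). x \<in> X \<and> l < r x}"

definition tower_map :: "('a \<Rightarrow> nat) \<Rightarrow> ('a \<Rightarrow> 'a) \<Rightarrow> 'a \<times> nat \<Rightarrow> 'a \<times> nat" where
  "tower_map r G = (\<lambda>(x, l). if Suc l < r x then (x, Suc l) else (G x, 0))"

subsection \<open>Young tower over the billiard map\<close>

definition smooth_curve :: "phase set \<Rightarrow> bool" where
  "smooth_curve \<gamma> \<longleftrightarrow> (\<exists>I g g'. is_interval (I :: real set) \<and> interior I \<noteq> {} \<and> inj_on g I \<and>
     (\<forall>r\<in>I. (g has_vector_derivative g' r) (at r within I) \<and> g' r \<noteq> 0) \<and>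
     continuous_on I g' \<and> \<gamma> = g ` I)"

text \<open>
  The billiard map is singular at the grazing vectors and at their preimages. The positive
  (resp. negative) iterates of the map are smooth on a stable (resp. unstable) curve.
\<close>

definition regular_curve :: "'j set \<Rightarrow> ('j \<Rightarrow> plane set) \<Rightarrow> phase set \<Rightarrow> bool" where
  "regular_curve J Ob \<gamma> \<longleftrightarrow>
     smooth_curve \<gamma> \<and> \<gamma> \<subseteq> phase_space J Ob \<and> (\<forall>x\<in>\<gamma>. \<not> grazing J Ob x)"

definition stable_curve ::
  "'j set \<Rightarrow> ('j \<Rightarrow> plane set) \<Rightarrow> real \<Rightarrow> real \<Rightarrow> phase set \<Rightarrow> bool" where
  "stable_curve J Ob K \<rho> \<gamma> \<longleftrightarrow>
     (\<forall>n. inj_on (billiard_map J Ob ^^ n) \<gamma> \<and> regular_curve J Ob ((billiard_map J Ob ^^ n) ` \<gamma>) \<and>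
          (\<forall>x\<in>\<gamma>. \<forall>y\<in>\<gamma>.
             dist ((billiard_map J Ob ^^ n) x) ((billiard_map J Ob ^^ n) y) \<le> K * \<rho> ^ n))"

definition unstable_curve ::
  "'j set \<Rightarrow> ('j \<Rightarrow> plane set) \<Rightarrow> real \<Rightarrow> real \<Rightarrow> phase set \<Rightarrow> bool" where
  "unstable_curve J Ob K \<rho> \<gamma> \<longleftrightarrow> (\<exists>W. W 0 = \<gamma> \<and>
     (\<forall>n. regular_curve J Ob (W n) \<and> bij_betw (billiard_map J Ob) (W (Suc n)) (W n) \<and>
          (\<forall>x\<in>W n. \<forall>y\<in>W n. dist x y \<le> K * \<rho> ^ n)))"

definition product_set :: "phase set set \<Rightarrow> phase set set \<Rightarrow> phase set" where
  "product_set \<Gamma>u \<Gamma>s = \<Union>\<Gamma>u \<inter> \<Union>\<Gamma>s"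

definition hyperbolic_product_structure ::
  "'j set \<Rightarrow> ('j \<Rightarrow> plane set) \<Rightarrow> phase set set \<Rightarrow> phase set set \<Rightarrow> bool" where
  "hyperbolic_product_structure J Ob \<Gamma>u \<Gamma>s \<longleftrightarrow>
     (\<exists>K \<rho>. 0 < \<rho> \<and> \<rho> < 1 \<and>
        (\<forall>\<gamma>\<in>\<Gamma>u. unstable_curve J Ob K \<rho> \<gamma>) \<and> (\<forall>\<gamma>\<in>\<Gamma>s. stable_curve J Ob K \<rho> \<gamma>)) \<and>
     disjoint \<Gamma>u \<and> disjoint \<Gamma>s \<and>
     (\<forall>\<gamma>u\<in>\<Gamma>u. \<forall>\<gamma>s\<in>\<Gamma>s. \<exists>!x. x \<in> \<gamma>u \<inter> \<gamma>s)"

text \<open>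
  \<open>\<P>\<close> consists of the s-subsets of the base \<open>\<Lambda>\<close> on which the return time \<open>R\<close> is constant, each
  mapped by \<open>T ^^ R\<close> to a u-subset, stable curves into stable curves and unstable ones across
  unstable ones. Points that do not return infinitely often form a null set saturated by stable
  curves; they are removed from the base.
\<close>

definition markov_returns ::
  "'j set \<Rightarrow> ('j \<Rightarrow> plane set) \<Rightarrow> phase set set \<Rightarrow> phase set set \<Rightarrow>
   phase set set \<Rightarrow> (phase \<Rightarrow> nat) \<Rightarrow> bool" where
  "markov_returns J Ob \<Gamma>u \<Gamma>s \<P> R \<longleftrightarrow>
     (let T = billiard_map J Ob; \<Lambda> = product_set \<Gamma>u \<Gamma>s in
      countable \<P> \<and> partition_on \<Lambda> \<P> \<and>
      (\<forall>A\<in>\<P>. \<exists>S\<subseteq>\<Gamma>s. A = \<Lambda> \<inter> \<Union>S) \<and>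
      (\<forall>A\<in>\<P>. \<exists>n\<ge>1. (\<forall>x\<in>A. R x = n) \<and>
         (\<exists>U\<subseteq>\<Gamma>u. (T ^^ n) ` A = \<Lambda> \<inter> \<Union>U) \<and>
         (\<forall>\<gamma>\<in>\<Gamma>s. \<gamma> \<inter> A \<noteq> {} \<longrightarrow> (\<exists>\<gamma>'\<in>\<Gamma>s. (T ^^ n) ` \<gamma> \<subseteq> \<gamma>')) \<and>
         (\<forall>\<gamma>\<in>\<Gamma>u. \<exists>W\<subseteq>\<gamma>. \<gamma> \<inter> A \<subseteq> W \<and> (T ^^ n) ` W \<in> \<Gamma>u \<and> inj_on (T ^^ n) W \<and>
            (\<forall>k\<le>n. regular_curve J Ob ((T ^^ k) ` W)))))"

definition return_map :: "'j set \<Rightarrow> ('j \<Rightarrow> plane set) \<Rightarrow> (phase \<Rightarrow> nat) \<Rightarrow> phase \<Rightarrow> phase" where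
  "return_map J Ob R x = (billiard_map J Ob ^^ R x) x"

definition tower_projection :: "'j set \<Rightarrow> ('j \<Rightarrow> plane set) \<Rightarrow> phase \<times> nat \<Rightarrow> phase" where
  "tower_projection J Ob = (\<lambda>(x, l). (billiard_map J Ob ^^ l) x)"

definition young_tower ::
  "'j set \<Rightarrow> ('j \<Rightarrow> plane set) \<Rightarrow> ('j \<Rightarrow> real) \<Rightarrow> ('j \<Rightarrow> real \<Rightarrow> plane) \<Rightarrow>
   phase set set \<Rightarrow> phase set set \<Rightarrow> phase set set \<Rightarrow> (phase \<Rightarrow> nat) \<Rightarrow>
   (phase \<times> nat) measure \<Rightarrow> bool" where
  "young_tower J Ob len c \<Gamma>u \<Gamma>s \<P> R \<mu>bar \<longleftrightarrow>
     hyperbolic_product_structure J Ob \<Gamma>u \<Gamma>s \<and> markov_returns J Ob \<Gamma>u \<Gamma>s \<P> R \<and>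
     prob_space \<mu>bar \<and>
     sets \<mu>bar = sets (restrict_space (borel \<Otimes>\<^sub>M count_space UNIV) (tower (product_set \<Gamma>u \<Gamma>s) R)) \<and>
     measure_preserving_map \<mu>bar \<mu>bar (tower_map R (return_map J Ob R)) \<and>
     measure_preserving_map \<mu>bar (billiard_measure J Ob len c) (tower_projection J Ob)"

subsection \<open>One-dimensional tower\<close>

text \<open>
  Separation time of the orbits under \<open>g\<close> with respect to a partition. It is \<open>\<infinity>\<close> if they are never
  separated, and \<open>\<beta> ^ \<infinity>\<close> is 0.
\<close>

definition separation_time :: "'a set set \<Rightarrow> ('a \<Rightarrow> 'a) \<Rightarrow> 'a \<Rightarrow> 'a \<Rightarrow> enat" where
  "separation_time \<D> g x y =
     (INF n \<in> {n. \<not> (\<exists>D\<in>\<D>. (g ^^ n) x \<in> D \<and> (g ^^ n) y \<in> D)}. enat n)"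

definition epower :: "real \<Rightarrow> enat \<Rightarrow> real" where
  "epower \<beta> s = (case s of enat n \<Rightarrow> \<beta> ^ n | \<infinity> \<Rightarrow> 0)"

definition full_branch_gibbs_markov :: "'y measure \<Rightarrow> 'y set set \<Rightarrow> ('y \<Rightarrow> 'y) \<Rightarrow> bool" where
  "full_branch_gibbs_markov \<mu>Y \<Y> F \<longleftrightarrow>
     countable \<Y> \<and> partition_on (space \<mu>Y) \<Y> \<and> \<Y> \<subseteq> sets \<mu>Y \<and> F \<in> measurable \<mu>Y \<mu>Y \<and>
     (\<forall>a\<in>\<Y>. bij_betw F a (space \<mu>Y) \<and> (\<forall>A\<in>sets \<mu>Y. A \<subseteq> a \<longrightarrow> F ` A \<in> sets \<mu>Y)) \<and>
     (\<forall>x\<in>space \<mu>Y. \<forall>y\<in>space \<mu>Y. separation_time \<Y> F x y = \<infinity> \<longrightarrow> x = y) \<and>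
     (\<exists>jac C \<theta>. jac \<in> borel_measurable \<mu>Y \<and> (\<forall>x\<in>space \<mu>Y. 0 < jac x) \<and> 0 < \<theta> \<and> \<theta> < 1 \<and>
        (\<forall>a\<in>\<Y>. \<forall>A\<in>sets \<mu>Y. A \<subseteq> a \<longrightarrow>
           emeasure \<mu>Y (F ` A) = (\<integral>\<^sup>+x\<in>A. ennreal (jac x) \<partial>\<mu>Y)) \<and>
        (\<forall>a\<in>\<Y>. \<forall>x\<in>a. \<forall>y\<in>a.
           \<bar>ln (jac x) - ln (jac y)\<bar> \<le> C * epower \<theta> (separation_time \<Y> F (F x) (F y))))"

definition one_dim_tower ::
  "'y measure \<Rightarrow> 'y set set \<Rightarrow> ('y \<Rightarrow> nat) \<Rightarrow> ('y \<Rightarrow> 'y) \<Rightarrow> ('y \<times> nat) measure \<Rightarrow> bool" where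
  "one_dim_tower \<mu>Y \<Y> \<sigma> F \<mu>\<Delta> \<longleftrightarrow>
     prob_space \<mu>Y \<and> full_branch_gibbs_markov \<mu>Y \<Y> F \<and>
     (\<forall>a\<in>\<Y>. \<exists>n\<ge>1. \<forall>y\<in>a. \<sigma> y = n) \<and>
     (\<exists>C \<theta>1. 0 < \<theta>1 \<and> \<theta>1 < 1 \<and> (\<forall>n. measure \<mu>Y {y \<in> space \<mu>Y. n < \<sigma> y} \<le> C * \<theta>1 ^ n)) \<and>
     prob_space \<mu>\<Delta> \<and>
     sets \<mu>\<Delta> = sets (restrict_space (\<mu>Y \<Otimes>\<^sub>M count_space UNIV) (tower (space \<mu>Y) \<sigma>)) \<and>
     (\<forall>A\<in>sets \<mu>Y. emeasure \<mu>Y A = emeasure \<mu>\<Delta> (A \<times> {0}) / emeasure \<mu>\<Delta> (space \<mu>Y \<times> {0})) \<and>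
     measure_preserving_map \<mu>\<Delta> \<mu>\<Delta> (tower_map \<sigma> F) \<and> mixing_map \<mu>\<Delta> (tower_map \<sigma> F)"

text \<open>The base map \<open>\<pi>\<close> identifies the points lying on the same stable curve.\<close>

definition collapses_stable_curves ::
  "'j set \<Rightarrow> ('j \<Rightarrow> plane set) \<Rightarrow> phase set set \<Rightarrow> phase set set \<Rightarrow> phase set set \<Rightarrow>
   (phase \<Rightarrow> nat) \<Rightarrow> (phase \<times> nat) measure \<Rightarrow> (phase \<Rightarrow> 'y) \<Rightarrow>
   'y measure \<Rightarrow> 'y set set \<Rightarrow> ('y \<Rightarrow> nat) \<Rightarrow> ('y \<Rightarrow> 'y) \<Rightarrow> ('y \<times> nat) measure \<Rightarrow> bool" where
  "collapses_stable_curves J Ob \<Gamma>u \<Gamma>s \<P> R \<mu>bar \<pi> \<mu>Y \<Y> \<sigma> F \<mu>\<Delta> \<longleftrightarrow>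
     (let \<Lambda> = product_set \<Gamma>u \<Gamma>s in
      \<pi> ` \<Lambda> = space \<mu>Y \<and>
      (\<forall>x\<in>\<Lambda>. \<forall>x'\<in>\<Lambda>. \<pi> x = \<pi> x' \<longleftrightarrow> (\<exists>\<gamma>\<in>\<Gamma>s. x \<in> \<gamma> \<and> x' \<in> \<gamma>)) \<and>
      \<Y> = (`) \<pi> ` \<P> \<and>
      (\<forall>x\<in>\<Lambda>. \<sigma> (\<pi> x) = R x \<and> F (\<pi> x) = \<pi> (return_map J Ob R x)) \<and>
      measure_preserving_map \<mu>bar \<mu>\<Delta> (map_prod \<pi> id))"

text \<open>
  Young's Markov partition of the tower: its elements are contained in floors and are unions of
  copies of atoms of \<open>\<Y>\<close>; each of them is mapped to a union of elements of the next floor and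
  contains at most one atom returning to the base at the next step.
\<close>

definition young_partition ::
  "'y set \<Rightarrow> 'y set set \<Rightarrow> ('y \<Rightarrow> nat) \<Rightarrow> ('y \<Rightarrow> 'y) \<Rightarrow> ('y \<times> nat) set set \<Rightarrow> bool" where
  "young_partition Y \<Y> \<sigma> F \<D> \<longleftrightarrow>
     partition_on (tower Y \<sigma>) \<D> \<and>
     (\<forall>D\<in>\<D>. \<exists>l. D \<subseteq> Y \<times> {l}) \<and>
     (\<forall>a\<in>\<Y>. \<forall>y\<in>a. \<forall>l<\<sigma> y. \<exists>D\<in>\<D>. a \<times> {l} \<subseteq> D) \<and>
     (\<forall>D\<in>\<D>. \<exists>\<D>'\<subseteq>\<D>. tower_map \<sigma> F ` {z \<in> D. Suc (snd z) < \<sigma> (fst z)} = \<Union>\<D>') \<and>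
     (\<forall>D\<in>\<D>. \<exists>a\<in>\<Y>. {z \<in> D. Suc (snd z) = \<sigma> (fst z)} \<subseteq> a \<times> UNIV)"


section \<open>Function spaces and operators\<close>

text \<open>
  Functions are identified when they agree almost everywhere. Norms take values in \<open>ennreal\<close> and
  are \<open>\<infinity>\<close> outside the space; \<open>0 / 0 = 0\<close> in the Lipschitz quotients on the diagonal.
\<close>

type_synonym 'a operator = "('a \<Rightarrow> complex) \<Rightarrow> 'a \<Rightarrow> complex"

definition Lp_norm :: "'a measure \<Rightarrow> real \<Rightarrow> ('a \<Rightarrow> complex) \<Rightarrow> ennreal" where
  "Lp_norm M p h =
     (let I = (\<integral>\<^sup>+x. ennreal (cmod (h x) powr p) \<partial>M) in
      if h \<notin> borel_measurable M \<or> I = \<infinity> then \<infinity> else ennreal (enn2real I powr (1 / p)))"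

definition lipschitz_quotient ::
  "real \<Rightarrow> ('a \<Rightarrow> 'a \<Rightarrow> enat) \<Rightarrow> ('a \<Rightarrow> complex) \<Rightarrow> 'a \<Rightarrow> 'a \<Rightarrow> ennreal" where
  "lipschitz_quotient \<beta> s0 h x y =
     (if s0 x y \<ge> 1 then ennreal (cmod (h x - h y)) / ennreal (epower \<beta> (s0 x y)) else 0)"

definition B0_norm ::
  "'a measure \<Rightarrow> real \<Rightarrow> ('a \<Rightarrow> 'a \<Rightarrow> enat) \<Rightarrow> ('a \<Rightarrow> complex) \<Rightarrow> ennreal" where
  "B0_norm M \<beta> s0 h =
     (if h \<in> borel_measurable M
      then esssup M (\<lambda>x. ennreal (cmod (h x))) +
           esssup (M \<Otimes>\<^sub>M M) (\<lambda>(x, y). lipschitz_quotient \<beta> s0 h x y)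
      else \<infinity>)"

definition B_norm ::
  "('y \<times> nat) measure \<Rightarrow> real \<Rightarrow> ('y \<times> nat \<Rightarrow> 'y \<times> nat \<Rightarrow> enat) \<Rightarrow> real \<Rightarrow>
   ('y \<times> nat \<Rightarrow> complex) \<Rightarrow> ennreal" where
  "B_norm M \<beta> s0 \<epsilon> h =
     (if h \<in> borel_measurable M
      then (SUP l. ennreal (exp (- real l * \<epsilon>)) *
             (esssup M (\<lambda>x. if snd x = l then ennreal (cmod (h x)) else 0) +
              esssup (M \<Otimes>\<^sub>M M)
                (\<lambda>(x, y). if snd x = l \<and> snd y = l then lipschitz_quotient \<beta> s0 h x y else 0)))
      else \<infinity>)"

text \<open>A Banach space of functions is given by its norm \<open>N\<close> and consists of all \<open>h\<close> with \<open>N h < \<infinity>\<close>.\<close>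

definition op_norm ::
  "(('a \<Rightarrow> complex) \<Rightarrow> ennreal) \<Rightarrow> (('a \<Rightarrow> complex) \<Rightarrow> ennreal) \<Rightarrow> 'a operator \<Rightarrow> ennreal" where
  "op_norm N1 N2 A = (SUP h \<in> {h. N1 h \<le> 1}. N2 (A h))"

definition bounded_operator ::
  "'a measure \<Rightarrow> (('a \<Rightarrow> complex) \<Rightarrow> ennreal) \<Rightarrow> (('a \<Rightarrow> complex) \<Rightarrow> ennreal) \<Rightarrow>
   'a operator \<Rightarrow> bool" where
  "bounded_operator M N1 N2 A \<longleftrightarrow>
     (\<forall>g h a b. N1 g < \<infinity> \<longrightarrow> N1 h < \<infinity> \<longrightarrow>
        (AE x in M. A (\<lambda>x. a * g x + b * h x) x = a * A g x + b * A h x)) \<and>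
     (\<forall>h. N1 h < \<infinity> \<longrightarrow> N2 (A h) < \<infinity>) \<and> op_norm N1 N2 A < \<infinity>"

definition transfer_op :: "'a set \<Rightarrow> ('a \<Rightarrow> 'a) \<Rightarrow> ('a \<Rightarrow> real) \<Rightarrow> 'a operator" where
  "transfer_op X g \<alpha> h x = (\<Sum>\<^sub>\<infinity>y\<in>{y \<in> X. g y = x}. of_real (exp (- \<alpha> y)) * h y)"

definition is_transfer_op :: "'a measure \<Rightarrow> ('a \<Rightarrow> 'a) \<Rightarrow> 'a operator \<Rightarrow> bool" where
  "is_transfer_op M g P \<longleftrightarrow> (\<forall>h. integrable M h \<longrightarrow> integrable M (P h) \<and>
     (\<forall>w\<in>borel_measurable M. (\<exists>K. \<forall>x\<in>space M. cmod (w x) \<le> K) \<longrightarrow>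
        (\<integral>x. P h x * w x \<partial>M) = (\<integral>x. h x * w (g x) \<partial>M)))"

definition twisted_op :: "'a operator \<Rightarrow> ('a \<Rightarrow> plane) \<Rightarrow> plane \<Rightarrow> 'a operator" where
  "twisted_op P k t h = P (\<lambda>x. cis (t \<bullet> k x) * h x)"

definition op_spectrum ::
  "'a measure \<Rightarrow> (('a \<Rightarrow> complex) \<Rightarrow> ennreal) \<Rightarrow> 'a operator \<Rightarrow> complex set" where
  "op_spectrum M N A =
     {\<xi>. \<not> (\<exists>S. bounded_operator M N N S \<and> (\<forall>h. N h < \<infinity> \<longrightarrow>
            (AE x in M. \<xi> * S h x - A (S h) x = h x) \<and>
            (AE x in M. S (\<lambda>x. \<xi> * h x - A h x) x = h x)))}"

definition dominating_simple_eigenvalue ::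
  "'a measure \<Rightarrow> (('a \<Rightarrow> complex) \<Rightarrow> ennreal) \<Rightarrow> 'a operator \<Rightarrow> complex \<Rightarrow> bool" where
  "dominating_simple_eigenvalue M N A lam \<longleftrightarrow>
     (\<exists>v. N v < \<infinity> \<and> \<not> (AE x in M. v x = 0) \<and> (AE x in M. A v x = lam * v x) \<and>
        (\<forall>h k. N h < \<infinity> \<longrightarrow> (AE x in M. ((\<lambda>g x. A g x - lam * g x) ^^ k) h x = 0) \<longrightarrow>
           (\<exists>b. AE x in M. h x = b * v x))) \<and>
     (\<forall>\<xi>\<in>op_spectrum M N A. \<xi> \<noteq> lam \<longrightarrow> cmod \<xi> < cmod lam)"

definition eigenprojector ::
  "'a measure \<Rightarrow> (('a \<Rightarrow> complex) \<Rightarrow> ennreal) \<Rightarrow> 'a operator \<Rightarrow> complex \<Rightarrow> 'a operator \<Rightarrow> bool" where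
  "eigenprojector M N A lam E \<longleftrightarrow>
     bounded_operator M N N E \<and>
     (\<forall>h. N h < \<infinity> \<longrightarrow>
        (AE x in M. E (E h) x = E h x) \<and> (AE x in M. E (A h) x = A (E h) x) \<and>
        ((AE x in M. E h x = h x) \<longleftrightarrow> (AE x in M. A h x = lam * h x)))"

definition square :: "real \<Rightarrow> plane set" where
  "square b = {t. \<forall>i. \<bar>t $ i\<bar> \<le> b}"

definition spectral_decomposition ::
  "'a measure \<Rightarrow> (('a \<Rightarrow> complex) \<Rightarrow> ennreal) \<Rightarrow> (plane \<Rightarrow> 'a operator) \<Rightarrow>
   real \<Rightarrow> real \<Rightarrow> (plane \<Rightarrow> complex) \<Rightarrow> (plane \<Rightarrow> 'a operator) \<Rightarrow> (plane \<Rightarrow> 'a operator) \<Rightarrow> bool" where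
  "spectral_decomposition M N Pt \<beta>0 \<theta> lam Pr Nt \<longleftrightarrow>
     0 < \<beta>0 \<and> \<beta>0 \<le> pi \<and> 0 < \<theta> \<and> \<theta> < 1 \<and>
     (\<forall>t\<in>square pi. bounded_operator M N N (Pt t)) \<and>
     (\<forall>t\<in>square \<beta>0.
        dominating_simple_eigenvalue M N (Pt t) (lam t) \<and> eigenprojector M N (Pt t) (lam t) (Pr t) \<and>
        bounded_operator M N N (Nt t) \<and>
        (\<forall>n\<ge>1. \<forall>h. N h < \<infinity> \<longrightarrow>
           (AE x in M. (Pt t ^^ n) h x = lam t ^ n * Pr t h x + (Nt t ^^ n) h x))) \<and>
     (\<exists>C. \<forall>n. (SUP t \<in> square \<beta>0. op_norm N N (Nt t ^^ n)) +
               (SUP t \<in> square pi - square \<beta>0. op_norm N N (Pt t ^^ n)) \<le> ennreal (C * \<theta> ^ n)) \<and>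
     lam 0 = 1 \<and>
     (\<forall>h. N h < \<infinity> \<longrightarrow> (AE x in M. Pr 0 h x = (\<integral>y. h y \<partial>M))) \<and>
     ((\<lambda>t. op_norm N (Lp_norm M 1) (\<lambda>h x. Pr t h x - Pr 0 h x)) \<longlongrightarrow> 0) (at 0)"

end

theory Submission
  imports Defs "HOL-Real_Asymp.Real_Asymp"
begin

text \<open>
  Only two properties of the tower are used: the uniform spectral gap of the twisted operators on
  \<open>\<B>\<close>, and \<open>\<kappa> \<in> L\<^sup>s\<close> for all \<open>s < 2\<close>. Let \<open>S\<^sub>n\<close> be the Birkhoff sum of \<open>\<kappa>\<close> and
  \<open>A\<^sub>n h = \<i> (P\<^sup>n (S\<^sub>n h) - n \<integral>\<kappa> \<integral>h)\<close>. Since \<open>|e\<^sup>i\<^sup>u - 1 - \<i> u| \<le> 2 |u|\<^sup>\<gamma>\<close> and \<open>P\<close> contracts \<open>L\<^sup>s\<close>,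
  expanding \<open>P\<^sub>t\<^sup>n h = P\<^sup>n (e\<^sup>i\<^sup>t\<^sup>S h)\<close> gives \<open>lam\<^sub>t\<^sup>n \<Pi>\<^sub>t h = \<integral>h + \<i> t P\<^sup>n (S\<^sub>n h) + O((n|t|)\<^sup>\<gamma> + \<theta>\<^sup>n)\<close> in \<open>L\<^sup>s\<close>
  whenever \<open>\<gamma> s < 2\<close>. Applied to \<open>h = 1\<close> with \<open>n\<close> and \<open>2 n\<close> this determines \<open>lam\<^sub>t\<^sup>n\<close>, whence
  \<open>\<Pi>\<^sub>t h = \<integral>h + t A\<^sub>n h + O((n|t|)\<^sup>\<gamma> + \<theta>\<^sup>n)\<close>. Comparing \<open>n\<close> and \<open>n + 1\<close> for \<open>t\<close> exponentially small in
  \<open>n\<close> shows that \<open>A\<^sub>n\<close> converges exponentially fast; its limit is \<open>\<Pi>\<^sub>0'\<close>, and \<open>n\<close> of order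
  \<open>ln (1/|t|)\<close> gives the theorem.

  The integrability of \<open>\<kappa>\<close> follows from a tail of order \<open>R\<^sup>-\<^sup>2\<close>. A free segment of length \<open>R\<close> is within
  an angle \<open>O(1/R)\<close> of one of finitely many lattice directions \<open>w\<close>. Translating its obstacle by \<open>w\<close>
  shows that the obstacle lies on one side of a line at distance \<open>O(1/R)\<close> from the starting point,
  so that \<open>cos \<phi> = O(R\<^sup>-\<^sup>1\<^sup>/\<^sup>2)\<close> there and, the curvature being nonzero, the starting points have
  length \<open>O(R\<^sup>-\<^sup>1\<^sup>/\<^sup>2)\<close>.
\<close>

section \<open>Bounds in \<open>L\<^sup>p\<close>\<close>

text \<open>The operator \<open>Pr'\<close> has to be chosen before \<open>p\<close>,
  \<open>\<epsilon>\<close> and the spectral data. It is therefore a limit of quantities built from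
  \<open>P\<close>, \<open>f\<close> and \<open>\<kappa>\<close> alone; a spectral decomposition
  only serves to show that the limit exists, and if there is no admissible decomposition at all, the
  zero operator will do. The given convergence of \<open>\<Pi>_t\<close> to \<open>\<Pi>_0\<close>
  comes without a rate, so the mean of \<open>\<Pi>_t 1\<close> is an unknown that has to be
  eliminated: this is what the pair \<open>n\<close>, \<open>2 n\<close> is for. The condition
  \<gamma> s < 2 expresses that |S_n|^\<gamma> lies in L^s when \<kappa> has all moments of order
  below 2. The exponents of the theorem satisfy it, because 4/p' - 2 \<le> 2/p' for p' \<ge> 1.
  Taking n of order ln (1/|t|) loses a power of a logarithm, which is recovered by working with an
  exponent slightly larger than the desired one.\<close>

definition Lp_bounded :: "'a measure \<Rightarrow> real \<Rightarrow> ('a \<Rightarrow> complex) \<Rightarrow> real \<Rightarrow> bool" where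
  "Lp_bounded M s h b \<longleftrightarrow> h \<in> borel_measurable M \<and> 0 < b \<and>
     (\<integral>\<^sup>+x. ennreal (cmod (h x) powr s) \<partial>M) \<le> ennreal (b powr s)"

lemma Lp_boundedD:
  assumes "Lp_bounded M s h b"
  shows "h \<in> borel_measurable M" "0 < b"
    "(\<integral>\<^sup>+x. ennreal (cmod (h x) powr s) \<partial>M) \<le> ennreal (b powr s)"
  using assms by (auto simp: Lp_bounded_def)

text \<open>Estimates are carried as real bounds on integrals, which are added and scaled without
  leaving the reals; only final statements return to \<open>Lp_norm\<close>. The bound is kept
  strictly positive so that one can divide by it, hence even the zero function gets a positive
  bound.\<close>

lemma Lp_norm_le:
  assumes "Lp_bounded M s h b" "1 \<le> s"
  shows "Lp_norm M s h \<le> ennreal b"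
proof -
  define I where "I = (\<integral>\<^sup>+x. ennreal (cmod (h x) powr s) \<partial>M)"
  have I: "I \<le> ennreal (b powr s)" "0 < b" "h \<in> borel_measurable M"
    using Lp_boundedD[OF assms(1)] by (auto simp: I_def)
  then have "I \<noteq> \<infinity>" by (auto simp: top_unique)
  have "enn2real I \<le> b powr s"
    using I by (simp add: enn2real_leI)
  then have "enn2real I powr (1 / s) \<le> (b powr s) powr (1 / s)"
    using assms(2) by (intro powr_mono2) auto
  also have "\<dots> = b" using I(2) assms(2) by (simp add: powr_powr)
  finally show ?thesis
    using I \<open>I \<noteq> \<infinity>\<close> by (simp add: Lp_norm_def Let_def I_def[symmetric] ennreal_leI)
qed

lemma Lp_bounded_dominated:
  assumes "Lp_bounded M s h b" "g \<in> borel_measurable M" "AE x in M. cmod (g x) \<le> cmod (h x)" "0 \<le> s"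
  shows "Lp_bounded M s g b"
proof -
  have "(\<integral>\<^sup>+x. ennreal (cmod (g x) powr s) \<partial>M) \<le> (\<integral>\<^sup>+x. ennreal (cmod (h x) powr s) \<partial>M)"
    using assms(3) by (intro nn_integral_mono_AE) (auto intro!: ennreal_leI powr_mono2 assms(4))
  then show ?thesis
    using assms(2) Lp_boundedD[OF assms(1)] unfolding Lp_bounded_def by (auto intro: order_trans)
qed

lemma Lp_bounded_cong_AE:
  assumes "Lp_bounded M s h b" "g \<in> borel_measurable M" "AE x in M. g x = h x" "0 \<le> s"
  shows "Lp_bounded M s g b"
  by (rule Lp_bounded_dominated[OF assms(1,2) _ assms(4)]) (use assms(3) in auto)

lemma Lp_bounded_scale:
  assumes "Lp_bounded M s h b" "cmod c * b \<le> d" "0 < d" "0 \<le> s"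
  shows "Lp_bounded M s (\<lambda>x. c * h x) d"
proof -
  note h = Lp_boundedD[OF assms(1)]
  have "(\<integral>\<^sup>+x. ennreal (cmod (c * h x) powr s) \<partial>M)
      = (\<integral>\<^sup>+x. ennreal (cmod c powr s) * ennreal (cmod (h x) powr s) \<partial>M)"
    by (intro nn_integral_cong) (simp add: norm_mult powr_mult ennreal_mult)
  also have "\<dots> = ennreal (cmod c powr s) * (\<integral>\<^sup>+x. ennreal (cmod (h x) powr s) \<partial>M)"
    using h(1) by (intro nn_integral_cmult) measurable
  also have "\<dots> \<le> ennreal (cmod c powr s) * ennreal (b powr s)"
    by (intro mult_left_mono h) auto
  also have "\<dots> = ennreal ((cmod c * b) powr s)"
    using h by (simp add: powr_mult ennreal_mult)
  also have "\<dots> \<le> ennreal (d powr s)"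
    using assms h by (intro ennreal_leI powr_mono2) auto
  finally show ?thesis using h(1) assms(3) unfolding Lp_bounded_def by auto
qed

lemma Lp_bounded_mono:
  assumes "Lp_bounded M s h b" "b \<le> d" "0 \<le> s"
  shows "Lp_bounded M s h d"
  using Lp_bounded_scale[OF assms(1), of 1 d] assms Lp_boundedD(2)[OF assms(1)] by auto

text \<open>For positive \<open>u\<close> and \<open>v\<close> this is convexity on the open
  half-line. If one of them vanishes, what remains is (c w)^s = c^s w^s \<le> c w^s, true since 0
  \<le> c \<le> 1 \<le> s.\<close>

lemma powr_convex_combination:
  fixes u v l s :: real
  assumes "0 \<le> u" "0 \<le> v" "0 \<le> l" "l \<le> 1" "1 \<le> s"
  shows "(l * u + (1 - l) * v) powr s \<le> l * u powr s + (1 - l) * v powr s"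
proof -
  have shrink: "(c * w) powr s \<le> c * w powr s" if "0 \<le> c" "c \<le> 1" "0 \<le> w" for c w :: real
  proof (cases "c = 0")
    case False
    have "c powr s \<le> c powr 1"
      using that False assms(5) by (intro powr_mono') auto
    then show ?thesis using that False
      by (simp add: powr_mult mult_right_mono)
  qed simp
  show ?thesis
  proof (cases "u = 0 \<or> v = 0")
    case True
    then show ?thesis using shrink[of l u] shrink[of "1 - l" v] assms by auto
  next
    case False
    then have "u \<in> {0<..}" "v \<in> {0<..}" using assms by auto
    from convex_onD[OF powr_convex[OF assms(5)] _ _ this, of "1 - l"] show ?thesis
      using assms by simp
  qed
qed

text \<open>Minkowski's inequality by convexity: (|g| + |h|) / (a + b) is the convex combination of
  |g| / a and |h| / b with weights a / (a + b) and b / (a + b), and both normalised functions have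
  s-th moment at most 1.\<close>

lemma Lp_bounded_add:
  assumes "Lp_bounded M s g a" "Lp_bounded M s h b" "1 \<le> s"
  shows "Lp_bounded M s (\<lambda>x. g x + h x) (a + b)"
proof -
  note g = Lp_boundedD[OF assms(1)] and h = Lp_boundedD[OF assms(2)]
  have [measurable]: "g \<in> borel_measurable M" "h \<in> borel_measurable M" using g h by auto
  define l where "l = a / (a + b)"
  have l: "0 \<le> l" "l \<le> 1" "1 - l = b / (a + b)"
    using g h by (auto simp: l_def field_simps)
  define A where "A = l * (a + b) powr s / a powr s"
  define B where "B = (1 - l) * (a + b) powr s / b powr s"
  have AB: "0 \<le> A" "0 \<le> B" using l g(2) h(2) by (auto simp: A_def B_def)
  have pt: "cmod (g x + h x) powr s \<le> A * cmod (g x) powr s + B * cmod (h x) powr s" for x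
  proof -
    have "cmod (g x + h x) powr s \<le> (cmod (g x) + cmod (h x)) powr s"
      using assms(3) by (intro powr_mono2 norm_triangle_ineq) auto
    also have "cmod (g x) + cmod (h x) = (a + b) * (l * (cmod (g x) / a) + (1 - l) * (cmod (h x) / b))"
    proof -
      have "l * (cmod (g x) / a) = cmod (g x) / (a + b)" "(1 - l) * (cmod (h x) / b) = cmod (h x) / (a + b)"
        using g(2) h(2) by (auto simp: l(3)) (auto simp: l_def)
      then show ?thesis using g(2) h(2) by (simp add: add_divide_distrib[symmetric])
    qed
    also have "\<dots> powr s = (a + b) powr s * (l * (cmod (g x) / a) + (1 - l) * (cmod (h x) / b)) powr s"
      using g(2) h(2) l by (subst powr_mult) auto
    also have "\<dots> \<le> (a + b) powr s * (l * (cmod (g x) / a) powr s + (1 - l) * (cmod (h x) / b) powr s)"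
      using g(2) h(2) l assms(3) by (intro mult_left_mono powr_convex_combination) auto
    also have "\<dots> = A * cmod (g x) powr s + B * cmod (h x) powr s"
      using g(2) h(2) by (simp add: A_def B_def powr_divide algebra_simps)
    finally show ?thesis .
  qed
  have "(\<integral>\<^sup>+x. ennreal (cmod (g x + h x) powr s) \<partial>M)
     \<le> (\<integral>\<^sup>+x. ennreal A * ennreal (cmod (g x) powr s) + ennreal B * ennreal (cmod (h x) powr s) \<partial>M)"
    using pt AB by (intro nn_integral_mono)
      (simp add: ennreal_mult[symmetric] ennreal_plus[symmetric] del: ennreal_plus)
  also have "\<dots> = ennreal A * (\<integral>\<^sup>+x. ennreal (cmod (g x) powr s) \<partial>M)
      + ennreal B * (\<integral>\<^sup>+x. ennreal (cmod (h x) powr s) \<partial>M)"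
    by (subst nn_integral_add) (auto simp: nn_integral_cmult)
  also have "\<dots> \<le> ennreal A * ennreal (a powr s) + ennreal B * ennreal (b powr s)"
    by (intro add_mono mult_left_mono g h) auto
  also have "\<dots> = ennreal (A * a powr s + B * b powr s)"
    using AB by (simp add: ennreal_mult)
  also have "A * a powr s + B * b powr s = (a + b) powr s"
  proof -
    have "A * a powr s = l * (a + b) powr s" "B * b powr s = (1 - l) * (a + b) powr s"
      using g(2) h(2) by (auto simp: A_def B_def)
    then show ?thesis by (simp add: algebra_simps)
  qed
  finally show ?thesis using g(2) h(2) unfolding Lp_bounded_def by auto
qed

lemma Lp_bounded_diff:
  assumes "Lp_bounded M s g a" "Lp_bounded M s h b" "1 \<le> s"
  shows "Lp_bounded M s (\<lambda>x. g x - h x) (a + b)"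
proof -
  have "Lp_bounded M s (\<lambda>x. - h x) b"
    using Lp_boundedD[OF assms(2)] by (auto simp: Lp_bounded_def)
  from Lp_bounded_add[OF assms(1) this assms(3)] show ?thesis by simp
qed

lemma Lp_bounded_sum:
  assumes "finite I" "I \<noteq> {}" "\<And>i. i \<in> I \<Longrightarrow> Lp_bounded M s (g i) (b i)" "1 \<le> s"
  shows "Lp_bounded M s (\<lambda>x. \<Sum>i\<in>I. g i x) (\<Sum>i\<in>I. b i)"
  using assms(1,2,3)
proof (induction rule: finite_ne_induct)
  case (insert i I)
  have "Lp_bounded M s (\<lambda>x. g i x + (\<Sum>i\<in>I. g i x)) (b i + (\<Sum>i\<in>I. b i))"
    by (rule Lp_bounded_add[OF _ _ assms(4)]) (use insert in auto)
  then show ?case using insert by simp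
qed simp

lemma (in prob_space) Lp_bounded_const:
  assumes "cmod c \<le> b" "0 < b" "0 \<le> s"
  shows "Lp_bounded M s (\<lambda>_. c) b"
  using assms by (auto simp: Lp_bounded_def emeasure_space_1 intro!: ennreal_leI powr_mono2)

lemma (in prob_space) Lp_bounded_AE:
  assumes "h \<in> borel_measurable M" "AE x in M. cmod (h x) \<le> b" "0 < b" "0 \<le> s"
  shows "Lp_bounded M s h b"
  by (rule Lp_bounded_dominated[OF Lp_bounded_const[of "of_real b" b]]) (use assms in auto)

lemma (in prob_space) Lp_bounded_integrable:
  assumes "Lp_bounded M s h b" "1 \<le> s"
  shows "integrable M h" "(\<integral>x. cmod (h x) \<partial>M) \<le> b" "cmod (\<integral>x. h x \<partial>M) \<le> b"
proof -
  note h = Lp_boundedD[OF assms(1)]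
  have [measurable]: "h \<in> borel_measurable M" by (rule h)
  \<comment> \<open>convexity gives \<open>z \<le> 1 - 1 / s + z\<^sup>s / s\<close>, applied to \<open>z = |h| / b\<close>\<close>
  have young: "z \<le> z powr s / s + (1 - 1 / s)" if "0 \<le> z" for z :: real
  proof (cases "s = 1")
    case False
    then have s: "1 < s" using assms(2) by auto
    have "z * 1 \<le> z powr s / s + 1 powr (1 / (1 - 1 / s)) / (1 / (1 - 1 / s))"
      using s that by (intro Youngs_inequality) (auto simp: field_simps)
    then show ?thesis by simp
  qed (use that in auto)
  have "(\<integral>\<^sup>+x. ennreal (cmod (h x)) \<partial>M)
     \<le> (\<integral>\<^sup>+x. ennreal (b / (s * b powr s)) * ennreal (cmod (h x) powr s) + ennreal (b * (1 - 1 / s)) \<partial>M)"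
  proof (intro nn_integral_mono)
    fix x
    have "cmod (h x) = b * (cmod (h x) / b)" using h(2) by simp
    also have "\<dots> \<le> b * ((cmod (h x) / b) powr s / s + (1 - 1 / s))"
      using h(2) by (intro mult_left_mono young) auto
    also have "\<dots> = b / (s * b powr s) * cmod (h x) powr s + b * (1 - 1 / s)"
      using h(2) by (simp add: powr_divide field_simps)
    finally show "ennreal (cmod (h x))
        \<le> ennreal (b / (s * b powr s)) * ennreal (cmod (h x) powr s) + ennreal (b * (1 - 1 / s))"
      using h(2) assms(2)
      by (simp add: ennreal_mult[symmetric] ennreal_plus[symmetric] divide_le_eq_1 ennreal_leI
          del: ennreal_plus)
  qed
  also have "\<dots> = ennreal (b / (s * b powr s)) * (\<integral>\<^sup>+x. ennreal (cmod (h x) powr s) \<partial>M) + ennreal (b * (1 - 1 / s))"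
    by (subst nn_integral_add) (auto simp: nn_integral_cmult emeasure_space_1)
  also have "\<dots> \<le> ennreal (b / (s * b powr s)) * ennreal (b powr s) + ennreal (b * (1 - 1 / s))"
    by (intro add_mono mult_left_mono h) auto
  also have "\<dots> = ennreal (b / (s * b powr s) * b powr s + b * (1 - 1 / s))"
    using h(2) assms(2) by (simp add: ennreal_mult[symmetric])
  also have "b / (s * b powr s) * b powr s + b * (1 - 1 / s) = b"
    using h(2) assms(2) by (simp add: field_simps)
  finally have le: "(\<integral>\<^sup>+x. ennreal (cmod (h x)) \<partial>M) \<le> ennreal b" .
  then show int: "integrable M h"
    by (intro integrableI_bounded) (auto intro: le_less_trans)
  have "ennreal (\<integral>x. cmod (h x) \<partial>M) = (\<integral>\<^sup>+x. ennreal (cmod (h x)) \<partial>M)"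
    using int by (intro nn_integral_eq_integral[symmetric]) auto
  with le h(2) show le': "(\<integral>x. cmod (h x) \<partial>M) \<le> b"
    by (metis ennreal_le_iff less_imp_le)
  then show "cmod (\<integral>x. h x \<partial>M) \<le> b"
    using integral_norm_bound[of M h] by linarith
qed

lemma Lp_bounded_Fatou:
  assumes "\<And>n. Lp_bounded M s (g n) b" "h \<in> borel_measurable M"
    and "AE x in M. (\<lambda>n. g n x) \<longlonglongrightarrow> h x" "0 < s"
  shows "Lp_bounded M s h b"
proof -
  have [measurable]: "\<And>n. g n \<in> borel_measurable M" using Lp_boundedD[OF assms(1)] by auto
  have "(\<integral>\<^sup>+x. ennreal (cmod (h x) powr s) \<partial>M)
      = (\<integral>\<^sup>+x. liminf (\<lambda>n. ennreal (cmod (g n x) powr s)) \<partial>M)"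
  proof (intro nn_integral_cong_AE, use assms(3) in eventually_elim)
    fix x assume "(\<lambda>n. g n x) \<longlonglongrightarrow> h x"
    then have "(\<lambda>n. cmod (g n x)) \<longlonglongrightarrow> cmod (h x)" by (rule tendsto_norm)
    then have "(\<lambda>n. cmod (g n x) powr s) \<longlonglongrightarrow> cmod (h x) powr s"
      using assms(4) by (intro tendsto_powr') auto
    then have "(\<lambda>n. ennreal (cmod (g n x) powr s)) \<longlonglongrightarrow> ennreal (cmod (h x) powr s)"
      by (rule tendsto_ennrealI)
    from lim_imp_Liminf[OF _ this]
    show "ennreal (cmod (h x) powr s) = liminf (\<lambda>n. ennreal (cmod (g n x) powr s))" by simp
  qed
  also have "\<dots> \<le> liminf (\<lambda>n. \<integral>\<^sup>+x. ennreal (cmod (g n x) powr s) \<partial>M)"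
    by (intro nn_integral_liminf) measurable
  also have "\<dots> \<le> liminf (\<lambda>n. ennreal (b powr s))"
    by (intro Liminf_mono always_eventually allI Lp_boundedD[OF assms(1)])
  also have "\<dots> = ennreal (b powr s)" by (simp add: Liminf_const)
  finally show ?thesis using assms(2) Lp_boundedD(2)[OF assms(1)] unfolding Lp_bounded_def by auto
qed

section \<open>Transfer operators\<close>

lemma integrable_mult_bounded:
  fixes g w :: "'a \<Rightarrow> complex"
  assumes "integrable M g" "w \<in> borel_measurable M" "\<And>x. cmod (w x) \<le> 1"
  shows "integrable M (\<lambda>x. g x * w x)"
  by (rule Bochner_Integration.integrable_bound[OF assms(1)])
    (use assms in \<open>auto simp: norm_mult intro!: mult_left_le\<close>)

text \<open>Testing against the conjugate phase of \<open>g - h\<close> turns the difference of the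
  two integrals into the integral of |g - h|.\<close>

lemma AE_eq_of_integrals_eq:
  fixes g h :: "'a \<Rightarrow> complex"
  assumes "integrable M g" "integrable M h"
    and "\<And>w. w \<in> borel_measurable M \<Longrightarrow> (\<And>x. cmod (w x) \<le> 1) \<Longrightarrow> (\<integral>x. g x * w x \<partial>M) = (\<integral>x. h x * w x \<partial>M)"
  shows "AE x in M. g x = h x"
proof -
  have [measurable]: "g \<in> borel_measurable M" "h \<in> borel_measurable M" using assms by auto
  define d where "d x = g x - h x" for x
  define w where "w x = cnj (d x) / of_real (cmod (d x))" for x
  have dm [measurable]: "d \<in> borel_measurable M" unfolding d_def by measurable
  have [measurable]: "w \<in> borel_measurable M"
    unfolding w_def by (intro borel_measurable_divide borel_measurable_of_real borel_measurable_norm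
        measurable_compose[OF dm] borel_measurable_continuous_onI continuous_intros)
  have w1: "cmod (w x) \<le> 1" for x
    by (simp add: w_def norm_divide)
  have int: "integrable M d" unfolding d_def using assms by auto
  have "integrable M (\<lambda>x. g x * w x)" "integrable M (\<lambda>x. h x * w x)"
    using assms(1,2) w1 by (auto intro!: integrable_mult_bounded)
  then have "(\<integral>x. d x * w x \<partial>M) = 0"
    using assms(3)[of w] w1 by (simp add: d_def algebra_simps)
  moreover have "d x * w x = of_real (cmod (d x))" for x
    by (cases "d x = 0") (simp_all add: w_def complex_norm_square[symmetric] power2_eq_square)
  ultimately have "(\<integral>x. cmod (d x) \<partial>M) = 0" by simp
  then have "AE x in M. cmod (d x) = 0"
    by (subst (asm) integral_nonneg_eq_0_iff_AE) (use int in auto)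
  then show ?thesis by (auto simp: d_def)
qed

text \<open>The operator enters through duality with composition by \<open>f\<close>. Its pointwise
  series is used in one place only, for the measurability of the displacement.\<close>

locale transfer_system = prob_space M for M :: "'a measure" +
  fixes f :: "'a \<Rightarrow> 'a" and P :: "'a operator"
  assumes f_measurable [measurable]: "f \<in> measurable M M"
    and f_invariant: "distr M M f = M"
    and transfer: "is_transfer_op M f P"
begin

lemma transfer_integrable: "integrable M h \<Longrightarrow> integrable M (P h)"
  using transfer by (auto simp: is_transfer_op_def)

lemma transfer_duality:
  assumes "integrable M h" "w \<in> borel_measurable M" "\<And>x. x \<in> space M \<Longrightarrow> cmod (w x) \<le> K"
  shows "(\<integral>x. P h x * w x \<partial>M) = (\<integral>x. h x * w (f x) \<partial>M)"
  using transfer assms unfolding is_transfer_op_def by blast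

lemma integral_invariant:
  fixes g :: "'a \<Rightarrow> real"
  assumes "g \<in> borel_measurable M"
  shows "(\<integral>x. g (f x) \<partial>M) = (\<integral>x. g x \<partial>M)"
  using integral_distr[OF f_measurable assms] f_invariant by simp

lemma Lp_bounded_compose:
  assumes "Lp_bounded M s h b"
  shows "Lp_bounded M s (\<lambda>x. h (f x)) b"
proof -
  have [measurable]: "h \<in> borel_measurable M" using Lp_boundedD[OF assms] by auto
  have "(\<integral>\<^sup>+x. ennreal (cmod (h (f x)) powr s) \<partial>M) = (\<integral>\<^sup>+x. ennreal (cmod (h x) powr s) \<partial>distr M M f)"
    by (subst nn_integral_distr) auto
  then show ?thesis using Lp_boundedD[OF assms] by (auto simp: Lp_bounded_def f_invariant)
qed

text \<open>Contraction by duality: P h is tested against its conjugate phase times the (s - 1)-th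
  power of its modulus. Young's inequality with exponents s and s / (s - 1), followed by invariance
  of the measure, reproduces the left-hand integral with the factor 1 - 1/s, and it is absorbed.
  Absorbing requires a finite integral, hence the truncation at \<open>k\<close>, which Fatou's
  lemma removes in the end.\<close>

lemma Lp_bounded_transfer:
  assumes "Lp_bounded M s h b" "1 \<le> s"
  shows "Lp_bounded M s (P h) b"
proof -
  note h = Lp_boundedD[OF assms(1)]
  have [measurable]: "h \<in> borel_measurable M" by (rule h)
  have inth: "integrable M h" by (rule Lp_bounded_integrable[OF assms])
  define g where "g = P h"
  have intg: "integrable M g" unfolding g_def by (rule transfer_integrable[OF inth])
  then have gm [measurable]: "g \<in> borel_measurable M" by auto
  define m where "m k x = min (cmod (g x)) (real k)" for k :: nat and x
  have [measurable]: "m k \<in> borel_measurable M" for k unfolding m_def by measurable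
  have m: "0 \<le> m k x" "m k x \<le> real k" "m k x \<le> cmod (g x)" for k x by (auto simp: m_def)
  have inths: "integrable M (\<lambda>x. cmod (h x) powr s)"
    using h(3) by (intro integrableI_bounded) (auto simp: top_unique less_top[symmetric])
  have hs: "(\<integral>x. cmod (h x) powr s \<partial>M) \<le> b powr s"
    using h(3) nn_integral_eq_integral[OF inths] by simp
  have bound: "Lp_bounded M s (\<lambda>x. of_real (m k x)) b" for k
  proof -
    define c where "c x = cnj (g x) / of_real (cmod (g x))" for x
    define w where "w x = c x * of_real (m k x powr (s - 1))" for x
    have [measurable]: "c \<in> borel_measurable M"
      unfolding c_def by (intro borel_measurable_divide borel_measurable_of_real borel_measurable_norm
        measurable_compose[OF gm] borel_measurable_continuous_onI continuous_intros)
    have [measurable]: "w \<in> borel_measurable M" unfolding w_def by measurable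
    have c: "cmod (c x) \<le> 1" for x by (simp add: c_def norm_divide)
    have mk: "m k x powr (s - 1) \<le> real k powr (s - 1)" for x
      using m assms(2) by (intro powr_mono2) auto
    have w: "cmod (w x) \<le> m k x powr (s - 1)" for x
      using c by (simp add: w_def norm_mult mult_left_le_one_le)
    have w': "cmod (w x) \<le> real k powr (s - 1)" for x
      using w mk order_trans by blast
    have gc: "g x * c x = of_real (cmod (g x))" for x
      by (cases "g x = 0") (simp_all add: c_def complex_norm_square[symmetric] power2_eq_square)
    have gw: "g x * w x = of_real (cmod (g x) * m k x powr (s - 1))" for x
      unfolding w_def by (simp add: gc mult.assoc[symmetric])
    have ms: "integrable M (\<lambda>x. m k x powr s)" "integrable M (\<lambda>x. m k (f x) powr s)"
      using powr_mono2[OF _ m(1,2), of s] assms(2)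
      by (auto intro!: integrable_const_bound[of _ "real k powr s"])
    have hm: "integrable M (\<lambda>x. cmod (h x) * m k (f x) powr (s - 1))"
      by (rule Bochner_Integration.integrable_bound[of _ "\<lambda>x. real k powr (s - 1) * cmod (h x)"])
        (use inth mk in \<open>auto simp: mult.commute intro!: mult_left_mono\<close>)
    have gi: "integrable M (\<lambda>x. cmod (g x) * m k x powr (s - 1))"
      by (rule Bochner_Integration.integrable_bound[of _ "\<lambda>x. real k powr (s - 1) * cmod (g x)"])
        (use intg mk in \<open>auto simp: mult.commute intro!: mult_left_mono\<close>)
    have young: "a * z powr (s - 1) \<le> a powr s / s + (1 - 1 / s) * z powr s" if "0 \<le> a" "0 \<le> z" for a z :: real
    proof (cases "s = 1")
      case False
      then have s: "1 < s" using assms(2) by auto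
      have "a * z powr (s - 1) \<le> a powr s / s + (z powr (s - 1)) powr (s / (s - 1)) / (s / (s - 1))"
        using s that by (intro Youngs_inequality) (auto simp: field_simps)
      also have "(z powr (s - 1)) powr (s / (s - 1)) / (s / (s - 1)) = (1 - 1 / s) * z powr s"
      proof -
        have "(s - 1) * (s / (s - 1)) = s" using s by simp
        then show ?thesis using s unfolding powr_powr by (simp only:) (simp add: field_simps)
      qed
      finally show ?thesis .
    qed (use that in auto)
    have "(\<integral>x. m k x powr s \<partial>M) \<le> (\<integral>x. cmod (g x) * m k x powr (s - 1) \<partial>M)"
    proof (intro integral_mono ms gi)
      fix x
      have "m k x powr s = m k x * m k x powr (s - 1)"
        using m(1)[of k x] by (cases "m k x = 0") (auto simp: powr_mult_base)
      then show "m k x powr s \<le> cmod (g x) * m k x powr (s - 1)"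
        using m by (simp add: mult_right_mono)
    qed
    also have "\<dots> = cmod (\<integral>x. g x * w x \<partial>M)"
      unfolding gw using m by (subst integral_complex_of_real, subst norm_of_real)
        (auto intro!: integral_nonneg_AE abs_of_nonneg[symmetric])
    also have "(\<integral>x. g x * w x \<partial>M) = (\<integral>x. h x * w (f x) \<partial>M)"
      unfolding g_def by (rule transfer_duality[OF inth _ w']) measurable
    also have "cmod \<dots> \<le> (\<integral>x. cmod (h x * w (f x)) \<partial>M)" by (rule integral_norm_bound)
    also have "\<dots> \<le> (\<integral>x. cmod (h x) * m k (f x) powr (s - 1) \<partial>M)"
      by (intro integral_mono' hm) (auto simp: norm_mult intro!: mult_left_mono w)
    also have "\<dots> \<le> (\<integral>x. cmod (h x) powr s / s + (1 - 1 / s) * m k (f x) powr s \<partial>M)"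
      by (intro integral_mono hm young) (use inths ms m in auto)
    also have "\<dots> = (\<integral>x. cmod (h x) powr s \<partial>M) / s + (1 - 1 / s) * (\<integral>x. m k (f x) powr s \<partial>M)"
      using inths ms by simp
    also have "(\<integral>x. m k (f x) powr s \<partial>M) = (\<integral>x. m k x powr s \<partial>M)"
      by (rule integral_invariant) measurable
    finally have "(\<integral>x. m k x powr s \<partial>M) / s \<le> (\<integral>x. cmod (h x) powr s \<partial>M) / s"
      by (simp add: field_simps)
    then have "(\<integral>x. m k x powr s \<partial>M) \<le> b powr s" using assms(2) hs by (simp add: divide_le_cancel)
    then show ?thesis
      using h(2) m(1) nn_integral_eq_integral[OF ms(1)]
      by (auto simp: Lp_bounded_def intro!: ennreal_leI)
  qed
  have "AE x in M. (\<lambda>k. complex_of_real (m k x)) \<longlonglongrightarrow> of_real (cmod (g x))"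
  proof (intro AE_I2 tendsto_of_real)
    fix x
    have "eventually (\<lambda>k. m k x = cmod (g x)) sequentially"
      using eventually_ge_at_top[of "nat \<lceil>cmod (g x)\<rceil>"]
    proof eventually_elim
      case (elim k)
      then have "cmod (g x) \<le> real k" by linarith
      then show ?case by (simp add: m_def)
    qed
    then show "(\<lambda>k. m k x) \<longlonglongrightarrow> cmod (g x)" by (rule tendsto_eventually)
  qed
  from Lp_bounded_Fatou[OF bound _ this] have "Lp_bounded M s (\<lambda>x. complex_of_real (cmod (g x))) b"
    using assms(2) by auto
  then show ?thesis unfolding g_def[symmetric]
    by (rule Lp_bounded_dominated) (use assms(2) in auto)
qed

text \<open>Duality determines \<open>P h\<close> up to null sets, so linearity can only be claimed
  almost everywhere.\<close>

lemma transfer_add_AE: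
  assumes "integrable M g" "integrable M h"
  shows "AE x in M. P (\<lambda>x. a * g x + b * h x) x = a * P g x + b * P h x"
proof (rule AE_eq_of_integrals_eq)
  have i: "integrable M (\<lambda>x. a * g x + b * h x)" using assms by auto
  show "integrable M (P (\<lambda>x. a * g x + b * h x))" by (rule transfer_integrable[OF i])
  show "integrable M (\<lambda>x. a * P g x + b * P h x)" using assms transfer_integrable by auto
  fix w :: "'a \<Rightarrow> complex" assume w [measurable]: "w \<in> borel_measurable M" and w1: "\<And>x. cmod (w x) \<le> 1"
  have wf: "(\<lambda>x. w (f x)) \<in> borel_measurable M" by measurable
  note ints = integrable_mult_bounded[OF assms(1) wf w1] integrable_mult_bounded[OF assms(2) wf w1]
    integrable_mult_bounded[OF transfer_integrable[OF assms(1)] w w1]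
    integrable_mult_bounded[OF transfer_integrable[OF assms(2)] w w1]
  have "(\<integral>x. P (\<lambda>x. a * g x + b * h x) x * w x \<partial>M) = (\<integral>x. a * (g x * w (f x)) + b * (h x * w (f x)) \<partial>M)"
    using transfer_duality[OF i w w1] by (simp add: algebra_simps)
  also have "\<dots> = a * (\<integral>x. P g x * w x \<partial>M) + b * (\<integral>x. P h x * w x \<partial>M)"
    using ints transfer_duality[OF assms(1) w w1] transfer_duality[OF assms(2) w w1] by simp
  also have "\<dots> = (\<integral>x. a * (P g x * w x) + b * (P h x * w x) \<partial>M)"
    using ints by simp
  also have "\<dots> = (\<integral>x. (a * P g x + b * P h x) * w x \<partial>M)" by (simp add: algebra_simps)
  finally show "(\<integral>x. P (\<lambda>x. a * g x + b * h x) x * w x \<partial>M) = (\<integral>x. (a * P g x + b * P h x) * w x \<partial>M)" .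
qed

lemma transfer_integral: "integrable M h \<Longrightarrow> (\<integral>x. P h x \<partial>M) = (\<integral>x. h x \<partial>M)"
  using transfer_duality[of h "\<lambda>_. 1" 1] by simp

text \<open>Interpreting the locale at the iterates makes every fact about \<open>f\<close> and
  \<open>P\<close> available for \<open>f ^^ n\<close> and \<open>P ^^ n\<close>.\<close>

lemma transfer_system_funpow: "transfer_system M (f ^^ n) (P ^^ n)"
proof (induction n)
  case 0
  show ?case by unfold_locales (auto simp: is_transfer_op_def distr_id)
next
  case (Suc n)
  interpret n: transfer_system M "f ^^ n" "P ^^ n" by (rule Suc)
  show ?case
  proof unfold_locales
    show m [measurable]: "(f ^^ Suc n) \<in> measurable M M" by simp
    show "distr M M (f ^^ Suc n) = M"
      using distr_distr[OF f_measurable n.f_measurable] by (simp add: f_invariant n.f_invariant)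
    show "is_transfer_op M (f ^^ Suc n) (P ^^ Suc n)"
      unfolding is_transfer_op_def
    proof (intro allI impI conjI ballI)
      fix h :: "'a \<Rightarrow> complex" assume h: "integrable M h"
      note hn = n.transfer_integrable[OF h]
      show "integrable M ((P ^^ Suc n) h)" using transfer_integrable[OF hn] by simp
      fix w :: "'a \<Rightarrow> complex" assume w [measurable]: "w \<in> borel_measurable M" and "\<exists>K. \<forall>x\<in>space M. cmod (w x) \<le> K"
      then obtain K where K: "\<And>x. x \<in> space M \<Longrightarrow> cmod (w x) \<le> K" by auto
      have "(\<integral>x. (P ^^ Suc n) h x * w x \<partial>M) = (\<integral>x. (P ^^ n) h x * w (f x) \<partial>M)"
        using transfer_duality[OF hn w K] by simp
      also have "\<dots> = (\<integral>x. h x * w (f ((f ^^ n) x)) \<partial>M)"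
        by (rule n.transfer_duality[OF h]) (auto intro!: K measurable_space[OF f_measurable])
      finally show "(\<integral>x. (P ^^ Suc n) h x * w x \<partial>M) = (\<integral>x. h x * w ((f ^^ Suc n) x) \<partial>M)" by simp
    qed
  qed
qed

section \<open>Birkhoff sums and iterates of the twisted operators\<close>

definition birkhoff_sum :: "('a \<Rightarrow> 'b::comm_monoid_add) \<Rightarrow> nat \<Rightarrow> 'a \<Rightarrow> 'b" where
  "birkhoff_sum k n x = (\<Sum>j<n. k ((f ^^ j) x))"

lemma funpow_measurable [measurable]: "(f ^^ n) \<in> measurable M M"
  using transfer_system.f_measurable[OF transfer_system_funpow] .

lemma birkhoff_sum_measurable [measurable]:
  fixes k :: "'a \<Rightarrow> 'b::{second_countable_topology, real_normed_vector}"
  assumes [measurable]: "k \<in> borel_measurable M"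
  shows "birkhoff_sum k n \<in> borel_measurable M"
  unfolding birkhoff_sum_def by measurable

text \<open>One application of the twisted operator replaces a test function \<open>w\<close> by
  \<open>cis (t \<bullet> k) * (w o f)\<close>, still of modulus at most 1, and the phases multiply
  up to that of the Birkhoff sum.\<close>

lemma twisted_funpow:
  assumes h: "integrable M h" and k [measurable]: "k \<in> borel_measurable M"
  shows "integrable M ((twisted_op P k t ^^ n) h)"
    and "AE x in M. (twisted_op P k t ^^ n) h x = (P ^^ n) (\<lambda>x. cis (t \<bullet> birkhoff_sum k n x) * h x) x"
proof -
  have hm [measurable]: "h \<in> borel_measurable M" using h by auto
  have cm [measurable]: "(\<lambda>x. cis (t \<bullet> v x)) \<in> borel_measurable M" if [measurable]: "v \<in> borel_measurable M" for v
    by (rule measurable_compose[of "\<lambda>x. t \<bullet> v x" _ borel])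
      (auto intro!: borel_measurable_continuous_onI continuous_intros continuous_on_cis)
  have ci: "integrable M (\<lambda>x. cis (t \<bullet> v x) * g x)" if [measurable]: "v \<in> borel_measurable M" and g: "integrable M g" for v g
    by (rule Bochner_Integration.integrable_bound[OF g]) (use g in \<open>auto simp: norm_mult\<close>)
  \<comment> \<open>The induction runs on the dual form: identities that hold almost everywhere
    cannot be substituted inside \<open>P\<close>, except through duality.\<close>
  have main: "integrable M ((twisted_op P k t ^^ n) h) \<and>
    (\<forall>w\<in>borel_measurable M. (\<forall>x. cmod (w x) \<le> 1) \<longrightarrow> (\<integral>x. (twisted_op P k t ^^ n) h x * w x \<partial>M) =
      (\<integral>x. cis (t \<bullet> birkhoff_sum k n x) * h x * w ((f ^^ n) x) \<partial>M))" for n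
  proof (induction n)
    case 0
    then show ?case using h by (simp add: birkhoff_sum_def)
  next
    case (Suc n)
    define g where "g = (twisted_op P k t ^^ n) h"
    have g: "integrable M g" using Suc by (simp add: g_def)
    have e: "(twisted_op P k t ^^ Suc n) h = P (\<lambda>x. cis (t \<bullet> k x) * g x)"
      by (simp add: twisted_op_def g_def)
    show ?case unfolding e
    proof (intro conjI ballI impI)
      show "integrable M (P (\<lambda>x. cis (t \<bullet> k x) * g x))" by (intro transfer_integrable ci k g)
      fix w :: "'a \<Rightarrow> complex" assume w [measurable]: "w \<in> borel_measurable M" and w1: "\<forall>x. cmod (w x) \<le> 1"
      have "(\<integral>x. P (\<lambda>x. cis (t \<bullet> k x) * g x) x * w x \<partial>M) = (\<integral>x. g x * (cis (t \<bullet> k x) * w (f x)) \<partial>M)"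
        by (subst transfer_duality[OF ci[OF k g] w, of 1]) (use w1 in \<open>auto simp: algebra_simps\<close>)
      also have "\<dots> = (\<integral>x. cis (t \<bullet> birkhoff_sum k n x) * h x * (cis (t \<bullet> k ((f ^^ n) x)) * w (f ((f ^^ n) x))) \<partial>M)"
        using Suc w1 unfolding g_def[symmetric]
        by (intro Suc[THEN conjunct2, folded g_def, rule_format]) (auto simp: norm_mult)
      also have "\<dots> = (\<integral>x. cis (t \<bullet> birkhoff_sum k (Suc n) x) * h x * w ((f ^^ Suc n) x) \<partial>M)"
        by (intro Bochner_Integration.integral_cong refl)
          (simp add: birkhoff_sum_def inner_add_right cis_mult[symmetric] algebra_simps)
      finally show "(\<integral>x. P (\<lambda>x. cis (t \<bullet> k x) * g x) x * w x \<partial>M) =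
        (\<integral>x. cis (t \<bullet> birkhoff_sum k (Suc n) x) * h x * w ((f ^^ Suc n) x) \<partial>M)" .
    qed
  qed
  then show "integrable M ((twisted_op P k t ^^ n) h)" by blast
  interpret n: transfer_system M "f ^^ n" "P ^^ n" by (rule transfer_system_funpow)
  note c = ci[OF birkhoff_sum_measurable[OF k] h, of n]
  show "AE x in M. (twisted_op P k t ^^ n) h x = (P ^^ n) (\<lambda>x. cis (t \<bullet> birkhoff_sum k n x) * h x) x"
  proof (rule AE_eq_of_integrals_eq)
    show "integrable M ((P ^^ n) (\<lambda>x. cis (t \<bullet> birkhoff_sum k n x) * h x))"
      by (rule n.transfer_integrable[OF c])
    fix w :: "'a \<Rightarrow> complex" assume w: "w \<in> borel_measurable M" "\<And>x. cmod (w x) \<le> 1"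
    then show "(\<integral>x. (twisted_op P k t ^^ n) h x * w x \<partial>M) =
        (\<integral>x. (P ^^ n) (\<lambda>x. cis (t \<bullet> birkhoff_sum k n x) * h x) x * w x \<partial>M)"
      using main[of n] n.transfer_duality[OF c w(1), of 1] by auto
  qed (use main in auto)
qed

end

section \<open>Expansion of the eigenprojector\<close>

text \<open>Interpolation between the second-order bound u^2 / 2, used for |u| \<le> 1, and the
  bound 2 |u|, used beyond; for exponents between 1 and 2 both are below the right-hand
  side.\<close>

lemma norm_cis_diff_le_powr:
  assumes "1 \<le> \<gamma>" "\<gamma> \<le> 2"
  shows "cmod (cis u - 1 - \<i> * of_real u) \<le> 2 * \<bar>u\<bar> powr \<gamma>"
proof (cases "\<bar>u\<bar> \<le> 1")
  case True
  have "cmod (cis u - 1 - \<i> * of_real u) \<le> \<bar>u\<bar>\<^sup>2 / 2"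
    using iexp_approx1[of u 1] by (simp add: cis_conv_exp numeral_2_eq_2 algebra_simps)
  also have "\<bar>u\<bar>\<^sup>2 \<le> \<bar>u\<bar> powr \<gamma>"
    using True assms powr_mono'[of \<gamma> 2 "\<bar>u\<bar>"] by (cases "u = 0") auto
  finally show ?thesis using powr_ge_zero[of "\<bar>u\<bar>" \<gamma>] by linarith
next
  case False
  have "cmod (cis u - 1 - \<i> * of_real u) \<le> cmod (cis u - 1) + cmod (\<i> * of_real u)"
    by (rule norm_triangle_ineq4)
  also have "cmod (cis u - 1) \<le> \<bar>u\<bar>"
    using iexp_approx1[of u 0] by (simp add: cis_conv_exp)
  finally have "cmod (cis u - 1 - \<i> * of_real u) \<le> 2 * \<bar>u\<bar>" by (simp add: norm_mult)
  also have "\<bar>u\<bar> \<le> \<bar>u\<bar> powr \<gamma>" using False assms powr_mono[of 1 \<gamma> "\<bar>u\<bar>"] by simp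
  finally show ?thesis by simp
qed

locale perturbed_transfer = transfer_system +
  fixes \<kappa> :: "'a \<Rightarrow> plane"
  assumes \<kappa>_measurable [measurable]: "\<kappa> \<in> borel_measurable M"
    and \<kappa>_moments: "\<And>s. 1 \<le> s \<Longrightarrow> s < 2 \<Longrightarrow> (\<integral>\<^sup>+x. ennreal (norm (\<kappa> x) powr s) \<partial>M) < \<infinity>"
begin

abbreviation S :: "nat \<Rightarrow> 'a \<Rightarrow> plane" where "S \<equiv> birkhoff_sum \<kappa>"

lemma \<kappa>_Lp_bounded:
  assumes "1 \<le> s" "s < 2"
  obtains K where "1 \<le> K" "Lp_bounded M s (\<lambda>x. of_real (norm (\<kappa> x))) K"
proof -
  define I where "I = enn2real (\<integral>\<^sup>+x. ennreal (norm (\<kappa> x) powr s) \<partial>M)"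
  have I: "(\<integral>\<^sup>+x. ennreal (norm (\<kappa> x) powr s) \<partial>M) = ennreal I"
    using \<kappa>_moments[OF assms] by (simp add: I_def less_top)
  have "0 \<le> I" by (simp add: I_def)
  \<comment> \<open>\<open>1 + I\<close> stands in for the s-th root of \<open>I\<close>: being at
    least 1, it is dominated by its own s-th power.\<close>
  have "I \<le> (1 + I) powr 1" using \<open>0 \<le> I\<close> by simp
  also have "\<dots> \<le> (1 + I) powr s" using \<open>0 \<le> I\<close> assms by (intro powr_mono) auto
  finally have "Lp_bounded M s (\<lambda>x. of_real (norm (\<kappa> x))) (1 + I)"
    using \<open>0 \<le> I\<close> by (auto simp: Lp_bounded_def I intro!: ennreal_leI)
  then show ?thesis using \<open>0 \<le> I\<close> by (intro that[of "1 + I"]) auto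
qed

text \<open>Triangle inequality and invariance. Linear growth is good enough, since \<open>n\<close>
  will be logarithmic in 1/|t|.\<close>

lemma S_Lp_bounded:
  assumes "Lp_bounded M s (\<lambda>x. of_real (norm (\<kappa> x))) K" "1 \<le> s" "1 \<le> n"
  shows "Lp_bounded M s (\<lambda>x. of_real (norm (S n x))) (real n * K)"
proof -
  have "Lp_bounded M s (\<lambda>x. of_real (norm (\<kappa> ((f ^^ j) x)))) K" for j
    using transfer_system.Lp_bounded_compose[OF transfer_system_funpow assms(1)] .
  then have "Lp_bounded M s (\<lambda>x. \<Sum>j<n. of_real (norm (\<kappa> ((f ^^ j) x)))) (\<Sum>j<n. K)"
    using assms by (intro Lp_bounded_sum) (auto simp: lessThan_empty_iff)
  then have "Lp_bounded M s (\<lambda>x. \<Sum>j<n. of_real (norm (\<kappa> ((f ^^ j) x)))) (real n * K)" by simp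
  then show ?thesis
  proof (rule Lp_bounded_dominated)
    show "AE x in M. cmod (of_real (norm (S n x))) \<le> cmod (\<Sum>j<n. of_real (norm (\<kappa> ((f ^^ j) x))))"
      unfolding of_real_sum[symmetric] norm_of_real
      by (auto simp: birkhoff_sum_def abs_of_nonneg sum_nonneg norm_sum)
  qed (use assms in auto)
qed

lemma integrable_\<kappa>: "integrable M \<kappa>"
proof -
  obtain K where "Lp_bounded M 1 (\<lambda>x. of_real (norm (\<kappa> x))) K" by (rule \<kappa>_Lp_bounded[of 1]) auto
  from Lp_bounded_integrable(1)[OF this] have "integrable M (\<lambda>x. norm (\<kappa> x))"
    by (simp add: complex_of_real_integrable_eq)
  then show ?thesis by (simp add: integrable_norm_iff)
qed

definition drift :: "plane" where "drift = (\<integral>x. \<kappa> x \<partial>M)"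

lemma integral_S: "integrable M (S n)" "(\<integral>x. S n x \<partial>M) = real n *\<^sub>R drift"
proof -
  have i: "integrable M (\<lambda>x. \<kappa> ((f ^^ j) x))" "(\<integral>x. \<kappa> ((f ^^ j) x) \<partial>M) = drift" for j
  proof -
    interpret j: transfer_system M "f ^^ j" "P ^^ j" by (rule transfer_system_funpow)
    show "integrable M (\<lambda>x. \<kappa> ((f ^^ j) x))"
      using integrable_distr[OF j.f_measurable, of \<kappa>] integrable_\<kappa> by (simp add: j.f_invariant)
    show "(\<integral>x. \<kappa> ((f ^^ j) x) \<partial>M) = drift"
      using integral_distr[OF j.f_measurable, of \<kappa>] by (simp add: j.f_invariant drift_def)
  qed
  show "integrable M (S n)"
    unfolding birkhoff_sum_def[abs_def] using i by auto
  show "(\<integral>x. S n x \<partial>M) = real n *\<^sub>R drift"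
    unfolding birkhoff_sum_def using i by (simp add: scaleR_conv_of_real)
qed

text \<open>The part of lam_t^(-n) P_t^n h that is linear in \<open>t\<close>: the factor lam_t^n is
  1 + \<i> n (t . drift) to first order, and its contribution is subtracted.\<close>

definition first_order :: "nat \<Rightarrow> plane \<Rightarrow> 'a operator" where
  "first_order n t h x = \<i> * ((P ^^ n) (\<lambda>x. of_real (t \<bullet> S n x) * h x) x
     - of_real (real n * (t \<bullet> drift)) * (\<integral>x. h x \<partial>M))"

end

text \<open>\<open>H\<close> will be the unit ball of B0, so that bounds uniform over
  \<open>H\<close> are operator norm bounds; the constant function 1 belongs to it because the
  eigenvalue is recovered from it. The moment of order \<open>s\<close> controls the linear term,
  the one of order \<open>\<gamma> * s\<close> the Taylor remainder.\<close>

locale spectral_expansion = perturbed_transfer M f P \<kappa>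
  for M :: "'a measure" and f P \<kappa> +
  fixes H :: "('a \<Rightarrow> complex) set" and T :: "plane set" and lam :: "plane \<Rightarrow> complex"
    and Pr :: "plane \<Rightarrow> 'a operator" and Rem :: "plane \<Rightarrow> nat \<Rightarrow> 'a operator"
    and s \<gamma> K C \<theta> :: real
  assumes H: "\<And>h. h \<in> H \<Longrightarrow> h \<in> borel_measurable M" "\<And>h. h \<in> H \<Longrightarrow> AE x in M. cmod (h x) \<le> 1"
    and one_H: "(\<lambda>_. 1) \<in> H"
    and decomposition: "\<And>t n h. t \<in> T \<Longrightarrow> 1 \<le> n \<Longrightarrow> h \<in> H \<Longrightarrow>
        AE x in M. (twisted_op P \<kappa> t ^^ n) h x = lam t ^ n * Pr t h x + Rem t n h x"
    and remainder: "\<And>t n h. t \<in> T \<Longrightarrow> 1 \<le> n \<Longrightarrow> h \<in> H \<Longrightarrow> Lp_bounded M s (Rem t n h) (C * \<theta> ^ n)"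
    and Pr_measurable: "\<And>t h. t \<in> T \<Longrightarrow> h \<in> H \<Longrightarrow> Pr t h \<in> borel_measurable M"
    and at_0: "0 \<in> T" "lam 0 = 1" "\<And>h. h \<in> H \<Longrightarrow> AE x in M. Pr 0 h x = (\<integral>x. h x \<partial>M)"
    and exponents: "1 \<le> s" "1 < \<gamma>" "\<gamma> \<le> 2"
    and constants: "0 < C" "0 < \<theta>" "\<theta> < 1" "1 \<le> K"
    and K: "Lp_bounded M s (\<lambda>x. of_real (norm (\<kappa> x))) K"
           "Lp_bounded M (\<gamma> * s) (\<lambda>x. of_real (norm (\<kappa> x))) K"
begin

lemma H_Lp_bounded: "h \<in> H \<Longrightarrow> 0 \<le> q \<Longrightarrow> Lp_bounded M q h 1"
  using H by (intro Lp_bounded_AE) auto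

lemma H_integrable: "h \<in> H \<Longrightarrow> integrable M h" "h \<in> H \<Longrightarrow> cmod (\<integral>x. h x \<partial>M) \<le> 1"
  using Lp_bounded_integrable[OF H_Lp_bounded[of h 1]] by auto

lemma linear_term_Lp_bounded:
  assumes "h \<in> H" "1 \<le> n" "t \<noteq> 0"
  shows "Lp_bounded M s (\<lambda>x. of_real (t \<bullet> S n x) * h x) (real n * K * norm t)"
proof -
  have [measurable]: "h \<in> borel_measurable M" using H assms by auto
  have "Lp_bounded M s (\<lambda>x. of_real (norm t) * of_real (norm (S n x))) (real n * K * norm t)"
    by (rule Lp_bounded_scale[OF S_Lp_bounded[OF K(1) exponents(1) assms(2)]])
      (use assms constants exponents in \<open>auto simp: algebra_simps\<close>)
  then show ?thesis
  proof (rule Lp_bounded_dominated)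
    show "AE x in M. cmod (of_real (t \<bullet> S n x) * h x) \<le> cmod (of_real (norm t) * of_real (norm (S n x)))"
      using H(2)[OF assms(1)]
    proof eventually_elim
      case (elim x)
      then show ?case using mult_mono[OF Cauchy_Schwarz_ineq2[of t "S n x"] elim]
        by (simp add: norm_mult)
    qed
  qed (use exponents in auto)
qed

text \<open>Taylor expansion of the phase inside P^n. The zeroth-order term P^n h is itself expanded
  by the decomposition at t = 0, as the integral of h plus a remainder; this second remainder
  explains the factor 2 before \<open>C * \<theta> ^ n\<close>.\<close>

lemma first_expansion:
  assumes "t \<in> T" "t \<noteq> 0" "1 \<le> n" "h \<in> H"
  shows "Lp_bounded M s (\<lambda>x. lam t ^ n * Pr t h x - (\<integral>x. h x \<partial>M)
           - \<i> * (P ^^ n) (\<lambda>x. of_real (t \<bullet> S n x) * h x) x)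
         (2 * (real n * K * norm t) powr \<gamma> + 2 * (C * \<theta> ^ n))"
proof -
  interpret n: transfer_system M "f ^^ n" "P ^^ n" by (rule transfer_system_funpow)
  have hm [measurable]: "h \<in> borel_measurable M" using H assms by auto
  have cm [measurable]: "(\<lambda>x. cis (t \<bullet> S n x)) \<in> borel_measurable M"
    by (rule measurable_compose[of "\<lambda>x. t \<bullet> S n x" _ borel])
      (auto intro!: borel_measurable_continuous_onI continuous_intros continuous_on_cis)
  define u where "u x = of_real (t \<bullet> S n x) * h x" for x
  define g where "g x = (cis (t \<bullet> S n x) - 1 - \<i> * of_real (t \<bullet> S n x)) * h x" for x
  have [measurable]: "g \<in> borel_measurable M" unfolding g_def by measurable
  have pos: "0 < norm t powr \<gamma>" using assms by simp
  have "Lp_bounded M s (\<lambda>x. of_real (norm (S n x) powr \<gamma>)) ((real n * K) powr \<gamma>)"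
    using Lp_boundedD[OF S_Lp_bounded[OF K(2) _ assms(3)]] exponents constants assms(3) mult_mono[of 1 \<gamma> 1 s]
    by (auto simp: Lp_bounded_def powr_powr mult.commute)
  then have "Lp_bounded M s (\<lambda>x. of_real (2 * norm t powr \<gamma>) * of_real (norm (S n x) powr \<gamma>))
      (2 * (real n * K * norm t) powr \<gamma>)"
    by (rule Lp_bounded_scale) (use pos assms constants exponents in \<open>auto simp: norm_mult powr_mult\<close>)
  then have "Lp_bounded M s g (2 * (real n * K * norm t) powr \<gamma>)"
  proof (rule Lp_bounded_dominated)
    show "AE x in M. cmod (g x) \<le> cmod (of_real (2 * norm t powr \<gamma>) * of_real (norm (S n x) powr \<gamma>))"
      using H(2)[OF assms(4)]
    proof eventually_elim
      case (elim x)
      have "cmod (g x) \<le> 2 * \<bar>t \<bullet> S n x\<bar> powr \<gamma> * 1"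
        unfolding g_def norm_mult using exponents by (intro mult_mono norm_cis_diff_le_powr elim) auto
      also have "\<bar>t \<bullet> S n x\<bar> powr \<gamma> \<le> (norm t * norm (S n x)) powr \<gamma>"
        using exponents by (intro powr_mono2 Cauchy_Schwarz_ineq2) auto
      finally show ?case by (simp add: norm_mult powr_mult)
    qed
  qed (use exponents in auto)
  then have Pg: "Lp_bounded M s ((P ^^ n) g) (2 * (real n * K * norm t) powr \<gamma>)"
    and gi: "integrable M g"
    using n.Lp_bounded_transfer Lp_bounded_integrable exponents by auto
  have ui: "integrable M u"
    unfolding u_def by (rule Lp_bounded_integrable[OF linear_term_Lp_bounded[OF assms(4,3,2)] exponents(1)])
  note hi = H_integrable(1)[OF assms(4)]
  have sum: "(\<lambda>x. cis (t \<bullet> S n x) * h x) = (\<lambda>x. 1 * g x + 1 * (1 * h x + \<i> * u x))"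
    by (auto simp: g_def u_def algebra_simps)
  have eq: "AE x in M. lam t ^ n * Pr t h x - (\<integral>x. h x \<partial>M) - \<i> * (P ^^ n) u x
      = (P ^^ n) g x + (Rem 0 n h x - Rem t n h x)"
    using decomposition[OF assms(1,3,4)] decomposition[OF at_0(1) assms(3,4)] at_0(3)[OF assms(4)]
      twisted_funpow(2)[OF hi \<kappa>_measurable, where t=t and n=n]
      twisted_funpow(2)[OF hi \<kappa>_measurable, where t=0 and n=n]
      n.transfer_add_AE[OF gi, of "\<lambda>x. 1 * h x + \<i> * u x" 1 1]
      n.transfer_add_AE[OF hi ui, of 1 \<i>] ui hi
    unfolding sum at_0(2)
    by (auto elim!: eventually_elim2 simp: algebra_simps)
  have R: "Lp_bounded M s (\<lambda>x. (P ^^ n) g x + (Rem 0 n h x - Rem t n h x))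
      (2 * (real n * K * norm t) powr \<gamma> + (C * \<theta> ^ n + C * \<theta> ^ n))"
    by (intro Lp_bounded_add Lp_bounded_diff Pg remainder assms at_0 exponents)
  show ?thesis
    unfolding u_def[symmetric] using R
    by (rule Lp_bounded_cong_AE[THEN Lp_bounded_mono])
      (use eq Pr_measurable[OF assms(1,4)] n.transfer_integrable[OF ui] exponents in auto)
qed

end

section \<open>Powers of the leading eigenvalue, and their removal from the expansion\<close>

context spectral_expansion
begin

definition err :: "nat \<Rightarrow> plane \<Rightarrow> real" where
  "err n t = (real n * K * norm t) powr \<gamma> + C * \<theta> ^ n"

lemma err_pos: "0 < err n t"
  using constants by (auto simp: err_def intro!: add_nonneg_pos)

lemma norm_drift_le: "norm drift \<le> K"
proof -
  have "norm drift \<le> (\<integral>x. norm (\<kappa> x) \<partial>M)" unfolding drift_def by (rule integral_norm_bound)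
  also have "\<dots> \<le> K" using Lp_bounded_integrable(2)[OF K(1) exponents(1)] by simp
  finally show ?thesis .
qed

lemma drift_le: "\<bar>real n * (t \<bullet> drift)\<bar> \<le> real n * K * norm t"
proof -
  have "\<bar>t \<bullet> drift\<bar> \<le> norm t * norm drift" by (rule Cauchy_Schwarz_ineq2)
  also have "\<dots> \<le> norm t * K" by (intro mult_left_mono norm_drift_le) auto
  finally have "real n * \<bar>t \<bullet> drift\<bar> \<le> real n * (norm t * K)" by (rule mult_left_mono) auto
  then show ?thesis by (simp add: abs_mult mult_ac)
qed

text \<open>The first expansion at h = 1, integrated: \<open>P\<close> preserves integrals and
  \<open>t \<bullet> S n\<close> has mean \<open>n * (t \<bullet> drift)\<close>.\<close>

lemma eigenvalue_mean:
  assumes "t \<in> T" "t \<noteq> 0" "1 \<le> n"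
  shows "cmod (lam t ^ n * (\<integral>x. Pr t (\<lambda>_. 1) x \<partial>M) - 1 - \<i> * of_real (real n * (t \<bullet> drift))) \<le> 2 * err n t"
proof -
  interpret n: transfer_system M "f ^^ n" "P ^^ n" by (rule transfer_system_funpow)
  define u where "u x = of_real (t \<bullet> S n x) * (1::complex)" for x
  note fe = first_expansion[OF assms one_H, folded u_def]
  have ui: "integrable M u"
    unfolding u_def by (rule Lp_bounded_integrable[OF linear_term_Lp_bounded[OF one_H assms(3,2)] exponents(1)])
  have Pui: "integrable M ((P ^^ n) u)" by (rule n.transfer_integrable[OF ui])
  note fi = Lp_bounded_integrable[OF fe exponents(1)]
  define g where "g x = lam t ^ n * Pr t (\<lambda>_. 1) x - (\<integral>x. 1 \<partial>M) - \<i> * (P ^^ n) u x" for x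
  have gi: "integrable M g" unfolding g_def using fi(1) by simp
  have "integrable M (\<lambda>x. g x + (\<integral>x. 1 \<partial>M) + \<i> * (P ^^ n) u x)"
    using gi Pui by auto
  then have Pi: "integrable M (\<lambda>x. lam t ^ n * Pr t (\<lambda>_. 1) x)" by (simp add: g_def)
  have Si: "(\<integral>x. t \<bullet> S n x \<partial>M) = real n * (t \<bullet> drift)"
    using integral_S[of n] by simp
  have "(\<integral>x. g x \<partial>M) = lam t ^ n * (\<integral>x. Pr t (\<lambda>_. 1) x \<partial>M) - 1 - \<i> * (\<integral>x. (P ^^ n) u x \<partial>M)"
    unfolding g_def using Pi Pui by (simp add: prob_space)
  also have "(\<integral>x. (P ^^ n) u x \<partial>M) = of_real (real n * (t \<bullet> drift))"
    unfolding n.transfer_integral[OF ui] unfolding u_def Si[symmetric] by simp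
  finally have "lam t ^ n * (\<integral>x. Pr t (\<lambda>_. 1) x \<partial>M) - 1 - \<i> * of_real (real n * (t \<bullet> drift)) = (\<integral>x. g x \<partial>M)" ..
  then show ?thesis using fi(3) unfolding g_def[symmetric] by (simp add: err_def)
qed

\<comment> \<open>With \<open>a\<close> the mean of \<open>Pr t 1\<close>, both \<open>lam\<^sup>n a\<close> and \<open>lam\<^sup>2\<^sup>n a\<close> are known; their quotient is \<open>lam\<^sup>n\<close>.\<close>
lemma eigenvalue_power:
  assumes "t \<in> T" "t \<noteq> 0" "1 \<le> n" and x: "real n * K * norm t \<le> 1 / 4" and e: "err n t \<le> 1 / 104"
  shows "cmod (lam t ^ n - 1 - \<i> * of_real (real n * (t \<bullet> drift))) \<le> 26 * err n t"
    and "cmod (lam t ^ n - 1) \<le> real n * K * norm t + 26 * err n t"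
    and "1 / 2 \<le> cmod (lam t ^ n)"
proof -
  define X where "X = lam t ^ n * (\<integral>x. Pr t (\<lambda>_. 1) x \<partial>M)"
  define x where "x = real n * K * norm t"
  define m where "m = real n * (t \<bullet> drift)"
  define d where "d = X - 1 - \<i> * of_real m"
  define d' where "d' = lam t ^ n * X - 1 - \<i> * of_real (2 * m)"
  have x0: "0 \<le> x" using constants by (simp add: x_def)
  have mx: "\<bar>m\<bar> \<le> x" unfolding m_def x_def by (rule drift_le)
  \<comment> \<open>Since x \<le> 1 and \<gamma> \<le> 2, quadratic errors in \<open>x\<close> are
    already covered by \<open>err\<close>.\<close>
  have "x\<^sup>2 = x powr 2" using x0 by simp
  also have "\<dots> \<le> x powr \<gamma>"
    using x x0 exponents by (intro powr_mono') (auto simp: x_def)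
  also have "\<dots> \<le> err n t" using constants by (simp add: err_def x_def)
  finally have x2: "x\<^sup>2 \<le> err n t" .
  have d: "cmod d \<le> 2 * err n t"
    using eigenvalue_mean[OF assms(1-3)] by (simp add: d_def X_def m_def)
  have "err (2 * n) t \<le> 4 * err n t"
  proof -
    have "(real (2 * n) * K * norm t) powr \<gamma> = 2 powr \<gamma> * x powr \<gamma>"
      using constants by (simp add: powr_mult x_def mult.assoc)
    also have "2 powr \<gamma> \<le> 2 powr 2" using exponents by (intro powr_mono) auto
    finally have a: "(real (2 * n) * K * norm t) powr \<gamma> \<le> 4 * x powr \<gamma>"
      by (simp add: mult_right_mono)
    have "\<theta> ^ (2 * n) \<le> \<theta> ^ n" using constants by (intro power_decreasing) auto
    then have "C * \<theta> ^ (2 * n) \<le> C * \<theta> ^ n" using constants by (intro mult_left_mono) auto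
    moreover have "0 \<le> C * \<theta> ^ n" using constants by simp
    ultimately show ?thesis using a by (simp add: err_def x_def)
  qed
  moreover have "cmod d' \<le> 2 * err (2 * n) t"
  proof -
    have "lam t ^ (2 * n) = lam t ^ n * lam t ^ n" by (simp only: mult_2 power_add)
    then have "d' = lam t ^ (2 * n) * (\<integral>x. Pr t (\<lambda>_. 1) x \<partial>M) - 1 - \<i> * of_real (real (2 * n) * (t \<bullet> drift))"
      by (simp add: d'_def X_def m_def)
    then show ?thesis using eigenvalue_mean[OF assms(1,2), of "2 * n"] assms(3) by simp
  qed
  ultimately have d': "cmod d' \<le> 8 * err n t" by linarith
  have one: "1 \<le> cmod (1 + \<i> * of_real m)"
    by (rule order_trans[OF _ complex_Re_le_cmod]) simp
  have two: "cmod (1 + \<i> * of_real m) \<le> 2"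
    using norm_triangle_ineq[of 1 "\<i> * of_real m"] mx x by (simp add: norm_mult x_def)
  have "cmod (1 + \<i> * of_real m) \<le> cmod X + cmod d"
    using norm_triangle_ineq4[of X d] by (simp add: d_def algebra_simps)
  then have X: "1 / 2 \<le> cmod X" using one d e by linarith
  \<comment> \<open>\<open>lam t ^ n * X\<close> is the quantity known at order 2n, and expanding (1
    + \<i> m)^2 leaves only m^2. The right side is at most (1 + 8 + 4) \<open>err n t\<close>;
    dividing by |X| \<ge> 1/2 doubles 13 to 26.\<close>
  have "X * (lam t ^ n - 1 - \<i> * of_real m) = of_real (m\<^sup>2) + d' - (1 + \<i> * of_real m) * d"
    by (simp add: d_def d'_def algebra_simps power2_eq_square)
  then have "cmod X * cmod (lam t ^ n - 1 - \<i> * of_real m)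
      = cmod (of_real (m\<^sup>2) + d' - (1 + \<i> * of_real m) * d)"
    by (metis norm_mult)
  also have "\<dots> \<le> cmod (of_real (m\<^sup>2)) + cmod d' + cmod ((1 + \<i> * of_real m) * d)"
    by (intro order_trans[OF norm_triangle_ineq4] add_right_mono norm_triangle_ineq)
  also have "\<dots> \<le> m\<^sup>2 + 8 * err n t + 2 * (2 * err n t)"
    using d' mult_mono[OF two d] by (intro add_mono) (simp_all add: norm_mult norm_power)
  also have "m\<^sup>2 \<le> x\<^sup>2" using mx by (simp add: abs_le_square_iff[symmetric] x0)
  also note x2
  finally have "cmod X * cmod (lam t ^ n - 1 - \<i> * of_real m) \<le> 13 * err n t" by simp
  moreover have "1 / 2 * cmod (lam t ^ n - 1 - \<i> * of_real m) \<le> cmod X * cmod (lam t ^ n - 1 - \<i> * of_real m)"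
    by (intro mult_right_mono X) auto
  ultimately show 1: "cmod (lam t ^ n - 1 - \<i> * of_real (real n * (t \<bullet> drift))) \<le> 26 * err n t"
    unfolding m_def by linarith
  have "cmod (lam t ^ n - 1) \<le> cmod (lam t ^ n - 1 - \<i> * of_real m) + cmod (\<i> * of_real m)"
    using norm_triangle_ineq[of "lam t ^ n - 1 - \<i> * of_real m" "\<i> * of_real m"] by simp
  also have "cmod (\<i> * of_real m) \<le> x" using mx by (simp add: norm_mult)
  finally show 2: "cmod (lam t ^ n - 1) \<le> real n * K * norm t + 26 * err n t"
    using 1 by (simp add: m_def x_def)
  have "1 \<le> cmod (lam t ^ n) + cmod (lam t ^ n - 1)"
    using norm_triangle_ineq4[of "lam t ^ n" "lam t ^ n - 1"] by simp
  \<comment> \<open>Origin of 1/104: it makes 26 \<open>err n t\<close> at most 1/4, the other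
    quarter coming from the bound on n K |t|.\<close>
  then show "1 / 2 \<le> cmod (lam t ^ n)" using 2 x e by linarith
qed

lemma first_order_Lp_bounded:
  assumes "h \<in> H" "1 \<le> n" "t \<noteq> 0"
  shows "Lp_bounded M s (first_order n t h) (2 * (real n * K * norm t))"
proof -
  interpret n: transfer_system M "f ^^ n" "P ^^ n" by (rule transfer_system_funpow)
  have pos: "0 < real n * K * norm t" using assms constants by auto
  have "\<bar>real n * (t \<bullet> drift)\<bar> * cmod (\<integral>x. h x \<partial>M) \<le> (real n * K * norm t) * 1"
    using pos by (intro mult_mono drift_le H_integrable assms) auto
  then have c: "cmod (of_real (real n * (t \<bullet> drift)) * (\<integral>x. h x \<partial>M)) \<le> real n * K * norm t"
    by (simp add: norm_mult del: of_real_mult)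
  have "Lp_bounded M s (\<lambda>x. (P ^^ n) (\<lambda>x. of_real (t \<bullet> S n x) * h x) x
      - of_real (real n * (t \<bullet> drift)) * (\<integral>x. h x \<partial>M)) (real n * K * norm t + real n * K * norm t)"
    by (intro Lp_bounded_diff n.Lp_bounded_transfer Lp_bounded_const linear_term_Lp_bounded assms
        exponents c pos) (use exponents in auto)
  then have "Lp_bounded M s (\<lambda>x. \<i> * ((P ^^ n) (\<lambda>x. of_real (t \<bullet> S n x) * h x) x
      - of_real (real n * (t \<bullet> drift)) * (\<integral>x. h x \<partial>M))) (2 * (real n * K * norm t))"
    by (rule Lp_bounded_scale) (use pos exponents in auto)
  then show ?thesis unfolding first_order_def[abs_def] .
qed

text \<open>The first expansion is divided by L = lam_t^n, of modulus at least 1/2. Two terms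
  remain: I (1 + \<i> m - L), controlled by \<open>eigenvalue_power\<close>, and (1 - L) times the
  first-order term, a product of two small quantities of size x + 26 err and 2 x. The constant is 86
  = 2 (2 + 26 + 15).\<close>

theorem projector_expansion:
  assumes "t \<in> T" "t \<noteq> 0" "1 \<le> n" "h \<in> H"
    and x: "real n * K * norm t \<le> 1 / 4" and e: "err n t \<le> 1 / 104"
  shows "Lp_bounded M s (\<lambda>x. Pr t h x - (\<integral>x. h x \<partial>M) - first_order n t h x) (86 * err n t)"
proof -
  define I where "I = (\<integral>x. h x \<partial>M)"
  define m where "m = real n * (t \<bullet> drift)"
  define L where "L = lam t ^ n"
  note L = eigenvalue_power[OF assms(1-3) x e, folded m_def L_def]
  define x where "x = real n * K * norm t"
  have x0: "0 < x" using assms constants by (simp add: x_def)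
  define fo where "fo = first_order n t h"
  have "L \<noteq> 0" using L(3) by auto
  have I: "cmod I \<le> 1" unfolding I_def by (rule H_integrable[OF assms(4)])
  have x2: "2 * x * (x + 26 * err n t) \<le> 15 * err n t"
  proof -
    have "x\<^sup>2 = x powr 2" using x0 by simp
    also have "\<dots> \<le> x powr \<gamma>"
      using assms(5) x0 exponents by (intro powr_mono') (auto simp: x_def)
    also have "\<dots> \<le> err n t" using constants by (simp add: err_def x_def)
  finally have "x\<^sup>2 \<le> err n t" .
    moreover have "x * err n t \<le> 1 / 4 * err n t"
      using assms(5) err_pos[of n t] by (intro mult_right_mono) (auto simp: x_def)
    ultimately show ?thesis by (simp add: algebra_simps power2_eq_square)
  qed
  have fe: "Lp_bounded M s (\<lambda>x. L * Pr t h x - I - (fo x + \<i> * of_real m * I)) (2 * err n t)"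
    using first_expansion[OF assms(1-4)]
    by (simp add: L_def I_def fo_def first_order_def m_def err_def algebra_simps)
  have c: "Lp_bounded M s (\<lambda>_. I * (1 + \<i> * of_real m - L)) (26 * err n t)"
  proof (rule Lp_bounded_const)
    have "cmod I * cmod (1 + \<i> * of_real m - L) \<le> 1 * (26 * err n t)"
      using L(1) by (intro mult_mono I) (auto simp: norm_minus_commute algebra_simps)
    then show "cmod (I * (1 + \<i> * of_real m - L)) \<le> 26 * err n t" by (simp add: norm_mult)
  qed (use err_pos exponents in auto)
  have "Lp_bounded M s (\<lambda>x. (1 - L) * fo x) (15 * err n t)"
  proof (rule Lp_bounded_scale)
    show "Lp_bounded M s fo (2 * x)"
      unfolding fo_def x_def by (rule first_order_Lp_bounded[OF assms(4,3,2)])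
    have "cmod (1 - L) * (2 * x) \<le> (x + 26 * err n t) * (2 * x)"
      using L(2) x0 by (intro mult_right_mono) (auto simp: norm_minus_commute x_def)
    then show "cmod (1 - L) * (2 * x) \<le> 15 * err n t" using x2 by (simp add: mult_ac)
  qed (use err_pos exponents in auto)
  then have "Lp_bounded M s (\<lambda>x. (L * Pr t h x - I - (fo x + \<i> * of_real m * I))
      + (I * (1 + \<i> * of_real m - L) + (1 - L) * fo x)) (2 * err n t + (26 * err n t + 15 * err n t))"
    by (intro Lp_bounded_add fe c exponents)
  then have "Lp_bounded M s (\<lambda>x. inverse L * ((L * Pr t h x - I - (fo x + \<i> * of_real m * I))
      + (I * (1 + \<i> * of_real m - L) + (1 - L) * fo x))) (86 * err n t)"
  proof (rule Lp_bounded_scale)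
    have "cmod (inverse L) \<le> 2"
      using L(3) le_imp_inverse_le[of "1 / 2" "cmod L"] by (simp add: norm_inverse)
    then show "cmod (inverse L) * (2 * err n t + (26 * err n t + 15 * err n t)) \<le> 86 * err n t"
      using err_pos[of n t] mult_right_mono[of "cmod (inverse L)" 2 "43 * err n t"] by simp
  qed (use err_pos exponents in auto)
  moreover have "inverse L * ((L * Pr t h x - I - (fo x + \<i> * of_real m * I))
      + (I * (1 + \<i> * of_real m - L) + (1 - L) * fo x)) = Pr t h x - I - fo x" for x
    using \<open>L \<noteq> 0\<close> by (simp add: field_simps)
  ultimately show ?thesis by (simp add: I_def fo_def)
qed

end

section \<open>The derivative of the eigenprojector\<close>

text \<open>The increments have summable L^1 norms, so their series converges absolutely almost
  everywhere.\<close>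

lemma (in prob_space) AE_convergent_of_geometric:
  fixes g :: "nat \<Rightarrow> 'a \<Rightarrow> complex"
  assumes d: "\<And>n. n0 \<le> n \<Longrightarrow> Lp_bounded M s (\<lambda>x. g (Suc n) x - g n x) (A * \<eta> ^ n)"
    and \<eta>: "0 < \<eta>" "\<eta> < 1" and s: "1 \<le> s"
  shows "AE x in M. convergent (\<lambda>n. g n x)"
proof -
  define e where "e n x = cmod (g (Suc (n + n0)) x - g (n + n0) x)" for n x
  have b: "integrable M (e n)" "(\<integral>x. e n x \<partial>M) \<le> A * \<eta> ^ (n + n0)" for n
    unfolding e_def using Lp_bounded_integrable[OF d s, of "n + n0"] by auto
  then have [measurable]: "e n \<in> borel_measurable M" for n by auto
  have sm: "summable (\<lambda>n. A * \<eta> ^ (n + n0))"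
    unfolding power_add mult.assoc[symmetric] using \<eta> by (intro summable_mult summable_mult2 summable_geometric) auto
  have "(\<integral>\<^sup>+x. (\<Sum>n. ennreal (e n x)) \<partial>M) = (\<Sum>n. \<integral>\<^sup>+x. ennreal (e n x) \<partial>M)"
    by (rule nn_integral_suminf) measurable
  also have "\<dots> \<le> (\<Sum>n. ennreal (A * \<eta> ^ (n + n0)))"
    using b by (intro suminf_le summableI) (subst nn_integral_eq_integral, auto simp: e_def[abs_def] intro!: ennreal_leI)
  also have "\<dots> < \<infinity>"
    using sm Lp_boundedD(2)[OF d] by (subst suminf_ennreal2) (auto intro: less_imp_le)
  finally have "(\<integral>\<^sup>+x. (\<Sum>n. ennreal (e n x)) \<partial>M) \<noteq> \<infinity>" by simp
  then have "AE x in M. (\<Sum>n. ennreal (e n x)) \<noteq> \<infinity>"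
    by (intro nn_integral_PInf_AE) auto
  then show ?thesis
  proof eventually_elim
    case (elim x)
    then have "summable (\<lambda>n. e n x)"
      by (intro summable_suminf_not_top) (auto simp: e_def)
    then have "summable (\<lambda>n. g (Suc (n + n0)) x - g (n + n0) x)"
      unfolding e_def by (rule summable_norm_cancel)
    then have "convergent (\<lambda>n. g n x - g n0 x)"
      unfolding summable_iff_convergent
      using sum_lessThan_telescope[of "\<lambda>n. g (n + n0) x"] convergent_ignore_initial_segment[of "\<lambda>n. g n x - g n0 x" n0]
      by simp
    then have "convergent (\<lambda>n. (g n x - g n0 x) + g n0 x)" by (intro convergent_add convergent_const)
    then show ?case by simp
  qed
qed

lemma (in prob_space) Lp_bounded_limit_of_geometric:
  fixes g :: "nat \<Rightarrow> 'a \<Rightarrow> complex"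
  assumes d: "\<And>n. n0 \<le> n \<Longrightarrow> Lp_bounded M s (\<lambda>x. g (Suc n) x - g n x) (A * \<eta> ^ n)"
    and \<eta>: "0 < \<eta>" "\<eta> < 1" and s: "1 \<le> s" and [measurable]: "\<And>n. g n \<in> borel_measurable M"
    and n: "n0 \<le> n"
  shows "Lp_bounded M s (\<lambda>x. lim (\<lambda>n. g n x) - g n x) (A * \<eta> ^ n / (1 - \<eta>))"
proof (rule Lp_bounded_Fatou)
  have A: "0 < A" using Lp_boundedD(2)[OF d[OF order_refl]] \<eta> by (simp add: zero_less_mult_iff)
  fix k
  \<comment> \<open>Partial sums have \<open>Suc k\<close> terms because an empty sum would have the
    forbidden bound 0.\<close>
  have "Lp_bounded M s (\<lambda>x. \<Sum>j<Suc k. g (Suc (n + j)) x - g (n + j) x) (\<Sum>j<Suc k. A * \<eta> ^ (n + j))"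
    using n s by (intro Lp_bounded_sum d) (auto simp: lessThan_empty_iff)
  moreover have "(\<Sum>j<Suc k. g (Suc (n + j)) x - g (n + j) x) = g (n + Suc k) x - g n x" for x
    using sum_lessThan_telescope[of "\<lambda>j. g (n + j) x" "Suc k"] by (simp del: sum.lessThan_Suc)
  ultimately have "Lp_bounded M s (\<lambda>x. g (n + Suc k) x - g n x) (\<Sum>j<Suc k. A * \<eta> ^ (n + j))"
    by (simp only:)
  then show "Lp_bounded M s (\<lambda>x. g (n + Suc k) x - g n x) (A * \<eta> ^ n / (1 - \<eta>))"
  proof (rule Lp_bounded_mono)
    have "(\<Sum>j<Suc k. A * \<eta> ^ (n + j)) = A * \<eta> ^ n * (\<Sum>j<Suc k. \<eta> ^ j)"
      unfolding sum_distrib_left by (simp add: power_add mult.assoc)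
    also have "(\<Sum>j<Suc k. \<eta> ^ j) \<le> 1 / (1 - \<eta>)"
      using \<eta> by (subst geometric_sum) (auto simp: field_simps)
    finally show "(\<Sum>j<Suc k. A * \<eta> ^ (n + j)) \<le> A * \<eta> ^ n / (1 - \<eta>)"
      using A \<eta> by (simp add: mult_left_mono)
  qed (use s in simp)
next
  have "AE x in M. convergent (\<lambda>n. g n x)"
    by (rule AE_convergent_of_geometric[where g = g, OF d \<eta> s])
  then show "AE x in M. (\<lambda>k. g (n + Suc k) x - g n x) \<longlonglongrightarrow> lim (\<lambda>n. g n x) - g n x"
  proof eventually_elim
    case (elim x)
    then have "(\<lambda>n. g n x) \<longlonglongrightarrow> lim (\<lambda>n. g n x)" by (simp add: convergent_LIMSEQ_iff)
    then have "(\<lambda>k. g (k + (n + 1)) x) \<longlonglongrightarrow> lim (\<lambda>n. g n x)" by (rule LIMSEQ_ignore_initial_segment)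
    then show ?case by (intro tendsto_diff) (auto simp: ac_simps)
  qed
qed (use s in auto)

section \<open>The limit operator and its linearity\<close>

context perturbed_transfer
begin

text \<open>No exponent and no spectral object enters, so the operator is the same for all of them.
  Where the sequence diverges the value of \<open>lim\<close> is arbitrary; these points will form a
  null set.\<close>

definition derivative_op :: "2 \<Rightarrow> 'a operator" where
  "derivative_op i h x = lim (\<lambda>n. first_order n (axis i 1) h x)"

lemma weighted_S_integrable:
  assumes "h \<in> borel_measurable M" "AE x in M. cmod (h x) \<le> c"
  shows "integrable M (\<lambda>x. of_real (t \<bullet> S n x) * h x)"
proof -
  have [measurable]: "h \<in> borel_measurable M" by fact
  show ?thesis
  proof (rule Bochner_Integration.integrable_bound[of _ "\<lambda>x. c * (t \<bullet> S n x)"])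
    show "integrable M (\<lambda>x. c * (t \<bullet> S n x))" using integral_S(1)[of n] by auto
    show "AE x in M. cmod (of_real (t \<bullet> S n x) * h x) \<le> norm (c * (t \<bullet> S n x))"
      using assms(2)
    proof eventually_elim
      case (elim x)
      then have "cmod (h x) \<le> \<bar>c\<bar>" by linarith
      then show ?case by (simp add: norm_mult abs_mult mult.commute mult_right_mono)
    qed
  qed measurable
qed

lemma first_order_measurable:
  assumes "h \<in> borel_measurable M" "AE x in M. cmod (h x) \<le> c"
  shows "first_order n t h \<in> borel_measurable M"
proof -
  interpret n: transfer_system M "f ^^ n" "P ^^ n" by (rule transfer_system_funpow)
  have "(P ^^ n) (\<lambda>x. of_real (t \<bullet> S n x) * h x) \<in> borel_measurable M"
    using n.transfer_integrable[OF weighted_S_integrable[OF assms]] by auto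
  then show ?thesis unfolding first_order_def[abs_def] by measurable
qed

lemma first_order_linear_direction:
  assumes "h \<in> borel_measurable M" "AE x in M. cmod (h x) \<le> c"
  shows "AE x in M. first_order n (a *\<^sub>R t + b *\<^sub>R u) h x
    = of_real a * first_order n t h x + of_real b * first_order n u h x"
proof -
  interpret n: transfer_system M "f ^^ n" "P ^^ n" by (rule transfer_system_funpow)
  have e: "(\<lambda>x. of_real ((a *\<^sub>R t + b *\<^sub>R u) \<bullet> S n x) * h x) =
    (\<lambda>x. of_real a * (of_real (t \<bullet> S n x) * h x) + of_real b * (of_real (u \<bullet> S n x) * h x))"
    by (simp add: inner_add_left algebra_simps)
  show ?thesis unfolding first_order_def e
    using n.transfer_add_AE[OF weighted_S_integrable[OF assms, of t n] weighted_S_integrable[OF assms, of u n],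
        of "of_real a" "of_real b"]
    by eventually_elim (simp add: inner_add_left algebra_simps)
qed

lemma first_order_components:
  assumes "h \<in> borel_measurable M" "AE x in M. cmod (h x) \<le> c"
  shows "AE x in M. first_order n t h x = (\<Sum>i\<in>UNIV. of_real (t $ i) * first_order n (axis i 1) h x)"
proof -
  have "t = (t $ 1) *\<^sub>R axis 1 1 + (t $ 2) *\<^sub>R axis 2 1"
    by (simp add: vec_eq_iff forall_2 axis_def)
  then show ?thesis
    using first_order_linear_direction[OF assms, of n "t $ 1" "axis 1 1" "t $ 2" "axis 2 1"]
    by (simp add: sum_2)
qed

lemma first_order_linear:
  assumes g: "g \<in> borel_measurable M" "AE x in M. cmod (g x) \<le> c"
    and h: "h \<in> borel_measurable M" "AE x in M. cmod (h x) \<le> d"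
  shows "AE x in M. first_order n t (\<lambda>x. a * g x + b * h x) x = a * first_order n t g x + b * first_order n t h x"
proof -
  interpret n: transfer_system M "f ^^ n" "P ^^ n" by (rule transfer_system_funpow)
  have i: "integrable M g" "integrable M h"
    using integrable_const_bound[OF g(2,1)] integrable_const_bound[OF h(2,1)] by auto
  have e: "(\<lambda>x. of_real (t \<bullet> S n x) * (a * g x + b * h x)) =
    (\<lambda>x. a * (of_real (t \<bullet> S n x) * g x) + b * (of_real (t \<bullet> S n x) * h x))"
    by (simp add: algebra_simps)
  have I: "(\<integral>x. a * g x + b * h x \<partial>M) = a * (\<integral>x. g x \<partial>M) + b * (\<integral>x. h x \<partial>M)"
    using i by simp
  show ?thesis unfolding first_order_def e I
    using n.transfer_add_AE[OF weighted_S_integrable[OF g, of t n] weighted_S_integrable[OF h, of t n], of a b]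
    by eventually_elim (simp add: algebra_simps)
qed

lemma derivative_op_measurable:
  assumes "h \<in> borel_measurable M" "AE x in M. cmod (h x) \<le> c"
  shows "derivative_op i h \<in> borel_measurable M"
  unfolding derivative_op_def[abs_def]
  by (rule borel_measurable_lim_metric) (rule first_order_measurable[OF assms])

text \<open>Convergence is established on the unit ball only. Applied to a scalar multiple, the
  first conclusion carries it to the whole space.\<close>

lemma derivative_op_linear:
  assumes g: "g \<in> borel_measurable M" "AE x in M. cmod (g x) \<le> c"
      "AE x in M. convergent (\<lambda>n. first_order n (axis i 1) g x)"
    and h: "h \<in> borel_measurable M" "AE x in M. cmod (h x) \<le> d"
      "AE x in M. convergent (\<lambda>n. first_order n (axis i 1) h x)"
  shows "AE x in M. convergent (\<lambda>n. first_order n (axis i 1) (\<lambda>x. a * g x + b * h x) x)"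
    and "AE x in M. derivative_op i (\<lambda>x. a * g x + b * h x) x = a * derivative_op i g x + b * derivative_op i h x"
proof -
  have "AE x in M. \<forall>n. first_order n (axis i 1) (\<lambda>x. a * g x + b * h x) x =
      a * first_order n (axis i 1) g x + b * first_order n (axis i 1) h x"
    unfolding AE_all_countable using first_order_linear[OF g(1,2) h(1,2)] by blast
  then have lim: "AE x in M. (\<lambda>n. first_order n (axis i 1) (\<lambda>x. a * g x + b * h x) x) \<longlonglongrightarrow>
      a * derivative_op i g x + b * derivative_op i h x"
    using g(3) h(3)
  proof eventually_elim
    case (elim x)
    from elim(2,3) show ?case
      unfolding elim(1)[rule_format] derivative_op_def convergent_LIMSEQ_iff
      by (intro tendsto_intros)
  qed
  from lim show "AE x in M. convergent (\<lambda>n. first_order n (axis i 1) (\<lambda>x. a * g x + b * h x) x)"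
    by eventually_elim (auto simp: convergent_def)
  from lim show "AE x in M. derivative_op i (\<lambda>x. a * g x + b * h x) x = a * derivative_op i g x + b * derivative_op i h x"
    by eventually_elim (simp add: derivative_op_def limI)
qed

end

section \<open>Exponential convergence of the first-order terms\<close>

context spectral_expansion
begin

\<comment> \<open>Comparing the expansions of order \<open>n\<close> and \<open>n + 1\<close> at \<open>|t| = \<theta>\<^bsup>n/\<gamma>\<^esup>\<close>, where both errors are of
  order \<open>|t|\<^sup>\<gamma>\<close> up to a power of \<open>n\<close>, bounds the increments by \<open>|t|\<^bsup>\<gamma> - 1\<^esup>\<close>.\<close>
lemma first_order_increments:
  assumes b: "0 < b" "\<And>t. norm t \<le> b \<Longrightarrow> t \<in> T"
  obtains A \<eta> n0 where "0 < A" "0 < \<eta>" "\<eta> < 1" and "\<And>n h i. n0 \<le> n \<Longrightarrow> h \<in> H \<Longrightarrow>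
    Lp_bounded M s (\<lambda>x. first_order (Suc n) (axis i 1) h x - first_order n (axis i 1) h x) (A * \<eta> ^ n)"
proof -
  define c where "c = - ln \<theta>"
  have c: "0 < c" "\<theta> = exp (- c)" using constants by (auto simp: c_def)
  define \<rho> where "\<rho> = exp (- c / \<gamma>)"
  \<comment> \<open>After division by |t| the error is exp (- c (1 - 1/\<gamma>) n) times a
    polynomial in n. One half of this rate becomes \<eta>, the other half absorbs the
    polynomial.\<close>
  define \<delta> where "\<delta> = c * (1 - 1 / \<gamma>) / 2"
  define \<eta> where "\<eta> = exp (- \<delta>)"
  have \<delta>: "0 < \<delta>" using c exponents by (simp add: \<delta>_def)
  define a where "a = c / \<gamma>"
  have a: "0 < a" using c exponents by (simp add: a_def)
  define E where "E n = (((real n + 1) * K) powr \<gamma> + C) * \<theta> ^ n" for n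
  have \<rho>n: "\<rho> ^ n = exp (- a * real n)" for n
    by (simp add: \<rho>_def a_def exp_of_nat2_mult[symmetric] mult.commute)
  have \<theta>n: "\<theta> ^ n = exp (- c * real n)" for n
    using c(2) by (simp add: exp_of_nat2_mult[symmetric] mult.commute)
  have \<eta>n: "\<eta> ^ n = exp (- \<delta> * real n)" for n
    by (simp add: \<eta>_def exp_of_nat2_mult[symmetric] mult.commute)
  have le: "((real n + 1) * K) powr \<gamma> \<le> ((real n + 1) * K)\<^sup>2" for n
  proof -
    have "1 \<le> (real n + 1) * K" using constants mult_mono[of 1 "real n + 1" 1 K] by simp
    then have "((real n + 1) * K) powr \<gamma> \<le> ((real n + 1) * K) powr 2"
      using exponents by (intro powr_mono) auto
    then show ?thesis using \<open>1 \<le> (real n + 1) * K\<close> by simp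
  qed
  have "(\<lambda>n. (real n + 1) * K * exp (- a * real n)) \<longlonglongrightarrow> 0"
    using a constants(4) by real_asymp
  then have 1: "eventually (\<lambda>n. (real n + 1) * K * \<rho> ^ n < 1 / 4) sequentially"
    unfolding \<rho>n[symmetric] by (rule order_tendstoD) simp
  have "(\<lambda>n. exp (- a * real n)) \<longlonglongrightarrow> 0" using a constants(4) by real_asymp
  then have 2: "eventually (\<lambda>n. \<rho> ^ n < b) sequentially"
    unfolding \<rho>n[symmetric] by (rule order_tendstoD) (rule b)
  have "(\<lambda>n. (((real n + 1) * K)\<^sup>2 + C) * exp (- c * real n)) \<longlonglongrightarrow> 0" using c(1) constants(1,4) by real_asymp
  then have 3: "eventually (\<lambda>n. (((real n + 1) * K)\<^sup>2 + C) * exp (- c * real n) < 1 / 104) sequentially"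
    by (rule order_tendstoD) simp
  have "(\<lambda>n. (((real n + 1) * K)\<^sup>2 + C) * exp (- \<delta> * real n)) \<longlonglongrightarrow> 0" using \<delta> constants(1,4) by real_asymp
  then have 4: "eventually (\<lambda>n. (((real n + 1) * K)\<^sup>2 + C) * exp (- \<delta> * real n) < 1) sequentially"
    by (rule order_tendstoD) simp
  from eventually_conj[OF eventually_conj[OF 1 2] eventually_conj[OF eventually_conj[OF 3 4] eventually_ge_at_top[of 1]]]
  obtain n0 where n0: "\<And>n. n0 \<le> n \<Longrightarrow> (real n + 1) * K * \<rho> ^ n < 1 / 4 \<and> \<rho> ^ n < b \<and>
    (((real n + 1) * K)\<^sup>2 + C) * exp (- c * real n) < 1 / 104 \<and>
    (((real n + 1) * K)\<^sup>2 + C) * exp (- \<delta> * real n) < 1 \<and> 1 \<le> n"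
    unfolding eventually_sequentially by auto
  show ?thesis
  proof (rule that[of 172 \<eta> n0])
    show "0 < (172::real)" "0 < \<eta>" "\<eta> < 1" using \<delta> by (auto simp: \<eta>_def)
    fix n h and i :: 2 assume n: "n0 \<le> n" and h: "h \<in> H"
    note n0 = n0[OF n]
    define t :: plane where "t = \<rho> ^ n *\<^sub>R axis i 1"
    have \<rho>: "0 < \<rho> ^ n" "\<rho> \<noteq> 0" by (simp_all add: \<rho>_def)
    have nt: "norm t = \<rho> ^ n" using \<rho> by (simp add: t_def)
    have t: "t \<in> T" by (rule b) (use n0 nt in simp)
    have t0: "t \<noteq> 0" using \<rho>(1) nt norm_eq_zero[of t] by linarith
    have pw: "(\<rho> ^ n) powr \<gamma> = \<theta> ^ n"
      using exponents by (simp add: \<rho>n \<theta>n powr_def a_def)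
    have err: "err m t \<le> E n" and x: "real m * K * norm t \<le> 1 / 4" if "n \<le> m" "m \<le> Suc n" for m
    proof -
      have m: "real m \<le> real n + 1" using that by auto
      have "(real m * K) powr \<gamma> \<le> ((real n + 1) * K) powr \<gamma>"
        using m constants exponents by (intro powr_mono2 mult_right_mono) auto
      moreover have "\<theta> ^ m \<le> \<theta> ^ n" using constants that by (intro power_decreasing) auto
      ultimately have "(real m * K) powr \<gamma> * \<theta> ^ n + C * \<theta> ^ m \<le> ((real n + 1) * K) powr \<gamma> * \<theta> ^ n + C * \<theta> ^ n"
        using constants by (intro add_mono mult_left_mono mult_right_mono) auto
      then show "err m t \<le> E n"
        using constants \<rho> by (simp add: err_def E_def nt powr_mult pw algebra_simps)
      have "real m * K * \<rho> ^ n \<le> (real n + 1) * K * \<rho> ^ n"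
        using m constants \<rho> by (intro mult_right_mono) auto
      then show "real m * K * norm t \<le> 1 / 4" using n0 by (simp add: nt)
    qed
    have "E n \<le> (((real n + 1) * K)\<^sup>2 + C) * \<theta> ^ n"
      unfolding E_def using constants le by (intro mult_right_mono add_mono) auto
    also note \<theta>n
    finally have En: "E n \<le> (((real n + 1) * K)\<^sup>2 + C) * exp (- c * real n)" .
    have pe: "Lp_bounded M s (\<lambda>x. Pr t h x - (\<integral>x. h x \<partial>M) - first_order m t h x) (86 * E n)"
      if "n \<le> m" "m \<le> Suc n" for m
      by (rule Lp_bounded_mono[OF projector_expansion]) (use that n0 err[OF that] x[OF that] En t t0 h exponents in auto)
    \<comment> \<open>At a common \<open>t\<close> the projector cancels between the two orders.
      Dividing by |t| is then possible because the first-order terms are linear in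
      \<open>t\<close>.\<close>
    have "Lp_bounded M s (\<lambda>x. (Pr t h x - (\<integral>x. h x \<partial>M) - first_order n t h x) -
        (Pr t h x - (\<integral>x. h x \<partial>M) - first_order (Suc n) t h x)) (86 * E n + 86 * E n)"
      by (intro Lp_bounded_diff pe exponents) auto
    then have "Lp_bounded M s (\<lambda>x. of_real (inverse (\<rho> ^ n)) * (first_order (Suc n) t h x - first_order n t h x)) (172 * \<eta> ^ n)"
    proof (intro Lp_bounded_scale[of _ _ _ "172 * E n"])
      have "exp (- c * real n) = \<eta> ^ n * exp (- \<delta> * real n) * \<rho> ^ n"
        unfolding \<eta>n \<rho>n exp_add[symmetric] using exponents by (simp add: \<delta>_def a_def field_simps)
      then have "E n \<le> ((((real n + 1) * K)\<^sup>2 + C) * exp (- \<delta> * real n)) * (\<eta> ^ n * \<rho> ^ n)"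
        using En by (simp add: mult_ac)
      also have "\<dots> \<le> 1 * (\<eta> ^ n * \<rho> ^ n)"
        using n0 \<rho> by (intro mult_right_mono) (auto simp: \<eta>_def)
      finally show "cmod (of_real (inverse (\<rho> ^ n))) * (172 * E n) \<le> 172 * \<eta> ^ n"
        unfolding norm_of_real using \<rho> by (simp add: field_simps)
    qed (use exponents in \<open>auto simp: \<eta>_def\<close>)
    then show "Lp_bounded M s (\<lambda>x. first_order (Suc n) (axis i 1) h x - first_order n (axis i 1) h x) (172 * \<eta> ^ n)"
    proof (rule Lp_bounded_cong_AE)
      show "AE x in M. first_order (Suc n) (axis i 1) h x - first_order n (axis i 1) h x
         = of_real (inverse (\<rho> ^ n)) * (first_order (Suc n) t h x - first_order n t h x)"
        using first_order_linear_direction[OF H[OF h], of n "\<rho> ^ n" "axis i 1" 0 0]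
          first_order_linear_direction[OF H[OF h], of "Suc n" "\<rho> ^ n" "axis i 1" 0 0]
        by eventually_elim (use \<rho> in \<open>simp add: t_def[symmetric] field_simps\<close>)
    qed (use first_order_measurable[OF H[OF h]] exponents in auto)
  qed
qed

lemma derivative_op_Lp_bounded:
  assumes b: "0 < b" "\<And>t. norm t \<le> b \<Longrightarrow> t \<in> T"
  obtains B where "\<And>h i. h \<in> H \<Longrightarrow> Lp_bounded M s (derivative_op i h) B"
    and "\<And>h i. h \<in> H \<Longrightarrow> AE x in M. convergent (\<lambda>n. first_order n (axis i 1) h x)"
proof -
  obtain A \<eta> n0 where A: "0 < A" and \<eta>: "0 < \<eta>" "\<eta> < 1" and inc: "\<And>n h i. n0 \<le> n \<Longrightarrow> h \<in> H \<Longrightarrow>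
    Lp_bounded M s (\<lambda>x. first_order (Suc n) (axis i 1) h x - first_order n (axis i 1) h x) (A * \<eta> ^ n)"
    by (rule first_order_increments[OF b]) auto
  show ?thesis
  proof (rule that)
    fix h i assume h: "h \<in> H"
    \<comment> \<open>The index starts at \<open>Suc n0\<close> because
      \<open>first_order_Lp_bounded\<close> asks for a positive order.\<close>
    note lim = Lp_bounded_limit_of_geometric[of "Suc n0" s "\<lambda>n. first_order n (axis i 1) h" A \<eta> "Suc n0",
        OF inc[OF Suc_leD h] \<eta> exponents(1) first_order_measurable[OF H[OF h]] order_refl]
    have "Lp_bounded M s (\<lambda>x. (lim (\<lambda>n. first_order n (axis i 1) h x) - first_order (Suc n0) (axis i 1) h x)
        + first_order (Suc n0) (axis i 1) h x)
        (A * \<eta> ^ Suc n0 / (1 - \<eta>) + 2 * (real (Suc n0) * K * norm (axis i 1 :: plane)))"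
      by (intro Lp_bounded_add lim first_order_Lp_bounded h exponents) (auto simp: axis_eq_0_iff)
    then show "Lp_bounded M s (derivative_op i h) (A * \<eta> ^ Suc n0 / (1 - \<eta>) + 2 * (real (Suc n0) * K))"
      by (simp add: derivative_op_def[abs_def])
    show "AE x in M. convergent (\<lambda>n. first_order n (axis i 1) h x)"
      by (rule AE_convergent_of_geometric[OF inc[OF _ h] \<eta> exponents(1)])
  qed
qed

text \<open>The order is n \<approx> L ln (1/|t|), with \<open>L\<close> large enough for \<theta>^n
  \<le> |t|^2 and \<eta>^n \<le> |t|. The spectral remainder and |t| times the distance of A_n from
  its limit are then both O(|t|^2).\<close>

theorem projector_derivative:
  assumes b: "0 < b" "\<And>t. norm t \<le> b \<Longrightarrow> t \<in> T" and \<gamma>': "1 < \<gamma>'" "\<gamma>' < \<gamma>"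
  shows "\<exists>B>0. \<forall>\<^sub>F t in at 0. \<forall>h\<in>H. Lp_bounded M s
    (\<lambda>x. Pr t h x - (\<integral>x. h x \<partial>M) - (\<Sum>i\<in>UNIV. of_real (t $ i) * derivative_op i h x)) (B * norm t powr \<gamma>')"
proof -
  obtain A \<eta> n0 where A: "0 < A" and \<eta>: "0 < \<eta>" "\<eta> < 1" and inc: "\<And>n h i. n0 \<le> n \<Longrightarrow> h \<in> H \<Longrightarrow>
    Lp_bounded M s (\<lambda>x. first_order (Suc n) (axis i 1) h x - first_order n (axis i 1) h x) (A * \<eta> ^ n)"
    by (rule first_order_increments[OF b]) auto
  define L where "L = 2 / (- ln \<theta>) + 1 / (- ln \<eta>)"
  have ln: "0 < - ln \<theta>" "0 < - ln \<eta>" using constants \<eta> by auto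
  then have L: "0 < L" unfolding L_def by (intro add_pos_pos divide_pos_pos) auto
  have L\<theta>: "2 \<le> L * (- ln \<theta>)" and L\<eta>: "1 \<le> L * (- ln \<eta>)"
    using ln mult_right_mono[of "2 / (- ln \<theta>)" L "- ln \<theta>"] mult_right_mono[of "1 / (- ln \<eta>)" L "- ln \<eta>"]
    by (simp_all add: L_def)
  define N where "N r = nat \<lceil>L * ln (1 / r)\<rceil>" for r :: real
  \<comment> \<open>Chosen so that (1 - a) \<gamma> = \<gamma>'; the remaining factor |t|^a
    outweighs the logarithm contained in n.\<close>
  define a where "a = 1 - \<gamma>' / \<gamma>"
  have a: "0 < a" using \<gamma>' by (simp add: a_def)
  have lim1: "((\<lambda>r. (L * ln (1 / r) + 1) * K * r powr a) \<longlongrightarrow> 0) (at_right 0)"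
    using a L constants(4) by real_asymp
  have lim2: "filterlim (\<lambda>r. L * ln (1 / r)) at_top (at_right 0)"
    using L constants(4) by real_asymp
  have lim3: "((\<lambda>r::real. r) \<longlongrightarrow> 0) (at_right 0)" by real_asymp
  have lim4: "((\<lambda>r. (L * ln (1 / r) + 1) * K * r) \<longlongrightarrow> 0) (at_right 0)"
    using L constants(4) by real_asymp
  have lim5: "((\<lambda>r. ((L * ln (1 / r) + 1) * K * r) powr \<gamma> + C * r\<^sup>2) \<longlongrightarrow> 0 powr \<gamma> + C * 0\<^sup>2) (at_right 0)"
    using lim4 lim3 constants L \<gamma>'
    by (intro tendsto_add tendsto_powr' tendsto_mult tendsto_power tendsto_const)
      (auto simp: eventually_at_right_field intro!: exI[of _ 1] mult_nonneg_nonneg add_nonneg_nonneg)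
  have ev: "eventually (\<lambda>r. (L * ln (1 / r) + 1) * K * r powr a < 1 \<and> real (Suc n0) \<le> L * ln (1 / r) \<and> r < min b 1 \<and>
      (L * ln (1 / r) + 1) * K * r < 1 / 4 \<and> ((L * ln (1 / r) + 1) * K * r) powr \<gamma> + C * r\<^sup>2 < 1 / 104) (at_right 0)"
    by (intro eventually_conj order_tendstoD(2)[OF lim1] order_tendstoD(2)[OF lim3] order_tendstoD(2)[OF lim4]
        order_tendstoD(2)[OF lim5] filterlim_at_top[THEN iffD1, rule_format, OF lim2]) (use b \<gamma>' in auto)
  define B where "B = 86 * (1 + C) + (A / (1 - \<eta>) + A / (1 - \<eta>))"
  have B: "0 < B" using A \<eta> constants by (auto simp: B_def intro!: add_pos_pos)
  have main: "Lp_bounded M s (\<lambda>x. Pr t h x - (\<integral>x. h x \<partial>M) - (\<Sum>i\<in>UNIV. of_real (t $ i) * derivative_op i h x)) (B * norm t powr \<gamma>')"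
    if r: "r = norm t" "0 < r" "(L * ln (1 / r) + 1) * K * r powr a < 1" "real (Suc n0) \<le> L * ln (1 / r)" "r < min b 1"
      "(L * ln (1 / r) + 1) * K * r < 1 / 4" "((L * ln (1 / r) + 1) * K * r) powr \<gamma> + C * r\<^sup>2 < 1 / 104" and h: "h \<in> H" for r t h
  proof -
    define n where "n = N r"
    have n1: "L * ln (1 / r) \<le> real n" "real n \<le> L * ln (1 / r) + 1"
      using r(4) unfolding n_def N_def by linarith+
    have n: "1 \<le> n" "n0 \<le> n" using n1 r(4) by linarith+
    have decay: "q ^ n \<le> r powr k" if q: "0 < q" "q < 1" "k \<le> L * (- ln q)" for q k
    proof -
      have lr: "0 \<le> ln (1 / r)" using r by simp
      have "k * ln (1 / r) \<le> L * (- ln q) * ln (1 / r)" using q lr by (intro mult_right_mono) auto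
      also have "\<dots> = (L * ln (1 / r)) * (- ln q)" by simp
      also have "\<dots> \<le> real n * (- ln q)" using n1 q by (intro mult_right_mono) auto
      finally have "real n * ln q \<le> k * ln r" using r by (simp add: ln_div)
      then show ?thesis using q r by (simp add: powr_def powr_realpow[symmetric])
    qed
    have \<theta>n: "\<theta> ^ n \<le> r\<^sup>2" using decay[of \<theta> 2] constants L\<theta> r by simp
    have \<eta>n: "\<eta> ^ n \<le> r" using decay[of \<eta> 1] \<eta> L\<eta> r by simp
    have t: "t \<in> T" "t \<noteq> 0" using r b by auto
    have xl: "real n * K * r \<le> (L * ln (1 / r) + 1) * K * r"
      using n1 constants r by (intro mult_right_mono) auto
    have "(real n * K * r) powr \<gamma> \<le> ((L * ln (1 / r) + 1) * K * r) powr \<gamma>"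
      using xl constants r \<gamma>' by (intro powr_mono2) auto
    moreover have C\<theta>: "C * \<theta> ^ n \<le> C * r\<^sup>2" using \<theta>n constants by (intro mult_left_mono) auto
    ultimately have err: "err n t \<le> ((L * ln (1 / r) + 1) * K * r) powr \<gamma> + C * r\<^sup>2"
      by (simp add: err_def r(1)[symmetric])
    have r2: "r powr 2 \<le> r powr \<gamma>'" using r \<gamma>' exponents by (intro powr_mono') auto
    have "err n t \<le> (1 + C) * r powr \<gamma>'"
    proof -
      have e: "\<gamma>' = (1 - a) * \<gamma>" using \<gamma>' by (simp add: a_def)
      have "(L * ln (1 / r) + 1) * K * r = ((L * ln (1 / r) + 1) * K * r powr a) * r powr (1 - a)"
        using r by (simp add: powr_add[symmetric] mult.assoc)
      also have "\<dots> powr \<gamma> \<le> (1 * r powr (1 - a)) powr \<gamma>"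
        using r L constants \<gamma>' by (intro powr_mono2 mult_right_mono) auto
      also have "\<dots> = r powr \<gamma>'" by (simp add: powr_powr e)
      finally have "((L * ln (1 / r) + 1) * K * r) powr \<gamma> \<le> r powr \<gamma>'" .
      moreover have "C * r\<^sup>2 \<le> C * r powr \<gamma>'" using r2 r constants by (intro mult_left_mono) auto
      ultimately show ?thesis using err by (simp add: algebra_simps)
    qed
    then have pe: "Lp_bounded M s (\<lambda>x. Pr t h x - (\<integral>x. h x \<partial>M) - first_order n t h x) (86 * ((1 + C) * r powr \<gamma>'))"
      by (intro Lp_bounded_mono[OF projector_expansion[OF t n(1) h]]) (use xl err r exponents in auto)
    have dc: "Lp_bounded M s (\<lambda>x. of_real (t $ i) * (derivative_op i h x - first_order n (axis i 1) h x)) (A / (1 - \<eta>) * r powr \<gamma>')" for i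
    proof (rule Lp_bounded_scale)
      show "Lp_bounded M s (\<lambda>x. derivative_op i h x - first_order n (axis i 1) h x) (A * \<eta> ^ n / (1 - \<eta>))"
        unfolding derivative_op_def
        by (rule Lp_bounded_limit_of_geometric[OF inc[OF _ h] \<eta> exponents(1) first_order_measurable[OF H[OF h]] n(2)])
      have "\<bar>t $ i\<bar> * \<eta> ^ n \<le> r * r"
        using component_le_norm_cart[of t i] r \<eta>n \<eta> by (intro mult_mono) auto
      also have "r * r \<le> r powr \<gamma>'" using r2 r by (simp add: power2_eq_square)
      finally have "\<bar>t $ i\<bar> * \<eta> ^ n * (A / (1 - \<eta>)) \<le> r powr \<gamma>' * (A / (1 - \<eta>))"
        using A \<eta> by (intro mult_right_mono) auto
      then show "cmod (of_real (t $ i)) * (A * \<eta> ^ n / (1 - \<eta>)) \<le> A / (1 - \<eta>) * r powr \<gamma>'"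
        by (simp add: mult_ac)
      show "0 < A / (1 - \<eta>) * r powr \<gamma>'" using A \<eta> r by simp
    qed (use exponents in simp)
    have "Lp_bounded M s (\<lambda>x. (Pr t h x - (\<integral>x. h x \<partial>M) - first_order n t h x) -
        (\<Sum>i\<in>UNIV. of_real (t $ i) * (derivative_op i h x - first_order n (axis i 1) h x)))
        (86 * ((1 + C) * r powr \<gamma>') + (\<Sum>i\<in>(UNIV::2 set). A / (1 - \<eta>) * r powr \<gamma>'))"
      by (intro Lp_bounded_diff Lp_bounded_sum pe dc exponents) auto
    then have R: "Lp_bounded M s (\<lambda>x. (Pr t h x - (\<integral>x. h x \<partial>M) - first_order n t h x) -
        (\<Sum>i\<in>UNIV. of_real (t $ i) * (derivative_op i h x - first_order n (axis i 1) h x))) (B * r powr \<gamma>')"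
      by (simp add: B_def sum_2 algebra_simps)
    note dm = derivative_op_measurable[OF H[OF h]]
    show ?thesis
      unfolding r(1)[symmetric]
    proof (rule Lp_bounded_cong_AE[OF R])
      show "AE x in M. Pr t h x - (\<integral>x. h x \<partial>M) - (\<Sum>i\<in>UNIV. of_real (t $ i) * derivative_op i h x) =
        (Pr t h x - (\<integral>x. h x \<partial>M) - first_order n t h x) -
        (\<Sum>i\<in>UNIV. of_real (t $ i) * (derivative_op i h x - first_order n (axis i 1) h x))"
        using first_order_components[OF H[OF h], of n t]
        by eventually_elim (simp add: sum_2 algebra_simps)
    qed (use dm Pr_measurable[OF t(1) h] exponents in auto)
  qed
  have "filterlim (\<lambda>t::plane. norm t) (at_right 0) (at 0)"
    unfolding filterlim_at by (auto simp: eventually_at_filter intro!: tendsto_eq_intros)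
  from eventually_compose_filterlim[OF ev this]
  have "\<forall>\<^sub>F t in at 0. \<forall>h\<in>H. Lp_bounded M s
    (\<lambda>x. Pr t h x - (\<integral>x. h x \<partial>M) - (\<Sum>i\<in>UNIV. of_real (t $ i) * derivative_op i h x)) (B * norm t powr \<gamma>')"
    using eventually_neq_at_within[of "0::plane" 0 UNIV]
    by eventually_elim (auto intro!: main[OF refl])
  then show ?thesis using B by blast
qed

end

section \<open>The function spaces of the tower\<close>

lemma B0_norm_measurable: "B0_norm M \<beta> s0 h < \<infinity> \<Longrightarrow> h \<in> borel_measurable M"
  by (auto simp: B0_norm_def split: if_splits)

lemma B_norm_measurable: "B_norm M \<beta> s0 \<epsilon> h < \<infinity> \<Longrightarrow> h \<in> borel_measurable M"
  by (auto simp: B_norm_def split: if_splits)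

lemma B0_norm_AE_bound:
  assumes "B0_norm M \<beta> s0 h \<le> ennreal b" "0 \<le> b"
  shows "AE x in M. cmod (h x) \<le> b"
proof -
  have "B0_norm M \<beta> s0 h < \<infinity>" using assms(1) by (rule le_less_trans) simp
  then have hm: "h \<in> borel_measurable M" by (rule B0_norm_measurable)
  have "esssup M (\<lambda>x. ennreal (cmod (h x))) \<le> B0_norm M \<beta> s0 h"
    unfolding B0_norm_def if_P[OF hm] by (metis le_iff_add)
  with assms(1) have le: "esssup M (\<lambda>x. ennreal (cmod (h x))) \<le> ennreal b" by (rule order_trans[rotated])
  show ?thesis
    using esssup_AE[of "\<lambda>x. ennreal (cmod (h x))" M]
  proof eventually_elim
    case (elim x)
    from order_trans[OF elim le] show ?case using assms(2) by simp
  qed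
qed

lemma B0_norm_const:
  assumes "cmod c \<le> b"
  shows "B0_norm M \<beta> s0 (\<lambda>_. c) \<le> ennreal b"
proof -
  have "esssup M (\<lambda>x. ennreal (cmod c)) \<le> ennreal b"
    using assms by (intro esssup_I) (auto intro: ennreal_leI)
  moreover have "esssup (M \<Otimes>\<^sub>M M) (\<lambda>(x, y). lipschitz_quotient \<beta> s0 (\<lambda>_. c) x y) \<le> 0"
  proof -
    have "(\<lambda>(x, y). lipschitz_quotient \<beta> s0 (\<lambda>_. c) x y) = (\<lambda>_. 0)"
      by (auto simp: lipschitz_quotient_def fun_eq_iff)
    then show ?thesis by (simp only:) (rule esssup_I, auto)
  qed
  ultimately show ?thesis by (simp add: B0_norm_def)
qed

lemma B0_norm_scale:
  assumes "B0_norm M \<beta> s0 h < \<infinity>"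
  shows "B0_norm M \<beta> s0 (\<lambda>x. c * h x) \<le> ennreal (cmod c) * B0_norm M \<beta> s0 h"
proof -
  have [measurable]: "h \<in> borel_measurable M" by (rule B0_norm_measurable[OF assms])
  let ?q = "\<lambda>h (x, y). lipschitz_quotient \<beta> s0 h x y"
  \<comment> \<open>\<open>esssup\<close> is infinite on nonmeasurable functions, so finiteness of
    the norm forces the Lipschitz quotient to be measurable.\<close>
  have q: "?q h \<in> borel_measurable (M \<Otimes>\<^sub>M M)"
    using assms esssup_non_measurable[of "?q h" "M \<Otimes>\<^sub>M M"] by (force simp: B0_norm_def top_add split: if_splits)
  have qe: "?q (\<lambda>x. c * h x) = (\<lambda>z. ennreal (cmod c) * ?q h z)"
    by (auto simp: lipschitz_quotient_def right_diff_distrib[symmetric] norm_mult ennreal_mult ennreal_times_divide)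
  have "esssup M (\<lambda>x. ennreal (cmod (c * h x))) \<le> ennreal (cmod c) * esssup M (\<lambda>x. ennreal (cmod (h x)))"
  proof (rule esssup_I)
    show "AE x in M. ennreal (cmod (c * h x)) \<le> ennreal (cmod c) * esssup M (\<lambda>x. ennreal (cmod (h x)))"
      using esssup_AE[of "\<lambda>x. ennreal (cmod (h x))" M]
      by eventually_elim (auto simp: norm_mult ennreal_mult intro!: mult_left_mono)
  qed measurable
  moreover have "esssup (M \<Otimes>\<^sub>M M) (?q (\<lambda>x. c * h x)) \<le> ennreal (cmod c) * esssup (M \<Otimes>\<^sub>M M) (?q h)"
    unfolding qe
  proof (rule esssup_I)
    show "AE z in M \<Otimes>\<^sub>M M. ennreal (cmod c) * ?q h z \<le> ennreal (cmod c) * esssup (M \<Otimes>\<^sub>M M) (?q h)"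
      using esssup_AE[of "?q h" "M \<Otimes>\<^sub>M M"] by eventually_elim (auto intro!: mult_left_mono)
  qed (use q in measurable)
  ultimately show ?thesis unfolding B0_norm_def by (simp add: distrib_left add_mono)
qed

locale tower_space = prob_space M for M :: "('y \<times> nat) measure" +
  assumes floor_measurable [measurable]: "snd \<in> measurable M (count_space UNIV)"
begin

lemma B_norm_le_B0_norm:
  assumes "0 < \<epsilon>"
  shows "B_norm M \<beta> s0 \<epsilon> h \<le> B0_norm M \<beta> s0 h"
proof (cases "B0_norm M \<beta> s0 h < \<infinity>")
  case True
  have [measurable]: "h \<in> borel_measurable M" by (rule B0_norm_measurable[OF True])
  let ?q = "\<lambda>(x, y). lipschitz_quotient \<beta> s0 h x y"
  have q [measurable]: "?q \<in> borel_measurable (M \<Otimes>\<^sub>M M)"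
    using True esssup_non_measurable[of ?q "M \<Otimes>\<^sub>M M"] by (force simp: B0_norm_def top_add split: if_splits)
  have "ennreal (exp (- real l * \<epsilon>)) *
      (esssup M (\<lambda>x. if snd x = l then ennreal (cmod (h x)) else 0) +
       esssup (M \<Otimes>\<^sub>M M) (\<lambda>(x, y). if snd x = l \<and> snd y = l then lipschitz_quotient \<beta> s0 h x y else 0))
      \<le> 1 * (esssup M (\<lambda>x. ennreal (cmod (h x))) + esssup (M \<Otimes>\<^sub>M M) ?q)" for l
  proof (intro mult_mono add_mono)
    show "ennreal (exp (- real l * \<epsilon>)) \<le> 1" using assms by (simp add: ennreal_le_1)
    show "esssup M (\<lambda>x. if snd x = l then ennreal (cmod (h x)) else 0) \<le> esssup M (\<lambda>x. ennreal (cmod (h x)))"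
      by (rule esssup_mono) auto
    have e: "(\<lambda>(x, y). if snd x = l \<and> snd y = l then lipschitz_quotient \<beta> s0 h x y else 0)
       = (\<lambda>z. if snd (fst z) = l \<and> snd (snd z) = l then ?q z else 0)"
      by (auto simp: fun_eq_iff)
    show "esssup (M \<Otimes>\<^sub>M M) (\<lambda>(x, y). if snd x = l \<and> snd y = l then lipschitz_quotient \<beta> s0 h x y else 0)
        \<le> esssup (M \<Otimes>\<^sub>M M) ?q"
      unfolding e
    proof (rule esssup_mono)
      have "(\<lambda>z. snd (fst z)) \<in> measurable (M \<Otimes>\<^sub>M M) (count_space UNIV)"
           "(\<lambda>z. snd (snd z)) \<in> measurable (M \<Otimes>\<^sub>M M) (count_space UNIV)"
        by measurable
      then show "(\<lambda>z. if snd (fst z) = l \<and> snd (snd z) = l then ?q z else 0) \<in> borel_measurable (M \<Otimes>\<^sub>M M)"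
        using q by measurable
    qed auto
  qed auto
  then show ?thesis by (auto simp: B_norm_def B0_norm_def intro!: SUP_least)
qed (auto simp: not_less top_unique)

lemma B_norm_AE_bound:
  assumes "B_norm M \<beta> s0 \<epsilon> h \<le> ennreal b" "0 \<le> b"
  shows "AE x in M. cmod (h x) \<le> exp (real (snd x) * \<epsilon>) * b"
proof -
  have "B_norm M \<beta> s0 \<epsilon> h < \<infinity>" using assms(1) by (rule le_less_trans) simp
  then have hm: "h \<in> borel_measurable M" by (rule B_norm_measurable)
  have "AE x in M. (if snd x = l then ennreal (cmod (h x)) else 0) \<le> ennreal (exp (real l * \<epsilon>) * b)" for l
  proof -
    define e where "e = esssup M (\<lambda>x. if snd x = l then ennreal (cmod (h x)) else 0)"
    have "ennreal (exp (- real l * \<epsilon>)) * e \<le> B_norm M \<beta> s0 \<epsilon> h"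
      unfolding B_norm_def if_P[OF hm] e_def
      by (rule SUP_upper2[of l]) (auto intro!: mult_left_mono)
    then have "ennreal (exp (- real l * \<epsilon>)) * e \<le> ennreal b" using assms(1) by (rule order_trans)
    then have "ennreal (exp (real l * \<epsilon>)) * (ennreal (exp (- real l * \<epsilon>)) * e) \<le> ennreal (exp (real l * \<epsilon>)) * ennreal b"
      by (rule mult_left_mono) simp
    then have "e \<le> ennreal (exp (real l * \<epsilon>) * b)"
      using assms(2) by (simp add: mult.assoc[symmetric] ennreal_mult[symmetric] exp_add[symmetric])
    with esssup_AE[of "\<lambda>x. if snd x = l then ennreal (cmod (h x)) else 0" M]
    show ?thesis unfolding e_def[symmetric] by (auto elim!: eventually_mono intro: order_trans)
  qed
  then have "AE x in M. \<forall>l. (if snd x = l then ennreal (cmod (h x)) else 0) \<le> ennreal (exp (real l * \<epsilon>) * b)"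
    unfolding AE_all_countable by blast
  then show ?thesis
  proof eventually_elim
    case (elim x)
    from elim[rule_format, of "snd x"] show ?case using assms(2) by simp
  qed
qed

text \<open>On floor \<open>l\<close> the function is at most
  \<open>exp (l * \<epsilon>) * b\<close>, and for s \<le> p its s-th power is dominated by a weight
  whose integral is the given sum \<open>W\<close>. The factor \<open>W + 1\<close> \<ge> 1 replaces
  the s-th root of \<open>W\<close>.\<close>

lemma B_norm_Lp_bounded:
  assumes sm: "summable (\<lambda>l. exp (p * real l * \<epsilon>) * measure M {z \<in> space M. snd z = l})"
    and "0 < \<epsilon>" "1 \<le> s" "s \<le> p"
  obtains D where "0 < D" "\<And>h b. B_norm M \<beta> s0 \<epsilon> h \<le> ennreal b \<Longrightarrow> 0 < b \<Longrightarrow> Lp_bounded M s h (D * b)"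
proof -
  define W where "W = (\<Sum>l. exp (p * real l * \<epsilon>) * measure M {z \<in> space M. snd z = l})"
  have W: "0 \<le> W" unfolding W_def by (intro suminf_nonneg sm) auto
  have "(\<integral>\<^sup>+x. ennreal (exp (p * real (snd x) * \<epsilon>)) \<partial>M)
      = (\<integral>\<^sup>+x. (\<Sum>l. ennreal (exp (p * real l * \<epsilon>)) * indicator {z \<in> space M. snd z = l} x) \<partial>M)"
  proof (intro nn_integral_cong)
    fix x assume x: "x \<in> space M"
    have "(\<Sum>l. ennreal (exp (p * real l * \<epsilon>)) * indicator {z \<in> space M. snd z = l} x)
      = (\<Sum>l\<in>{snd x}. ennreal (exp (p * real l * \<epsilon>)) * indicator {z \<in> space M. snd z = l} x)"
      by (intro suminf_finite) (auto simp: indicator_def)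
    then show "ennreal (exp (p * real (snd x) * \<epsilon>)) = (\<Sum>l. ennreal (exp (p * real l * \<epsilon>)) * indicator {z \<in> space M. snd z = l} x)"
      using x by simp
  qed
  also have "\<dots> = (\<Sum>l. ennreal (exp (p * real l * \<epsilon>)) * emeasure M {z \<in> space M. snd z = l})"
    by (subst nn_integral_suminf) (auto simp: nn_integral_cmult_indicator)
  also have "\<dots> = (\<Sum>l. ennreal (exp (p * real l * \<epsilon>) * measure M {z \<in> space M. snd z = l}))"
    by (simp add: emeasure_eq_measure ennreal_mult)
  also have "\<dots> = ennreal W" unfolding W_def using sm by (intro suminf_ennreal2) auto
  finally have WI: "(\<integral>\<^sup>+x. ennreal (exp (p * real (snd x) * \<epsilon>)) \<partial>M) = ennreal W" .
  show ?thesis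
  proof (rule that[of "W + 1"])
    fix h b assume B: "B_norm M \<beta> s0 \<epsilon> h \<le> ennreal b" and b: "0 < b"
    have hm: "h \<in> borel_measurable M"
      by (rule B_norm_measurable[OF le_less_trans[OF B]]) simp
    have "(\<integral>\<^sup>+x. ennreal (cmod (h x) powr s) \<partial>M)
        \<le> (\<integral>\<^sup>+x. ennreal (b powr s) * ennreal (exp (p * real (snd x) * \<epsilon>)) \<partial>M)"
    proof (rule nn_integral_mono_AE)
      show "AE x in M. ennreal (cmod (h x) powr s) \<le> ennreal (b powr s) * ennreal (exp (p * real (snd x) * \<epsilon>))"
        using B_norm_AE_bound[OF B less_imp_le[OF b]]
      proof eventually_elim
        case (elim x)
        have "cmod (h x) powr s \<le> (exp (real (snd x) * \<epsilon>) * b) powr s"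
          using elim assms by (intro powr_mono2) auto
        also have "\<dots> = exp (s * (real (snd x) * \<epsilon>)) * b powr s"
          using b by (simp add: powr_mult exp_powr_real mult.commute)
        also have "\<dots> \<le> exp (p * (real (snd x) * \<epsilon>)) * b powr s"
          using assms by (intro mult_right_mono) (auto intro!: mult_right_mono)
        finally show ?case by (simp add: ennreal_mult[symmetric] mult_ac ennreal_leI)
      qed
    qed
    also have "\<dots> = ennreal (b powr s) * ennreal W"
      by (subst nn_integral_cmult) (auto simp: WI)
    also have "\<dots> = ennreal (W * b powr s)" using W by (simp add: ennreal_mult[symmetric] mult.commute)
    also have "W * b powr s \<le> ((W + 1) * b) powr s"
    proof -
      have "W \<le> (W + 1) powr 1" using W by simp
      also have "\<dots> \<le> (W + 1) powr s" using W assms by (intro powr_mono) auto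
      finally show ?thesis using W b by (simp add: powr_mult mult_right_mono)
    qed
    finally show "Lp_bounded M s h ((W + 1) * b)"
      using hm W b by (auto simp: Lp_bounded_def ennreal_leI)
  qed (use W in auto)
qed

end


section \<open>From the spectral decomposition on B to expansions from B0 to L^s\<close>

lemma SUP_op_norm_le:
  assumes "(SUP t\<in>T. op_norm N N' (A t)) + r \<le> ennreal c" "t \<in> T" "N h \<le> 1"
  shows "N' (A t h) \<le> ennreal c"
proof -
  have "N' (A t h) \<le> op_norm N N' (A t)"
    unfolding op_norm_def using assms(3) by (intro SUP_upper) simp
  also have "\<dots> \<le> (SUP t\<in>T. op_norm N N' (A t))" using assms(2) by (rule SUP_upper)
  also have "\<dots> \<le> (SUP t\<in>T. op_norm N N' (A t)) + r" by (metis le_iff_add)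
  finally show ?thesis using assms(1) by (rule order_trans)
qed

locale tower_transfer = tower_space M + perturbed_transfer M f P \<kappa>
  for M :: "('y \<times> nat) measure" and f P \<kappa> +
  fixes \<beta> :: real and s0 :: "'y \<times> nat \<Rightarrow> 'y \<times> nat \<Rightarrow> enat"
begin

text \<open>The bound on \<open>Nt t ^^ n\<close> lives in B. Since s < 2 < p, the embedding of B
  into L^s transfers it, and B0 has its unit ball inside that of B. Both moments of \<kappa> in
  play, of orders s and \<gamma> s, stay below 2.\<close>

lemma spectral_expansion_of_decomposition:
  assumes decomp: "spectral_decomposition M (B_norm M \<beta> s0 \<epsilon>) (twisted_op P \<kappa>) \<beta>0 \<theta> lam Pr Nt"
    and p: "2 < p" "0 < \<epsilon>" and sm: "summable (\<lambda>l. exp (p * real l * \<epsilon>) * measure M {z \<in> space M. snd z = l})"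
    and s: "1 \<le> s" and \<gamma>: "1 < \<gamma>" "\<gamma> \<le> 2" "\<gamma> * s < 2"
  obtains K C where "spectral_expansion M f P \<kappa> {h. B0_norm M \<beta> s0 h \<le> 1} (square \<beta>0) lam Pr
    (\<lambda>t n. Nt t ^^ n) s \<gamma> K C \<theta>"
proof -
  let ?N = "B_norm M \<beta> s0 \<epsilon>"
  have "1 * s \<le> \<gamma> * s" using s \<gamma> by (intro mult_right_mono) auto
  then have s2: "s < 2" "s \<le> \<gamma> * s" using \<gamma>(3) by auto
  obtain K1 where K1: "1 \<le> K1" "Lp_bounded M s (\<lambda>x. of_real (norm (\<kappa> x))) K1"
    by (rule \<kappa>_Lp_bounded[OF s s2(1)])
  obtain K2 where K2: "1 \<le> K2" "Lp_bounded M (\<gamma> * s) (\<lambda>x. of_real (norm (\<kappa> x))) K2"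
    by (rule \<kappa>_Lp_bounded[OF order_trans[OF s s2(2)] \<gamma>(3)])
  obtain D where D: "0 < D" "\<And>h b. ?N h \<le> ennreal b \<Longrightarrow> 0 < b \<Longrightarrow> Lp_bounded M s h (D * b)"
    by (rule B_norm_Lp_bounded[OF sm p(2) s]) (use p s2 in auto)
  have th: "0 < \<theta>" "\<theta> < 1" "0 < \<beta>0" "lam 0 = 1"
    using decomp by (auto simp: spectral_decomposition_def)
  have dec: "AE x in M. (twisted_op P \<kappa> t ^^ n) h x = lam t ^ n * Pr t h x + (Nt t ^^ n) h x"
    if "t \<in> square \<beta>0" "1 \<le> n" "?N h < \<infinity>" for t n h
    using decomp that by (auto simp: spectral_decomposition_def)
  have Pr0: "AE x in M. Pr 0 h x = (\<integral>y. h y \<partial>M)" if "?N h < \<infinity>" for h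
    using decomp that by (auto simp: spectral_decomposition_def)
  have Prb: "bounded_operator M ?N ?N (Pr t)" if "t \<in> square \<beta>0" for t
    using decomp that by (auto simp: spectral_decomposition_def eigenprojector_def)
  obtain C where C: "\<And>n. (SUP t \<in> square \<beta>0. op_norm ?N ?N (Nt t ^^ n)) +
       (SUP t \<in> square pi - square \<beta>0. op_norm ?N ?N (twisted_op P \<kappa> t ^^ n)) \<le> ennreal (C * \<theta> ^ n)"
    using decomp by (auto simp: spectral_decomposition_def)
  \<comment> \<open>The constant \<open>C\<close> of the decomposition carries no sign condition,
    whereas bounds here must be positive.\<close>
  define C' where "C' = max C 1"
  have C': "ennreal (C * \<theta> ^ n) \<le> ennreal (C' * \<theta> ^ n)" for n
    using th by (intro ennreal_leI mult_right_mono) (auto simp: C'_def)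
  have H: "?N h \<le> 1" "?N h < \<infinity>" "h \<in> borel_measurable M" if "B0_norm M \<beta> s0 h \<le> 1" for h
  proof -
    show "?N h \<le> 1" using B_norm_le_B0_norm[OF p(2)] that by (rule order_trans)
    then show "?N h < \<infinity>" by (rule le_less_trans) simp
    then show "h \<in> borel_measurable M" by (rule B_norm_measurable)
  qed
  show ?thesis
  proof (rule that[of "max K1 K2" "D * C'"], unfold_locales)
    fix h assume "h \<in> {h. B0_norm M \<beta> s0 h \<le> 1}"
    then have h: "B0_norm M \<beta> s0 h \<le> 1" by simp
    show "h \<in> borel_measurable M" by (rule H(3)[OF h])
    show "AE x in M. cmod (h x) \<le> 1" by (rule B0_norm_AE_bound) (use h in auto)
    show "AE x in M. Pr 0 h x = (\<integral>x. h x \<partial>M)" by (rule Pr0[OF H(2)[OF h]])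
    fix t assume t: "t \<in> square \<beta>0"
    have "?N (Pr t h) < \<infinity>" using Prb[OF t] H(2)[OF h] by (auto simp: bounded_operator_def)
    then show "Pr t h \<in> borel_measurable M" by (rule B_norm_measurable)
    fix n :: nat assume n: "1 \<le> n"
    show "AE x in M. (twisted_op P \<kappa> t ^^ n) h x = lam t ^ n * Pr t h x + (Nt t ^^ n) h x"
      by (rule dec[OF t n H(2)[OF h]])
    have "?N ((Nt t ^^ n) h) \<le> ennreal (C' * \<theta> ^ n)"
      using SUP_op_norm_le[OF C t H(1)[OF h]] C' by (rule order_trans)
    then have "Lp_bounded M s ((Nt t ^^ n) h) (D * (C' * \<theta> ^ n))"
      by (rule D(2)) (use th in \<open>auto simp: C'_def\<close>)
    then show "Lp_bounded M s ((Nt t ^^ n) h) (D * C' * \<theta> ^ n)" by (simp add: mult.assoc)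
  next
    have "B0_norm M \<beta> s0 (\<lambda>_. 1) \<le> ennreal 1" by (rule B0_norm_const) simp
    then show "(\<lambda>_. 1) \<in> {h. B0_norm M \<beta> s0 h \<le> 1}" by simp
    show "Lp_bounded M s (\<lambda>x. of_real (norm (\<kappa> x))) (max K1 K2)"
      by (rule Lp_bounded_mono[OF K1(2)]) (use s in auto)
    show "Lp_bounded M (\<gamma> * s) (\<lambda>x. of_real (norm (\<kappa> x))) (max K1 K2)"
      by (rule Lp_bounded_mono[OF K2(2)]) (use s \<gamma> in auto)
  qed (use s \<gamma> th D K1 in \<open>auto simp: square_def C'_def\<close>)
qed

lemma square_contains_ball: "norm t \<le> b \<Longrightarrow> t \<in> square b"
  unfolding square_def using component_le_norm_cart order_trans by blast

lemma derivative_op_bounded: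
  assumes decomp: "spectral_decomposition M (B_norm M \<beta> s0 \<epsilon>) (twisted_op P \<kappa>) \<beta>0 \<theta> lam Pr Nt"
    and p: "2 < p" "0 < \<epsilon>" and sm: "summable (\<lambda>l. exp (p * real l * \<epsilon>) * measure M {z \<in> space M. snd z = l})"
    and s: "1 \<le> s" "s < 2"
  shows "bounded_operator M (B0_norm M \<beta> s0) (Lp_norm M s) (derivative_op i)"
proof -
  let ?N = "B0_norm M \<beta> s0"
  \<comment> \<open>Midpoint of 1 and 2/s: any exponent in this interval, nonempty since s < 2, will
    serve.\<close>
  define \<gamma> where "\<gamma> = (1 + 2 / s) / 2"
  have \<gamma>: "1 < \<gamma>" "\<gamma> \<le> 2" "\<gamma> * s < 2" using s by (auto simp: \<gamma>_def field_simps)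
  obtain K C where "spectral_expansion M f P \<kappa> {h. ?N h \<le> 1} (square \<beta>0) lam Pr (\<lambda>t n. Nt t ^^ n) s \<gamma> K C \<theta>"
    by (rule spectral_expansion_of_decomposition[OF decomp p sm s(1) \<gamma>])
  then interpret spectral_expansion M f P \<kappa> "{h. ?N h \<le> 1}" "square \<beta>0" lam Pr "\<lambda>t n. Nt t ^^ n" s \<gamma> K C \<theta> .
  have \<beta>0: "0 < \<beta>0" using decomp by (auto simp: spectral_decomposition_def)
  obtain B where B: "\<And>h i. ?N h \<le> 1 \<Longrightarrow> Lp_bounded M s (derivative_op i h) B"
    and conv: "\<And>h i. ?N h \<le> 1 \<Longrightarrow> AE x in M. convergent (\<lambda>n. first_order n (axis i 1) h x)"
    by (rule derivative_op_Lp_bounded[OF \<beta>0 square_contains_ball]) auto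
  have general: "h \<in> borel_measurable M" "\<exists>c. AE x in M. cmod (h x) \<le> c"
    "AE x in M. convergent (\<lambda>n. first_order n (axis i 1) h x)" "Lp_norm M s (derivative_op i h) < \<infinity>"
    if h: "?N h < \<infinity>" for h
  proof -
    \<comment> \<open>One is added so that normalising by \<open>b\<close> makes sense even for
      functions of norm 0.\<close>
    define b where "b = enn2real (?N h) + 1"
    have b: "0 < b" by (simp add: b_def add_nonneg_pos)
    have hb: "?N h \<le> ennreal b"
      using h by (cases "?N h") (auto simp: b_def intro!: ennreal_leI)
    show hm: "h \<in> borel_measurable M" by (rule B0_norm_measurable[OF h])
    have hc: "AE x in M. cmod (h x) \<le> b" using hb b by (intro B0_norm_AE_bound) auto
    then show "\<exists>c. AE x in M. cmod (h x) \<le> c" by blast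
    define k where "k x = of_real (inverse b) * h x" for x
    have "?N k \<le> ennreal (cmod (of_real (inverse b))) * ?N h"
      unfolding k_def[abs_def] by (rule B0_norm_scale[OF h])
    also have "\<dots> \<le> ennreal (inverse b) * ennreal b"
      using b hb by (intro mult_mono) (auto simp del: of_real_inverse)
    also have "\<dots> = 1" using b by (simp add: ennreal_mult[symmetric])
    finally have k: "?N k \<le> 1" .
    have km: "k \<in> borel_measurable M" unfolding k_def[abs_def] using hm by measurable
    have kc: "AE x in M. cmod (k x) \<le> 1" by (rule B0_norm_AE_bound) (use k in auto)
    have hk: "h = (\<lambda>x. of_real b * k x + 0 * k x)" using b by (auto simp: k_def)
    note lin = derivative_op_linear[OF km kc conv[OF k] km kc conv[OF k], of i "of_real b" 0, folded hk]
    show "AE x in M. convergent (\<lambda>n. first_order n (axis i 1) h x)" by (rule lin(1))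
    have Bp: "0 < B" using Lp_boundedD(2)[OF B[OF k]] .
    have "Lp_bounded M s (\<lambda>x. of_real b * derivative_op i k x) (b * B)"
      by (rule Lp_bounded_scale[OF B[OF k]]) (use b Bp s in auto)
    then have "Lp_bounded M s (derivative_op i h) (b * B)"
      by (rule Lp_bounded_cong_AE) (use lin(2) derivative_op_measurable[OF hm hc] s in auto)
    from Lp_norm_le[OF this s(1)] show "Lp_norm M s (derivative_op i h) < \<infinity>"
      by (rule le_less_trans) simp
  qed
  have "op_norm ?N (Lp_norm M s) (derivative_op i) \<le> ennreal B"
    unfolding op_norm_def by (intro SUP_least Lp_norm_le[OF B s(1)]) simp
  then have "op_norm ?N (Lp_norm M s) (derivative_op i) < \<infinity>" by (rule le_less_trans) simp
  moreover have "AE x in M. derivative_op i (\<lambda>x. a * g x + b * h x) x = a * derivative_op i g x + b * derivative_op i h x"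
    if g: "?N g < \<infinity>" and h: "?N h < \<infinity>" for g h a b
  proof -
    obtain c d where "AE x in M. cmod (g x) \<le> c" "AE x in M. cmod (h x) \<le> d"
      using general(2)[OF g] general(2)[OF h] by blast
    then show ?thesis
      using derivative_op_linear(2)[OF general(1)[OF g] _ general(3)[OF g] general(1)[OF h] _ general(3)[OF h]] by blast
  qed
  ultimately show ?thesis using general(4) unfolding bounded_operator_def by blast
qed

lemma projector_expansion_op_norm:
  assumes decomp: "spectral_decomposition M (B_norm M \<beta> s0 \<epsilon>) (twisted_op P \<kappa>) \<beta>0 \<theta> lam Pr Nt"
    and p: "2 < p" "0 < \<epsilon>" and sm: "summable (\<lambda>l. exp (p * real l * \<epsilon>) * measure M {z \<in> space M. snd z = l})"
    and s: "1 \<le> s" and \<gamma>: "1 < \<gamma>" "\<gamma> < 2 / s"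
  shows "\<exists>C>0. \<forall>\<^sub>F t in at 0. op_norm (B0_norm M \<beta> s0) (Lp_norm M s)
    (\<lambda>h x. Pr t h x - Pr 0 h x - (\<Sum>i\<in>UNIV. of_real (t $ i) * derivative_op i h x)) \<le> ennreal (C * norm t powr \<gamma>)"
proof -
  let ?N = "B0_norm M \<beta> s0"
  \<comment> \<open>Midpoint of \<gamma> and 2/s: above \<gamma>, to pay for the logarithm, and
    still with \<gamma>1 s < 2.\<close>
  define \<gamma>1 where "\<gamma>1 = (\<gamma> + 2 / s) / 2"
  have "2 / s \<le> 2" using s by (simp add: divide_le_eq)
  moreover have "\<gamma> * s < 2" using s \<gamma> by (simp add: less_divide_eq)
  then have "\<gamma>1 * s < 2" using s by (simp add: \<gamma>1_def distrib_right)
  moreover have "2 * \<gamma>1 = \<gamma> + 2 / s" by (simp add: \<gamma>1_def)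
  ultimately have \<gamma>1: "1 < \<gamma>1" "\<gamma>1 \<le> 2" "\<gamma>1 * s < 2" "\<gamma> < \<gamma>1"
    using \<gamma> by linarith+
  obtain K C where "spectral_expansion M f P \<kappa> {h. ?N h \<le> 1} (square \<beta>0) lam Pr (\<lambda>t n. Nt t ^^ n) s \<gamma>1 K C \<theta>"
    by (rule spectral_expansion_of_decomposition[OF decomp p sm s(1) \<gamma>1(1-3)])
  then interpret spectral_expansion M f P \<kappa> "{h. ?N h \<le> 1}" "square \<beta>0" lam Pr "\<lambda>t n. Nt t ^^ n" s \<gamma>1 K C \<theta> .
  have \<beta>0: "0 < \<beta>0" using decomp by (auto simp: spectral_decomposition_def)
  obtain B where B: "0 < B" and ev: "\<forall>\<^sub>F t in at 0. \<forall>h\<in>{h. ?N h \<le> 1}. Lp_bounded M s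
    (\<lambda>x. Pr t h x - (\<integral>x. h x \<partial>M) - (\<Sum>i\<in>UNIV. of_real (t $ i) * derivative_op i h x)) (B * norm t powr \<gamma>)"
    using projector_derivative[OF \<beta>0 square_contains_ball \<gamma>(1) \<gamma>1(4)] by auto
  have "\<forall>\<^sub>F t in at (0::plane). norm t < \<beta>0"
    using \<beta>0 by (intro order_tendstoD) (auto intro!: tendsto_eq_intros)
  with ev have "\<forall>\<^sub>F t in at 0. op_norm ?N (Lp_norm M s)
    (\<lambda>h x. Pr t h x - Pr 0 h x - (\<Sum>i\<in>UNIV. of_real (t $ i) * derivative_op i h x)) \<le> ennreal (B * norm t powr \<gamma>)"
  proof eventually_elim
    case (elim t)
    have t: "t \<in> square \<beta>0" using elim(2) by (intro square_contains_ball) auto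
    show ?case unfolding op_norm_def
    proof (intro SUP_least Lp_norm_le[OF _ s])
      fix h assume h: "h \<in> {h. ?N h \<le> 1}"
      note m = Pr_measurable[OF t h] Pr_measurable[OF at_0(1) h] derivative_op_measurable[OF H[OF h]]
      show "Lp_bounded M s (\<lambda>x. Pr t h x - Pr 0 h x - (\<Sum>i\<in>UNIV. of_real (t $ i) * derivative_op i h x)) (B * norm t powr \<gamma>)"
        by (rule Lp_bounded_cong_AE[OF elim(1)[rule_format, OF h]]) (use m at_0(3)[OF h] s in auto)
    qed
  qed
  then show ?thesis using B by blast
qed

end

section \<open>Measurability of the displacement\<close>

locale collapsed_tower =
  fixes \<mu>Y :: "'y measure" and \<Y> :: "'y set set" and \<sigma> :: "'y \<Rightarrow> nat" and F :: "'y \<Rightarrow> 'y"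
    and \<mu>\<Delta> :: "('y \<times> nat) measure" and \<D> :: "('y \<times> nat) set set" and \<beta> :: real
    and f s0
  assumes one_dim: "one_dim_tower \<mu>Y \<Y> \<sigma> F \<mu>\<Delta>"
    and partition: "young_partition (space \<mu>Y) \<Y> \<sigma> F \<D>"
    and f_eq: "f = tower_map \<sigma> F" and s0_eq: "s0 = separation_time \<D> f"
    and \<beta>: "0 < \<beta>" "\<beta> < 1"
begin

lemma prob_tower: "prob_space \<mu>\<Delta>"
  using one_dim by (simp add: one_dim_tower_def)

lemma sets_tower: "sets \<mu>\<Delta> = sets (restrict_space (\<mu>Y \<Otimes>\<^sub>M count_space UNIV) (tower (space \<mu>Y) \<sigma>))"
  using one_dim by (simp add: one_dim_tower_def)

lemma space_tower: "space \<mu>\<Delta> = tower (space \<mu>Y) \<sigma>"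
  using sets_eq_imp_space_eq[OF sets_tower] by (auto simp: space_restrict_space space_pair_measure tower_def)

lemma f_preserving: "f \<in> measurable \<mu>\<Delta> \<mu>\<Delta>" "distr \<mu>\<Delta> \<mu>\<Delta> f = \<mu>\<Delta>"
  using one_dim by (auto simp: one_dim_tower_def measure_preserving_map_def f_eq)

lemma snd_measurable: "snd \<in> measurable \<mu>\<Delta> (count_space UNIV)"
proof -
  have "snd \<in> measurable (restrict_space (\<mu>Y \<Otimes>\<^sub>M count_space UNIV) (tower (space \<mu>Y) \<sigma>)) (count_space UNIV)"
    by (rule measurable_restrict_space1) measurable
  then show ?thesis using measurable_cong_sets[OF sets_tower refl] by blast
qed

lemma atoms: "countable \<Y>" "partition_on (space \<mu>Y) \<Y>" "\<And>a. a \<in> \<Y> \<Longrightarrow> a \<in> sets \<mu>Y" "\<And>a. a \<in> \<Y> \<Longrightarrow> inj_on F a"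
  using one_dim by (auto simp: one_dim_tower_def full_branch_gibbs_markov_def bij_betw_def)

lemma height_const: "a \<in> \<Y> \<Longrightarrow> y \<in> a \<Longrightarrow> y' \<in> a \<Longrightarrow> \<sigma> y = \<sigma> y'"
  using one_dim by (force simp: one_dim_tower_def)

lemma atom_measurable:
  assumes "a \<in> \<Y>" "y \<in> a" "l < \<sigma> y"
  shows "a \<times> {l} \<in> sets \<mu>\<Delta>" "a \<times> {l} \<subseteq> space \<mu>\<Delta>"
proof -
  have "a \<subseteq> space \<mu>Y" using atoms(3)[OF assms(1)] sets.sets_into_space by blast
  then show sub: "a \<times> {l} \<subseteq> space \<mu>\<Delta>"
    using height_const[OF assms(1,2)] assms(3) by (auto simp: space_tower tower_def)
  have "a \<times> {l} = (a \<times> {l}) \<inter> tower (space \<mu>Y) \<sigma>" using sub by (auto simp: space_tower)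
  moreover have "a \<times> {l} \<in> sets (\<mu>Y \<Otimes>\<^sub>M count_space UNIV)"
    using atoms(3)[OF assms(1)] by (intro pair_measureI) auto
  ultimately show "a \<times> {l} \<in> sets \<mu>\<Delta>"
    unfolding sets_tower sets_restrict_space by (auto intro!: image_eqI[of _ _ "a \<times> {l}"])
qed

lemma atom_cover:
  assumes "y \<in> space \<mu>Y"
  obtains a where "a \<in> \<Y>" "y \<in> a"
  using assms atoms(2) by (auto simp: partition_on_def)

lemmas partition_conjuncts = partition[unfolded young_partition_def]
lemmas partition_tower = partition_conjuncts[THEN conjunct1]
  and partition_floor = partition_conjuncts[THEN conjunct2, THEN conjunct1, rule_format]
  and partition_atom = partition_conjuncts[THEN conjunct2, THEN conjunct2, THEN conjunct1, rule_format]
  and partition_returns =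
    partition_conjuncts[THEN conjunct2, THEN conjunct2, THEN conjunct2, THEN conjunct2, rule_format]

lemma partition_unique: "D \<in> \<D> \<Longrightarrow> D' \<in> \<D> \<Longrightarrow> x \<in> D \<Longrightarrow> x \<in> D' \<Longrightarrow> D = D'"
  using partition_tower by (auto simp: partition_on_def disjoint_def)

text \<open>An element lies in a single floor and contains every copy of an atom that it meets
  there, so it is a countable union of measurable copies.\<close>

lemma partition_measurable:
  assumes D: "D \<in> \<D>"
  shows "D \<in> sets \<mu>\<Delta>"
proof -
  obtain l where l: "D \<subseteq> space \<mu>Y \<times> {l}" using partition_floor[OF D] by auto
  have sub: "D \<subseteq> tower (space \<mu>Y) \<sigma>" using D partition_tower by (auto simp: partition_on_def)
  define A where "A = {a \<in> \<Y>. a \<times> {l} \<subseteq> D}"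
  have "D = (\<Union>a\<in>A. a \<times> {l})"
  proof
    show "D \<subseteq> (\<Union>a\<in>A. a \<times> {l})"
    proof
      fix z assume z: "z \<in> D"
      obtain y where y: "z = (y, l)" "y \<in> space \<mu>Y" "l < \<sigma> y"
        using z l sub by (auto simp: tower_def)
      obtain a where a: "a \<in> \<Y>" "y \<in> a" using atom_cover[OF y(2)] .
      then obtain D' where "D' \<in> \<D>" "a \<times> {l} \<subseteq> D'" using partition_atom y(3) by blast
      moreover from this have "D' = D" using partition_unique[OF _ D _ z, of D'] a y by auto
      ultimately show "z \<in> (\<Union>a\<in>A. a \<times> {l})" using a y by (auto simp: A_def)
    qed
  qed (auto simp: A_def)
  also have "\<dots> \<in> sets \<mu>\<Delta>"
  proof (rule sets.countable_UN')
    show "countable A" using atoms(1) by (auto simp: A_def intro: countable_subset)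
    show "(\<lambda>a. a \<times> {l}) ` A \<subseteq> sets \<mu>\<Delta>"
    proof safe
      fix a assume a: "a \<in> A"
      then have "a \<in> \<Y>" "a \<times> {l} \<subseteq> D" by (auto simp: A_def)
      moreover have "a \<noteq> {}" using \<open>a \<in> \<Y>\<close> atoms(2) by (auto simp: partition_on_def)
      then obtain y where "y \<in> a" by auto
      ultimately show "a \<times> {l} \<in> sets \<mu>\<Delta>" using sub by (intro atom_measurable) (auto simp: tower_def)
    qed
  qed
  finally show ?thesis .
qed

lemma separation_ge_1: "1 \<le> s0 x y \<longleftrightarrow> (\<exists>D\<in>\<D>. x \<in> D \<and> y \<in> D)"
proof -
  define A where "A n \<longleftrightarrow> (\<exists>D\<in>\<D>. (f ^^ n) x \<in> D \<and> (f ^^ n) y \<in> D)" for n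
  have pos: "1 \<le> enat n \<longleftrightarrow> n \<noteq> 0" for n by (cases n) (auto simp: one_enat_def)
  have "s0 x y = (INF n\<in>{n. \<not> A n}. enat n)"
    unfolding s0_eq separation_time_def A_def ..
  then have "1 \<le> s0 x y \<longleftrightarrow> A 0" by (auto simp: le_INF_iff pos intro: gr0I)
  then show ?thesis by (simp add: A_def)
qed

lemma separation_le_1: "\<not> (\<exists>D\<in>\<D>. f x \<in> D \<and> f y \<in> D) \<Longrightarrow> s0 x y \<le> 1"
  unfolding s0_eq separation_time_def by (rule INF_lower2[of 1]) (auto simp: one_enat_def)

\<comment> \<open>Points of the same element of \<open>\<D>\<close> exactly one of which lies in a returning atom are separated at time 1.\<close>
lemma returning_atom_B_norm:
  assumes a: "a \<in> \<Y>" "y0 \<in> a" and l: "Suc l = \<sigma> y0" and \<epsilon>: "0 < \<epsilon>"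
  shows "B_norm \<mu>\<Delta> \<beta> s0 \<epsilon> (indicator (a \<times> {l})) < \<infinity>"
proof -
  define E where "E = a \<times> {l}"
  have E: "E \<in> sets \<mu>\<Delta>" "E \<subseteq> space \<mu>\<Delta>" using atom_measurable[OF a, of l] l by (auto simp: E_def)
  obtain D where D: "D \<in> \<D>" "E \<subseteq> D" using partition_atom[OF a, of l] l by (auto simp: E_def)
  have Dm: "D \<in> sets \<mu>\<Delta>" by (rule partition_measurable[OF D(1)])
  obtain l' where "D \<subseteq> space \<mu>Y \<times> {l'}" using partition_floor[OF D(1)] by auto
  moreover from this have "l' = l" using D a by (auto simp: E_def)
  ultimately have Dl: "D \<subseteq> space \<mu>Y \<times> {l}" by simp
  have Dt: "D \<subseteq> tower (space \<mu>Y) \<sigma>" using D partition_tower by (auto simp: partition_on_def)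
  \<comment> \<open>On \<open>Q\<close> the quotient equals 1/\<beta>. Elsewhere it vanishes: points
    in different elements of \<open>\<D>\<close> have separation time 0, and other pairs have equal
    indicators. Thus the quotient is visibly measurable.\<close>
  define Q where "Q = E \<times> (D - E) \<union> (D - E) \<times> E"
  have Qm: "Q \<in> sets (\<mu>\<Delta> \<Otimes>\<^sub>M \<mu>\<Delta>)" unfolding Q_def using E Dm by auto
  \<comment> \<open>\<open>x\<close> returns to the base, whereas \<open>y\<close> climbs, since
    \<open>D\<close> contains no returning atom other than \<open>a\<close>. Their images lie on
    different floors, hence in no common element.\<close>
  have sep: "s0 x y = 1 \<and> s0 y x = 1" if x: "x \<in> E" and y: "y \<in> D - E" for x y
  proof -
    obtain a' where a': "a' \<in> \<Y>" "{z \<in> D. Suc (snd z) = \<sigma> (fst z)} \<subseteq> a' \<times> UNIV"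
      using partition_returns[OF D(1)] by auto
    have "(y0, l) \<in> {z \<in> D. Suc (snd z) = \<sigma> (fst z)}" using D a l by (auto simp: E_def)
    with a' have "y0 \<in> a'" by auto
    then have aa: "a' = a" using a a'(1) atoms(2) by (auto simp: partition_on_def disjoint_def)
    have ry: "Suc (snd y) \<noteq> \<sigma> (fst y)"
    proof
      assume "Suc (snd y) = \<sigma> (fst y)"
      then have "y \<in> a \<times> UNIV" using a'(2) y aa by auto
      moreover have "snd y = l" using y Dl by auto
      ultimately show False using y by (cases y) (auto simp: E_def)
    qed
    have "fst x \<in> a" "snd x = l" using x by (auto simp: E_def)
    then have fx: "snd (f x) = 0"
      using height_const[OF a(1) a(2)] l by (cases x) (auto simp: f_eq tower_map_def)
    have "snd y < \<sigma> (fst y)" using y Dt by (auto simp: tower_def)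
    then have fy: "snd (f y) \<noteq> 0" using ry by (cases y) (auto simp: f_eq tower_map_def)
    have "\<not> (f x \<in> D' \<and> f y \<in> D')" if D': "D' \<in> \<D>" for D'
    proof -
      obtain m where "D' \<subseteq> space \<mu>Y \<times> {m}" using partition_floor[OF D'] by auto
      then have "snd w = m" if "w \<in> D'" for w using that by auto
      then show ?thesis using fx fy by metis
    qed
    then have "\<not> (\<exists>D\<in>\<D>. f x \<in> D \<and> f y \<in> D)" "\<not> (\<exists>D\<in>\<D>. f y \<in> D \<and> f x \<in> D)" by blast+
    moreover have "1 \<le> s0 x y" "1 \<le> s0 y x"
      using x y D unfolding separation_ge_1 by auto
    ultimately show ?thesis using separation_le_1[of x y] separation_le_1[of y x] by (simp add: antisym)
  qed
  have q: "lipschitz_quotient \<beta> s0 (indicator E) x y = ennreal (1 / \<beta>) * indicator Q (x, y)" for x y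
  proof (cases "(x, y) \<in> Q")
    case True
    then have "s0 x y = 1" using sep unfolding Q_def by blast
    moreover have "cmod (indicator E x - indicator E y) = 1" using True by (auto simp: Q_def)
    ultimately show ?thesis
      using True \<beta> divide_ennreal[of 1 \<beta>]
      by (simp add: lipschitz_quotient_def epower_def one_enat_def)
  next
    case False
    have "indicator E x = (indicator E y :: complex)" if ge: "1 \<le> s0 x y"
    proof -
      obtain D' where D': "D' \<in> \<D>" "x \<in> D'" "y \<in> D'" using ge unfolding separation_ge_1 by blast
      have "D' = D" if "x \<in> E \<or> y \<in> E" using that D' D(2) partition_unique[OF D'(1) D(1)] by blast
      then have "x \<in> E \<longleftrightarrow> y \<in> E" using False D' unfolding Q_def by blast
      then show ?thesis by (simp add: indicator_def)
    qed
    then show ?thesis using False by (auto simp: lipschitz_quotient_def)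
  qed
  have im: "(indicator E :: _ \<Rightarrow> complex) \<in> borel_measurable \<mu>\<Delta>" using E by auto
  have "B_norm \<mu>\<Delta> \<beta> s0 \<epsilon> (indicator E) \<le> 1 * (ennreal 1 + ennreal (1 / \<beta>))"
    unfolding B_norm_def if_P[OF im]
  proof (intro SUP_least mult_mono add_mono)
    fix k :: nat
    show "ennreal (exp (- real k * \<epsilon>)) \<le> 1" using \<epsilon> by (simp add: ennreal_le_1)
    note [measurable] = snd_measurable E(1)
    show "esssup \<mu>\<Delta> (\<lambda>x. if snd x = k then ennreal (cmod (indicator E x)) else 0) \<le> ennreal 1"
      by (intro esssup_I AE_I2) (auto simp: indicator_def)
    have e: "(\<lambda>(x, y). if snd x = k \<and> snd y = k then lipschitz_quotient \<beta> s0 (indicator E) x y else 0)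
       = (\<lambda>z. if snd (fst z) = k \<and> snd (snd z) = k then ennreal (1 / \<beta>) * indicator Q z else 0)"
      by (auto simp: fun_eq_iff q)
    show "esssup (\<mu>\<Delta> \<Otimes>\<^sub>M \<mu>\<Delta>) (\<lambda>(x, y). if snd x = k \<and> snd y = k then lipschitz_quotient \<beta> s0 (indicator E) x y else 0)
        \<le> ennreal (1 / \<beta>)"
      unfolding e
    proof (rule esssup_I)
      have "(\<lambda>z. snd (fst z)) \<in> measurable (\<mu>\<Delta> \<Otimes>\<^sub>M \<mu>\<Delta>) (count_space UNIV)"
           "(\<lambda>z. snd (snd z)) \<in> measurable (\<mu>\<Delta> \<Otimes>\<^sub>M \<mu>\<Delta>) (count_space UNIV)"
        by measurable
      then show "(\<lambda>z. if snd (fst z) = k \<and> snd (snd z) = k then ennreal (1 / \<beta>) * indicator Q z else 0)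
          \<in> borel_measurable (\<mu>\<Delta> \<Otimes>\<^sub>M \<mu>\<Delta>)"
        using Qm by measurable
    qed (auto simp: indicator_def)
  qed auto
  then show ?thesis unfolding E_def by (rule le_less_trans) simp
qed

lemma transfer_op_single_branch:
  assumes z: "z \<in> space \<mu>\<Delta>" and h: "\<And>w. w \<in> space \<mu>\<Delta> \<Longrightarrow> f w = f z \<Longrightarrow> w \<noteq> z \<Longrightarrow> h w = 0"
  shows "transfer_op (space \<mu>\<Delta>) f \<alpha> h (f z) = of_real (exp (- \<alpha> z)) * h z"
proof -
  have "transfer_op (space \<mu>\<Delta>) f \<alpha> h (f z) = (\<Sum>\<^sub>\<infinity>y\<in>{z}. of_real (exp (- \<alpha> y)) * h y)"
    unfolding transfer_op_def by (rule infsum_cong_neutral) (use z h in auto)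
  then show ?thesis by simp
qed

\<comment> \<open>Measurability of \<open>\<kappa>\<close> is not inherited through the collapse, whose direct images need not be measurable.
  It is read off the operators: on each atom \<open>e\<^sup>i\<^sup>t\<^sup>\<kappa>\<close> is a twisted image of a single branch, composed
  with \<open>f\<close>, and \<open>\<kappa>\<close> is a derivative at \<open>t = 0\<close>.\<close>
lemma displacement_measurable:
  assumes \<alpha>: "\<alpha> \<in> borel_measurable \<mu>\<Delta>" and \<epsilon>: "0 < \<epsilon>"
    and bounded: "\<And>t. t \<in> square pi \<Longrightarrow> bounded_operator \<mu>\<Delta> (B_norm \<mu>\<Delta> \<beta> s0 \<epsilon>) (B_norm \<mu>\<Delta> \<beta> s0 \<epsilon>)
      (twisted_op (transfer_op (space \<mu>\<Delta>) f \<alpha>) \<kappa> t)"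
  shows "\<kappa> \<in> borel_measurable \<mu>\<Delta>"
proof -
  interpret tower_space \<mu>\<Delta>
    using prob_tower snd_measurable by (simp add: tower_space_def tower_space_axioms_def)
  note [measurable] = \<alpha> f_preserving(1)
  define \<C> where "\<C> = {a \<times> {l} |a l. a \<in> \<Y> \<and> (\<exists>y\<in>a. l < \<sigma> y)}"
  have "\<C> \<subseteq> (\<lambda>(a, l). a \<times> {l}) ` (\<Y> \<times> UNIV)" by (auto simp: \<C>_def)
  then have "countable \<C>" by (rule countable_subset) (use atoms(1) in auto)
  show ?thesis
  proof (rule measurable_piecewise_restrict[OF \<open>countable \<C>\<close>])
    show "space \<mu>\<Delta> \<subseteq> \<Union>\<C>"
          proof
      fix z assume "z \<in> space \<mu>\<Delta>"
      then have z: "fst z \<in> space \<mu>Y" "snd z < \<sigma> (fst z)" by (auto simp: space_tower tower_def)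
      obtain a where "a \<in> \<Y>" "fst z \<in> a" using atom_cover[OF z(1)] .
      then show "z \<in> \<Union>\<C>" using z(2) by (cases z) (auto simp: \<C>_def)
    qed
  next
    fix E assume "E \<in> \<C>"
    then obtain a l y0 where a: "a \<in> \<Y>" "y0 \<in> a" "l < \<sigma> y0" and E: "E = a \<times> {l}" by (auto simp: \<C>_def)
    show Em: "E \<inter> space \<mu>\<Delta> \<in> sets \<mu>\<Delta>" using atom_measurable[OF a] by (auto simp: E)
    have Es: "E \<subseteq> space \<mu>\<Delta>" using atom_measurable[OF a] by (auto simp: E)
    \<comment> \<open>An atom that climbs has images with a single preimage in the whole tower, so h
      = 1 will do. A returning atom shares its images with all other returning atoms, so
      \<open>h\<close> has to be its indicator.\<close>
    have "\<exists>h. B_norm \<mu>\<Delta> \<beta> s0 \<epsilon> h < \<infinity> \<and> (\<forall>z\<in>E. h z = 1) \<and>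
        (\<forall>z\<in>E. \<forall>w\<in>space \<mu>\<Delta>. f w = f z \<longrightarrow> w \<noteq> z \<longrightarrow> h w = 0)"
    proof (cases "Suc l = \<sigma> y0")
      case True
      have "w = z" if "z \<in> E" "w \<in> E" "f w = f z" for w z
        using that height_const[OF a(1,2)] True inj_onD[OF atoms(4)[OF a(1)]]
        by (auto simp: E f_eq tower_map_def split: if_splits)
      then show ?thesis
        using returning_atom_B_norm[OF a(1,2) True \<epsilon>] unfolding E[symmetric]
        by (intro exI[of _ "indicator E"]) (auto simp: indicator_def)
    next
      case False
      have "B_norm \<mu>\<Delta> \<beta> s0 \<epsilon> (\<lambda>_. 1) \<le> ennreal 1"
        by (rule order_trans[OF B_norm_le_B0_norm[OF \<epsilon>] B0_norm_const]) simp
      then have "B_norm \<mu>\<Delta> \<beta> s0 \<epsilon> (\<lambda>_. 1) < \<infinity>" by (rule le_less_trans) simp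
      moreover have "w = z" if "z \<in> E" "w \<in> space \<mu>\<Delta>" "f w = f z" for w z
      proof -
        have "Suc l < \<sigma> (fst z)" "snd z = l" using that(1) height_const[OF a(1,2)] False a(3) by (auto simp: E)
        then show ?thesis using that(3) by (cases w, cases z) (auto simp: f_eq tower_map_def split: if_splits)
      qed
      ultimately show ?thesis by (intro exI[of _ "\<lambda>_. 1"]) auto
    qed
    then obtain h where h: "B_norm \<mu>\<Delta> \<beta> s0 \<epsilon> h < \<infinity>" "\<And>z. z \<in> E \<Longrightarrow> h z = 1"
      "\<And>z w. z \<in> E \<Longrightarrow> w \<in> space \<mu>\<Delta> \<Longrightarrow> f w = f z \<Longrightarrow> w \<noteq> z \<Longrightarrow> h w = 0" by blast
    define g where "g t z = of_real (exp (\<alpha> z)) * twisted_op (transfer_op (space \<mu>\<Delta>) f \<alpha>) \<kappa> t h (f z)" for t z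
    have gm: "g t \<in> borel_measurable \<mu>\<Delta>" if "t \<in> square pi" for t
    proof -
      have "B_norm \<mu>\<Delta> \<beta> s0 \<epsilon> (twisted_op (transfer_op (space \<mu>\<Delta>) f \<alpha>) \<kappa> t h) < \<infinity>"
        using bounded[OF that] h(1) by (auto simp: bounded_operator_def)
      then have [measurable]: "twisted_op (transfer_op (space \<mu>\<Delta>) f \<alpha>) \<kappa> t h \<in> borel_measurable \<mu>\<Delta>"
        by (rule B_norm_measurable)
      show ?thesis unfolding g_def by measurable
    qed
    have g: "g t z = cis (t \<bullet> \<kappa> z)" if "z \<in> E" for t z
    proof -
      have "twisted_op (transfer_op (space \<mu>\<Delta>) f \<alpha>) \<kappa> t h (f z) = of_real (exp (- \<alpha> z)) * (cis (t \<bullet> \<kappa> z) * h z)"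
        unfolding twisted_op_def using that Es h(3) by (intro transfer_op_single_branch) auto
      then show ?thesis using h(2)[OF that]
        by (simp add: g_def exp_minus field_simps)
    qed
    \<comment> \<open>Frequencies 1/(n + 1) along a coordinate axis: (n + 1) sin (x / (n + 1)) tends
      to x, which recovers the component of \<kappa> as a limit of measurable functions.\<close>
    define t :: "2 \<Rightarrow> nat \<Rightarrow> plane" where "t i n = (1 / real (Suc n)) *\<^sub>R axis i 1" for i n
    have t: "t i n \<in> square pi" for i n
    proof -
      have "norm (t i n) \<le> 1" by (simp add: t_def)
      then have "\<bar>t i n $ j\<bar> \<le> pi" for j using component_le_norm_cart[of "t i n" j] pi_ge_two by linarith
      then show ?thesis by (simp add: square_def)
    qed
    have lim: "(\<lambda>n. real (Suc n) * Im (g (t i n) z)) \<longlonglongrightarrow> \<kappa> z $ i" if "z \<in> E" for i z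
    proof -
      have "(\<lambda>n. real (Suc n) * sin (x / real (Suc n))) \<longlonglongrightarrow> x" for x by real_asymp
      moreover have "t i n \<bullet> \<kappa> z = \<kappa> z $ i / real (Suc n)" for n
        by (simp add: t_def inner_axis' )
      ultimately show ?thesis by (simp add: g[OF that])
    qed
    have "(\<lambda>z. \<kappa> z $ i) \<in> borel_measurable (restrict_space \<mu>\<Delta> E)" for i
    proof (rule borel_measurable_LIMSEQ_real)
      show "\<And>z. z \<in> space (restrict_space \<mu>\<Delta> E) \<Longrightarrow> (\<lambda>n. real (Suc n) * Im (g (t i n) z)) \<longlonglongrightarrow> \<kappa> z $ i"
        using lim by (simp add: space_restrict_space)
      show "(\<lambda>z. real (Suc n) * Im (g (t i n) z)) \<in> borel_measurable (restrict_space \<mu>\<Delta> E)" for n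
        using gm[OF t[of i n]] by (intro measurable_restrict_space1) measurable
    qed
    then show "\<kappa> \<in> borel_measurable (restrict_space \<mu>\<Delta> E)"
      by (subst borel_measurable_euclidean_space) (auto simp: Basis_vec_def cart_eq_inner_axis)
  qed
qed

end

section \<open>Free segments in a periodic array of discs\<close>

text \<open>The determinant of (v, w). For a unit vector \<open>v\<close> it is the signed component
  of \<open>w\<close> across the direction \<open>v\<close>.\<close>

definition cross2 :: "plane \<Rightarrow> plane \<Rightarrow> real" where
  "cross2 v w = v $ 1 * w $ 2 - v $ 2 * w $ 1"

definition perp :: "plane \<Rightarrow> plane" where
  "perp v = vector [- (v $ 2), v $ 1]"

lemma inner_plane: "v \<bullet> w = v $ 1 * w $ 1 + v $ 2 * w $ 2" for v w :: plane
  by (simp add: inner_vec_def sum_2)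

lemma norm_plane_sq: "(norm v)\<^sup>2 = (v $ 1)\<^sup>2 + (v $ 2)\<^sup>2" for v :: plane
  by (simp only: power2_norm_eq_inner inner_plane) (simp add: power2_eq_square)

lemma perp_simps [simp]: "perp v $ 1 = - (v $ 2)" "perp v $ 2 = v $ 1" "norm (perp v) = norm v"
  by (simp_all add: perp_def norm_eq_sqrt_inner inner_plane)

lemma cross2_eq_inner: "cross2 v w = perp v \<bullet> w"
  by (simp add: cross2_def inner_plane)

lemma cross2_linear:
  "cross2 v (a *\<^sub>R x + b *\<^sub>R y) = a * cross2 v x + b * cross2 v y"
  "cross2 (a *\<^sub>R x + b *\<^sub>R y) v = a * cross2 x v + b * cross2 y v"
  "cross2 v (x + y) = cross2 v x + cross2 v y" "cross2 v (x - y) = cross2 v x - cross2 v y"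
  "cross2 v (- x) = - cross2 v x" "cross2 v (a *\<^sub>R x) = a * cross2 v x" "cross2 v v = 0"
  by (simp_all add: cross2_def algebra_simps)

lemma abs_cross2_le: "\<bar>cross2 v w\<bar> \<le> norm v * norm w"
  unfolding cross2_eq_inner using Cauchy_Schwarz_ineq2[of "perp v" w] by simp

lemma frame_expansion:
  assumes "norm v = 1"
  shows "z = (v \<bullet> z) *\<^sub>R v + cross2 v z *\<^sub>R perp v"
proof -
  have v: "v $ 1 * v $ 1 + v $ 2 * v $ 2 = 1"
    using assms norm_plane_sq[of v] by (simp add: power2_eq_square)
  have "((v \<bullet> z) *\<^sub>R v + cross2 v z *\<^sub>R perp v) $ i = (v $ 1 * v $ 1 + v $ 2 * v $ 2) * z $ i" for i
    using exhaust_2[of i] by (auto simp: inner_plane cross2_def algebra_simps)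
  then show ?thesis by (simp add: vec_eq_iff v)
qed

lemma lattice_vector: "vector [of_int a, of_int b] \<in> lattice"
  by (auto simp: lattice_def forall_2)

lemma lattice_add: "u \<in> lattice \<Longrightarrow> w \<in> lattice \<Longrightarrow> u + w \<in> lattice"
  by (simp add: lattice_def)

lemma lattice_scale: "w \<in> lattice \<Longrightarrow> of_int k *\<^sub>R w \<in> lattice"
  by (simp add: lattice_def)

lemma lattice_near:
  obtains u where "u \<in> lattice" "norm (u - y) \<le> 1"
proof (rule that[of "vector [of_int (round (y $ 1)), of_int (round (y $ 2))]"])
  have "norm (vector [of_int (round (y $ 1)), of_int (round (y $ 2))] - y)
      \<le> \<bar>of_int (round (y $ 1)) - y $ 1\<bar> + \<bar>of_int (round (y $ 2)) - y $ 2\<bar>"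
    by (rule order_trans[OF norm_le_l1_cart]) (simp add: sum_2)
  then show "norm (vector [of_int (round (y $ 1)), of_int (round (y $ 2))] - y) \<le> 1"
    using of_int_round_abs_le[of "y $ 1"] of_int_round_abs_le[of "y $ 2"] by linarith
qed (rule lattice_vector)

lemma norm_lattice_ge_1:
  assumes "w \<in> lattice" "w \<noteq> 0"
  shows "1 \<le> norm w"
proof -
  obtain i where i: "w $ i \<noteq> 0" using assms(2) by (auto simp: vec_eq_iff)
  obtain k where k: "w $ i = of_int k" using assms(1) by (auto simp: lattice_def Ints_def)
  then have "1 \<le> \<bar>w $ i\<bar>" using i by auto
  then show ?thesis using component_le_norm_cart[of w i] by linarith
qed

text \<open>Dirichlet approximation of the slope of \<open>v\<close>, taken with respect to its
  larger coordinate so that the slope is at most 1 and the numerator at most N + 1. Replacing the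
  vector by its opposite fixes the sign of the inner product.\<close>

lemma lattice_direction:
  assumes N: "0 < N" and v: "norm v = 1"
  obtains a b :: int where "(a, b) \<noteq> (0, 0)" "\<bar>a\<bar> \<le> int N + 1" "\<bar>b\<bar> \<le> int N + 1"
    "\<bar>cross2 v (vector [of_int a, of_int b])\<bar> \<le> 1 / real N" "0 \<le> v \<bullet> vector [of_int a, of_int b]"
proof -
  have approx: "\<exists>h k. 0 < k \<and> \<bar>k\<bar> \<le> int N + 1 \<and> \<bar>h\<bar> \<le> int N + 1 \<and> \<bar>p * of_int h - q * of_int k\<bar> \<le> 1 / real N"
    if pq: "\<bar>q\<bar> \<le> \<bar>p\<bar>" "p \<noteq> 0" "\<bar>p\<bar> \<le> 1" for p q :: real
  proof -
    obtain h k where hk: "0 < k" "k \<le> int N" "\<bar>of_int k * (q / p) - of_int h\<bar> < 1 / real N"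
      using Dirichlet_approx[OF N, of "q / p"] by blast
    have "\<bar>q / p\<bar> \<le> 1" using pq by (simp add: abs_divide divide_le_eq)
    then have "of_int k * \<bar>q / p\<bar> \<le> of_int k * 1" using hk by (intro mult_left_mono) auto
    then have "\<bar>of_int k * (q / p)\<bar> \<le> real N" using hk by (simp add: abs_mult)
    moreover have "1 / real N \<le> 1" using N by simp
    ultimately have "\<bar>of_int h\<bar> \<le> real N + 1" using hk(3) by linarith
    then have h: "\<bar>h\<bar> \<le> int N + 1" by linarith
    have "p * of_int h - q * of_int k = - p * (of_int k * (q / p) - of_int h)"
      using pq by (simp add: field_simps)
    then have "\<bar>p * of_int h - q * of_int k\<bar> = \<bar>p\<bar> * \<bar>of_int k * (q / p) - of_int h\<bar>"
      by (simp add: abs_mult)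
    also have "\<dots> \<le> 1 * (1 / real N)" using pq hk(3) by (intro mult_mono) auto
    finally show ?thesis using hk h by (intro exI[of _ h] exI[of _ k]) auto
  qed
  have v1: "\<bar>v $ i\<bar> \<le> 1" for i using component_le_norm_cart[of v i] v by simp
  have vn: "v $ 1 \<noteq> 0 \<or> v $ 2 \<noteq> 0"
    using v norm_plane_sq[of v] by auto
  have "\<exists>a b :: int. (a, b) \<noteq> (0, 0) \<and> \<bar>a\<bar> \<le> int N + 1 \<and> \<bar>b\<bar> \<le> int N + 1 \<and>
      \<bar>cross2 v (vector [of_int a, of_int b])\<bar> \<le> 1 / real N"
  proof (cases "\<bar>v $ 2\<bar> \<le> \<bar>v $ 1\<bar>")
    case True
    then obtain h k where hk: "0 < k" "\<bar>k\<bar> \<le> int N + 1" "\<bar>h\<bar> \<le> int N + 1" "\<bar>v $ 1 * of_int h - v $ 2 * of_int k\<bar> \<le> 1 / real N"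
      using approx[of "v $ 2" "v $ 1"] v1 vn by fastforce
    then show ?thesis by (intro exI[of _ k] exI[of _ h]) (auto simp: cross2_def)
  next
    case False
    then obtain h k where hk: "0 < k" "\<bar>k\<bar> \<le> int N + 1" "\<bar>h\<bar> \<le> int N + 1" "\<bar>v $ 2 * of_int h - v $ 1 * of_int k\<bar> \<le> 1 / real N"
      using approx[of "v $ 1" "v $ 2"] v1 vn by fastforce
    then show ?thesis by (intro exI[of _ h] exI[of _ k]) (auto simp: cross2_def abs_minus_commute)
  qed
  then obtain a b :: int where ab: "(a, b) \<noteq> (0, 0)" "\<bar>a\<bar> \<le> int N + 1" "\<bar>b\<bar> \<le> int N + 1"
      "\<bar>cross2 v (vector [of_int a, of_int b])\<bar> \<le> 1 / real N" by blast
  show ?thesis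
  proof (cases "0 \<le> v \<bullet> vector [of_int a, of_int b]")
    case True
    then show ?thesis using ab that by blast
  next
    case False
    have e: "vector [of_int (- a), of_int (- b)] = - (vector [of_int a, of_int b] :: plane)"
      by (simp add: vec_eq_iff forall_2)
    show ?thesis
      by (rule that[of "- a" "- b"]) (use ab False in \<open>auto simp: e[simplified] cross2_linear\<close>)
  qed
qed

\<comment> \<open>The lattice points \<open>u + k w\<close> drift slowly across the ray; one of them is met by the disc.\<close>
lemma ray_meets_lattice_disc:
  fixes c x :: plane
  assumes v: "norm v = 1" and w: "w \<in> lattice" "0 \<le> v \<bullet> w" and \<delta>: "cross2 v w \<noteq> 0" "\<bar>cross2 v w\<bar> < r"
  obtains l s where "l \<in> lattice" "1 \<le> s" "s \<le> 3 + 2 * norm w / \<bar>cross2 v w\<bar>" "x + s *\<^sub>R v \<in> ball (l + c) r"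
proof -
  define \<delta> where "\<delta> = cross2 v w"
  define e where "e = sgn \<delta>"
  have e: "\<bar>e\<bar> = 1" "e * \<delta> = \<bar>\<delta>\<bar>" "e * e = 1" using \<delta> by (auto simp: e_def \<delta>_def sgn_real_def)
  \<comment> \<open>Two units ahead of \<open>x\<close>, and one unit to the side from which adding
    \<open>w\<close> drifts towards the ray. Rounding to the lattice costs at most 1, so the start
    is ahead by 1 to 3 and aside by 0 to 2.\<close>
  define y where "y = x + 2 *\<^sub>R v - e *\<^sub>R perp v - c"
  obtain u where u: "u \<in> lattice" "norm (u - y) \<le> 1" by (rule lattice_near)
  define z0 where "z0 = u + c - x"
  have z0: "z0 = 2 *\<^sub>R v - e *\<^sub>R perp v + (u - y)" by (simp add: z0_def y_def algebra_simps)
  have vv: "v \<bullet> v = 1" "v \<bullet> perp v = 0" "cross2 v (perp v) = 1"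
    using v by (simp_all add: norm_eq_1) (simp_all add: inner_plane cross2_def norm_eq_1)
  have b0: "1 \<le> v \<bullet> z0" "v \<bullet> z0 \<le> 3"
    using Cauchy_Schwarz_ineq2[of v "u - y"] u(2) v
    by (auto simp: z0 inner_add_right inner_diff_right vv)
  have "e * cross2 v z0 = - 1 + e * cross2 v (u - y)"
    using e by (simp add: z0 cross2_linear vv algebra_simps)
  moreover have "\<bar>e * cross2 v (u - y)\<bar> \<le> 1"
    using abs_cross2_le[of v "u - y"] u(2) v e by (simp add: abs_mult)
  ultimately have a0: "- 2 \<le> e * cross2 v z0" "e * cross2 v z0 \<le> 0" by linarith+
  \<comment> \<open>The last step before crossing the ray; the distance left is less than one drift
    |\<delta>| < r.\<close>
  define k where "k = \<lfloor>- (e * cross2 v z0) / \<bar>\<delta>\<bar>\<rfloor>"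
  have d0: "0 < \<bar>\<delta>\<bar>" using \<delta> by (simp add: \<delta>_def)
  have k0: "0 \<le> k" using a0 d0 by (simp add: k_def)
  have k1: "of_int k \<le> - (e * cross2 v z0) / \<bar>\<delta>\<bar>" "- (e * cross2 v z0) / \<bar>\<delta>\<bar> < of_int k + 1"
    unfolding k_def by linarith+
  then have k2: "of_int k * \<bar>\<delta>\<bar> \<le> - (e * cross2 v z0)" "- (e * cross2 v z0) < (of_int k + 1) * \<bar>\<delta>\<bar>"
    using d0 pos_le_divide_eq[OF d0] pos_divide_less_eq[OF d0] by blast+
  have k3: "of_int k \<le> 2 / \<bar>\<delta>\<bar>"
    using k1(1) a0 d0 divide_right_mono[of "- (e * cross2 v z0)" 2 "\<bar>\<delta>\<bar>"] by linarith
  define z where "z = z0 + of_int k *\<^sub>R w"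
  have cz: "e * cross2 v z = e * cross2 v z0 + of_int k * \<bar>\<delta>\<bar>"
    unfolding e(2)[symmetric] by (simp add: z_def cross2_linear \<delta>_def[symmetric] algebra_simps)
  have "\<bar>e * cross2 v z\<bar> < r"
    using k2 \<delta>(2) unfolding cz by (simp add: \<delta>_def[symmetric] algebra_simps)
  then have cr: "\<bar>cross2 v z\<bar> < r" using e by (simp add: abs_mult)
  define s where "s = v \<bullet> z"
  have s: "s = v \<bullet> z0 + of_int k * (v \<bullet> w)" by (simp add: s_def z_def inner_add_right)
  show ?thesis
  proof (rule that[of "u + of_int k *\<^sub>R w" s])
    show "u + of_int k *\<^sub>R w \<in> lattice" by (intro lattice_add lattice_scale u w)
    show "1 \<le> s" using b0 k0 w(2) by (simp add: s add_increasing2)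
    have "of_int k * (v \<bullet> w) \<le> 2 / \<bar>\<delta>\<bar> * norm w"
      using k3 k0 w(2) Cauchy_Schwarz_ineq2[of v w] v by (intro mult_mono) auto
    then show "s \<le> 3 + 2 * norm w / \<bar>cross2 v w\<bar>" using b0 by (simp add: s \<delta>_def)
    have "u + of_int k *\<^sub>R w + c - (x + s *\<^sub>R v) = z - s *\<^sub>R v"
      by (simp add: z_def z0_def algebra_simps)
    also have "\<dots> = cross2 v z *\<^sub>R perp v"
      using frame_expansion[OF v, of z] by (simp add: s_def algebra_simps)
    finally show "x + s *\<^sub>R v \<in> ball (u + of_int k *\<^sub>R w + c) r"
      using cr v by (simp add: dist_norm)
  qed
qed

\<comment> \<open>Long segments avoiding a lattice of discs are almost parallel to one of finitely many lattice vectors,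
  which can moreover be taken as long as desired.\<close>
lemma free_directions:
  fixes c :: plane
  assumes r: "0 < r"
  obtains W C where "finite W" "W \<subseteq> lattice" "0 < C"
    "\<And>R x v. 6 \<le> R \<Longrightarrow> norm v = 1 \<Longrightarrow> (\<And>s l. 0 < s \<Longrightarrow> s \<le> R \<Longrightarrow> l \<in> lattice \<Longrightarrow> x + s *\<^sub>R v \<notin> ball (l + c) r) \<Longrightarrow>
       \<exists>w\<in>W. L \<le> v \<bullet> w \<and> \<bar>cross2 v w\<bar> \<le> C / R"
proof -
  \<comment> \<open>1/N < r keeps the drift below the radius, and 1/N \<le> 1/2 gives v . w \<ge>
    1/2 for the lattice vector found below.\<close>
  define N where "N = nat \<lceil>1 / r\<rceil> + 2"
  have N: "0 < N" "1 / real N \<le> 1 / 2" by (simp_all add: N_def)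
  have "1 / r < real N" unfolding N_def by linarith
  then have Nr: "1 / real N < r" using r N by (simp add: field_simps)
  \<comment> \<open>Scaling by \<open>k\<close> lifts v . w \<ge> 1/2 to the prescribed length
    \<open>L\<close>, at the price of a constant factor in the transversal component.\<close>
  define k where "k = int (nat \<lceil>2 * L\<rceil> + 1)"
  have k: "1 \<le> k" "2 * L \<le> of_int k" unfolding k_def by linarith+
  define m where "m = int N + 1"
  define V where "V = (\<lambda>(a, b). vector [of_int a, of_int b] :: plane) ` ({- m..m} \<times> {- m..m})"
  have Vnorm: "norm w \<le> 2 * of_int m" if w: "w \<in> V" for w
  proof -
    obtain a b :: int where ab: "w = vector [of_int a, of_int b]" "\<bar>a\<bar> \<le> m" "\<bar>b\<bar> \<le> m"
      using w unfolding V_def by fastforce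
    have "norm w \<le> \<bar>of_int a\<bar> + \<bar>of_int b\<bar>"
      by (rule order_trans[OF norm_le_l1_cart]) (simp add: sum_2 ab)
    then show ?thesis using ab by linarith
  qed
  show ?thesis
  proof (rule that[of "(\<lambda>w. of_int k *\<^sub>R w) ` V" "of_int k * (4 * (2 * of_int m))"])
    show "finite ((\<lambda>w. of_int k *\<^sub>R w) ` V)" by (simp add: V_def)
    show "(\<lambda>w. of_int k *\<^sub>R w) ` V \<subseteq> lattice" by (auto simp: V_def intro!: lattice_scale lattice_vector)
    show "0 < of_int k * (4 * (2 * of_int m) :: real)" using k by (simp add: m_def)
    fix R x v assume R: "(6::real) \<le> R" and v: "norm (v::plane) = 1"
      and free: "\<And>s l. 0 < s \<Longrightarrow> s \<le> R \<Longrightarrow> l \<in> lattice \<Longrightarrow> x + s *\<^sub>R v \<notin> ball (l + c) r"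
    obtain a b :: int where ab: "(a, b) \<noteq> (0, 0)" "\<bar>a\<bar> \<le> int N + 1" "\<bar>b\<bar> \<le> int N + 1"
      "\<bar>cross2 v (vector [of_int a, of_int b])\<bar> \<le> 1 / real N" "0 \<le> v \<bullet> vector [of_int a, of_int b]"
      by (rule lattice_direction[OF N(1) v])
    define w :: plane where "w = vector [of_int a, of_int b]"
    have wV: "w \<in> V" unfolding w_def V_def m_def using ab by (intro image_eqI[of _ _ "(a, b)"]) auto
    have wl: "w \<in> lattice" unfolding w_def by (rule lattice_vector)
    have w0: "w \<noteq> 0" using ab(1) by (auto simp: w_def vec_eq_iff forall_2)
    define \<delta> where "\<delta> = cross2 v w"
    have \<delta>: "\<bar>\<delta>\<bar> \<le> 1 / real N" using ab(4) by (simp add: \<delta>_def w_def)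
    have vw: "0 \<le> v \<bullet> w" using ab(5) by (simp add: w_def)
    have "norm w \<le> norm ((v \<bullet> w) *\<^sub>R v) + norm (cross2 v w *\<^sub>R perp v)"
      by (subst frame_expansion[OF v, of w]) (rule norm_triangle_ineq)
    then have "1 \<le> v \<bullet> w + \<bar>\<delta>\<bar>" using norm_lattice_ge_1[OF wl w0] vw v by (simp add: \<delta>_def)
    then have vw2: "1 / 2 \<le> v \<bullet> w" using \<delta> N(2) by linarith
    \<comment> \<open>A nonzero drift makes the ray meet a disc by the time 3 + 2 |w| / |\<delta>|,
      which must exceed \<open>R\<close>; R \<ge> 6 absorbs the 3 into R / 2.\<close>
    have d: "\<bar>\<delta>\<bar> \<le> 4 * norm w / R"
    proof (cases "\<delta> = 0")
      case False
      obtain l s where ls: "l \<in> lattice" "1 \<le> s" "s \<le> 3 + 2 * norm w / \<bar>\<delta>\<bar>" "x + s *\<^sub>R v \<in> ball (l + c) r"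
        using ray_meets_lattice_disc[OF v wl vw, of r x c] False \<delta> Nr unfolding \<delta>_def by (metis order_le_less_trans)
      then have "R < s" using free[of s l] by force
      then have "R < 3 + 2 * norm w / \<bar>\<delta>\<bar>" using ls(3) by linarith
      then have "R / 2 < 2 * norm w / \<bar>\<delta>\<bar>" using R by linarith
      then show ?thesis using False R by (simp add: field_simps)
    qed (use R in auto)
    show "\<exists>w\<in>(\<lambda>w. of_int k *\<^sub>R w) ` V. L \<le> v \<bullet> w \<and> \<bar>cross2 v w\<bar> \<le> of_int k * (4 * (2 * of_int m)) / R"
    proof (rule bexI[of _ "of_int k *\<^sub>R w"], intro conjI)
      have "of_int k * (1 / 2) \<le> of_int k * (v \<bullet> w)" using k vw2 by (intro mult_left_mono) auto
      then have "L \<le> of_int k * (v \<bullet> w)" using k(2) by linarith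
      then show "L \<le> v \<bullet> (of_int k *\<^sub>R w)" by simp
      have "\<bar>\<delta>\<bar> \<le> 4 * (2 * of_int m) / R"
        using d Vnorm[OF wV] R divide_right_mono[of "4 * norm w" "4 * (2 * of_int m)" R] by linarith
      then have "of_int k * \<bar>\<delta>\<bar> \<le> of_int k * (4 * (2 * of_int m) / R)"
        using k by (intro mult_left_mono) auto
      then show "\<bar>cross2 v (of_int k *\<^sub>R w)\<bar> \<le> of_int k * (4 * (2 * of_int m)) / R"
        using k by (simp add: cross2_linear \<delta>_def abs_mult)
    qed (use wV in \<open>rule imageI\<close>)
  qed
qed

section \<open>Boundaries of obstacles\<close>

lemma C3_boundaryE:
  assumes "C3_boundary K len c"
  obtains c1 c2 c3 where "0 < len" "\<And>r. c (r + len) = c r" "c ` {0..<len} = frontier K"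
    "\<And>r. (c has_vector_derivative c1 r) (at r)" "\<And>r. (c1 has_vector_derivative c2 r) (at r)"
    "\<And>r. (c2 has_vector_derivative c3 r) (at r)" "continuous_on UNIV c3"
    "\<And>r. norm (c1 r) = 1" "\<And>r. c2 r \<noteq> 0"
  using assms unfolding C3_boundary_def by blast

lemma C3_boundary_image:
  assumes "C3_boundary K len c"
  shows "c ` {0..len} = frontier K" "compact (frontier K)" "frontier K \<noteq> {}" "c r \<in> frontier K"
proof -
  obtain c1 where len: "0 < len" and per: "\<And>r. c (r + len) = c r" and im: "c ` {0..<len} = frontier K"
    and d: "\<And>r. (c has_vector_derivative c1 r) (at r)"
    by (rule C3_boundaryE[OF assms]) metis
  have "c len = c 0" using per[of 0] by simp
  moreover have "{0..len} = insert len {0..<len}" using len by auto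
  moreover have "c 0 \<in> c ` {0..<len}" using len by auto
  ultimately show eq: "c ` {0..len} = frontier K" using im by (simp add: insert_absorb)
  have "continuous_on {0..len} c"
    using d by (meson has_vector_derivative_continuous continuous_at_imp_continuous_on)
  then show "compact (frontier K)" unfolding eq[symmetric] by (intro compact_continuous_image) auto
  show "frontier K \<noteq> {}" using im len by auto
  have shift: "c (r + real n * len) = c r" for n r
  proof (induction n)
    case (Suc n)
    have "r + real (Suc n) * len = (r + real n * len) + len" by (simp add: algebra_simps)
    then show ?case using Suc per[of "r + real n * len"] by (simp only:)
  qed simp
  have ishift: "c (r + of_int m * len) = c r" for m r
  proof (cases "0 \<le> m")
    case True
    then show ?thesis using shift[of r "nat m"] by simp
  next
    case False
    then have "real (nat (- m)) = - of_int m" by simp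
    then have "r + of_int m * len + real (nat (- m)) * len = r" by simp
    then show ?thesis using shift[of "r + of_int m * len" "nat (- m)"] by (simp only:)
  qed
  define m where "m = \<lfloor>r / len\<rfloor>"
  have "of_int m \<le> r / len" "r / len < of_int m + 1" unfolding m_def by linarith+
  then have "of_int m * len \<le> r" "r < (of_int m + 1) * len"
    using pos_le_divide_eq[OF len] pos_divide_less_eq[OF len] by blast+
  then have "r + of_int (- m) * len \<in> {0..<len}" by (auto simp: algebra_simps)
  then have "c (r + of_int (- m) * len) \<in> frontier K" using im by blast
  then show "c r \<in> frontier K" using ishift[of r "- m"] by simp
qed

text \<open>The exterior of a disc containing the frontier is connected. An unbounded
  \<open>K\<close> meets this exterior, so contains it; every point of the plane is a midpoint of
  two exterior points, so convexity gives K = UNIV, whose frontier is empty.\<close>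

lemma bounded_of_compact_frontier:
  fixes K :: "plane set"
  assumes "convex K" "bounded (frontier K)" "frontier K \<noteq> {}"
  shows "bounded K"
proof (rule ccontr)
  assume unb: "\<not> bounded K"
  obtain B where B: "\<And>z. z \<in> frontier K \<Longrightarrow> norm z \<le> B" using assms(2) by (auto simp: bounded_iff)
  obtain z where z: "z \<in> K" "B < norm z" using unb by (force simp: bounded_iff not_le)
  have conn: "connected (- cball (0::plane) B)"
    by (rule connected_complement_bounded_convex) auto
  have sub: "- cball 0 B \<subseteq> K"
  proof (rule ccontr)
    assume "\<not> - cball 0 B \<subseteq> K"
    moreover have "z \<in> - cball 0 B \<inter> K" using z by auto
    ultimately have "- cball 0 B \<inter> frontier K \<noteq> {}"
      by (intro connected_Int_frontier[OF conn]) blast+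
    then show False using B by force
  qed
  have "x \<in> K" for x
  proof -
    define y :: plane where "y = (\<bar>B\<bar> + norm x + 1) *\<^sub>R axis 1 1"
    have y: "norm y = \<bar>B\<bar> + norm x + 1" by (simp add: y_def)
    have "B < norm (x + y)" "B < norm (x - y)"
      using norm_triangle_ineq4[of "x + y" x] norm_triangle_ineq4[of x "x - y"] y by auto
    then have "x + y \<in> K" "x - y \<in> K" using sub by auto
    then have "(1 / 2) *\<^sub>R (x + y) + (1 / 2) *\<^sub>R (x - y) \<in> K"
      by (intro convexD[OF assms(1)]) auto
    then show ?thesis by (simp add: algebra_simps scaleR_2[symmetric])
  qed
  then have "K = UNIV" by auto
  then show False using assms(3) by simp
qed

text \<open>A function that vanishes at \<open>r\<close> and never exceeds \<delta> has slope of
  order sqrt \<delta> there. Adding K (x - r)^2 / 2 makes it convex near \<open>r\<close>, hence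
  above its tangent; at the step g1 r / K, of length at most 1, this gives g \<ge> (g1 r)^2 / (2
  K).\<close>

lemma tangent_height_bound:
  fixes g g1 g2 :: "real \<Rightarrow> real"
  assumes "\<And>x. (g has_real_derivative g1 x) (at x)" "\<And>x. (g1 has_real_derivative g2 x) (at x)"
    and "\<And>x. x \<in> {r - 1..r + 1} \<Longrightarrow> \<bar>g2 x\<bar> \<le> K" "1 \<le> K" "\<bar>g1 r\<bar> \<le> 1" "g r = 0" "\<And>x. g x \<le> \<delta>"
  shows "(g1 r)\<^sup>2 \<le> 2 * K * \<delta>"
proof -
  define \<psi> where "\<psi> x = g x + K * (x - r)\<^sup>2 / 2" for x
  define \<psi>1 where "\<psi>1 x = g1 x + K * (x - r)" for x
  define h where "h = g1 r / K"
  have "\<bar>h\<bar> \<le> 1" using assms(4,5) by (simp add: h_def abs_divide divide_le_eq)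
  then have h: "r + h \<in> {r - 1..r + 1}" by auto
  have d: "(\<psi> has_real_derivative \<psi>1 x) (at x)" for x
    unfolding \<psi>_def \<psi>1_def by (auto intro!: derivative_eq_intros assms)
  have "convex_on {r - 1..r + 1} \<psi>"
  proof (rule f''_ge0_imp_convex)
    show "\<And>x. (\<psi> has_real_derivative \<psi>1 x) (at x)" by (rule d)
    show "(\<psi>1 has_real_derivative g2 x + K) (at x)" for x
      unfolding \<psi>1_def by (auto intro!: derivative_eq_intros assms)
    show "0 \<le> g2 x + K" if "x \<in> {r - 1..r + 1}" for x using assms(3)[OF that] by linarith
  qed auto
  then have "\<psi> (r + h) - \<psi> r \<ge> \<psi>1 r * (r + h - r)"
    by (rule convex_on_imp_above_tangent) (use d h in \<open>auto intro: has_field_derivative_at_within\<close>)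
  then have "(g1 r)\<^sup>2 / K \<le> g (r + h) + (g1 r)\<^sup>2 / (2 * K)"
    using assms(4,6) by (simp add: \<psi>_def \<psi>1_def h_def power2_eq_square divide_simps split: if_splits)
  moreover have "(g1 r)\<^sup>2 / K = 2 * ((g1 r)\<^sup>2 / (2 * K))" by simp
  ultimately have "(g1 r)\<^sup>2 / (2 * K) \<le> \<delta>" using assms(7)[of "r + h"] by linarith
  then show ?thesis using assms(4) by (simp add: field_simps)
qed

\<comment> \<open>Where \<open>g\<close> is small, \<open>g'\<close> is not; so on each short interval the sublevel set has length of order \<open>e\<close>.\<close>
lemma sublevel_measure:
  fixes a b m K :: real
  assumes "0 < m" "0 < K" "a \<le> b"
  obtains C where "0 < C" "\<And>g g1 g2 e. (\<And>x. (g has_real_derivative g1 x) (at x)) \<Longrightarrow>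
      (\<And>x. (g1 has_real_derivative g2 x) (at x)) \<Longrightarrow> (\<And>x. x \<in> {a..b} \<Longrightarrow> \<bar>g2 x\<bar> \<le> K) \<Longrightarrow>
      (\<And>x. x \<in> {a..b} \<Longrightarrow> m\<^sup>2 \<le> (g x)\<^sup>2 + (g1 x)\<^sup>2) \<Longrightarrow> 0 \<le> e \<Longrightarrow>
      emeasure lborel {x \<in> {a..b}. \<bar>g x\<bar> \<le> e} \<le> ennreal (C * e)"
proof -
  \<comment> \<open>Over a length \<open>d\<close> the derivative changes by at most m/4, while it
    is at least m/2 in modulus where |g| \<le> m/2. So two points of the sublevel set in one cell of
    length \<open>d\<close> are at most 8 e / m apart.\<close>
  define d where "d = m / (4 * K)"
  have d: "0 < d" using assms by (simp add: d_def)
  define n where "n = nat \<lceil>(b - a) / d\<rceil>"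
  define C where "C = max (2 * (b - a) / m) (real (Suc n) * (16 / m)) + 1"
  show ?thesis
  proof (rule that[of C])
    show "0 < C" using assms by (simp add: C_def add_nonneg_pos max.coboundedI2)
    fix g g1 g2 :: "real \<Rightarrow> real" and e :: real
    assume g: "\<And>x. (g has_real_derivative g1 x) (at x)" "\<And>x. (g1 has_real_derivative g2 x) (at x)"
      and g2: "\<And>x. x \<in> {a..b} \<Longrightarrow> \<bar>g2 x\<bar> \<le> K" and lower: "\<And>x. x \<in> {a..b} \<Longrightarrow> m\<^sup>2 \<le> (g x)\<^sup>2 + (g1 x)\<^sup>2" and e: "0 \<le> e"
    let ?S = "{x \<in> {a..b}. \<bar>g x\<bar> \<le> e}"
    have Ce: "x * e \<le> C * e" if "x \<le> C" for x using that e by (intro mult_right_mono)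
    show "emeasure lborel ?S \<le> ennreal (C * e)"
    proof (cases "e \<le> m / 2")
      \<comment> \<open>For e > m/2 the length of the whole interval is already of order e.\<close>
      case False
      have "emeasure lborel ?S \<le> emeasure lborel {a..b}" by (intro emeasure_mono) auto
      also have "\<dots> = ennreal (b - a)" using assms by simp
      also have "b - a \<le> 2 * (b - a) / m * e"
      proof -
        have "(b - a) * 1 \<le> (b - a) * (2 * e / m)"
          using False assms by (intro mult_left_mono) (auto simp: field_simps)
        then show ?thesis by (simp add: algebra_simps)
      qed
      also have "\<dots> \<le> C * e" by (rule Ce) (simp add: C_def)
      finally show ?thesis by (simp add: ennreal_leI)
    next
      case True
      define S where "S i = {x \<in> ?S. \<lfloor>(x - a) / d\<rfloor> = int i}" for i
      have close: "\<bar>x - y\<bar> \<le> 8 * e / m" if xy: "x \<in> S i" "y \<in> S i" "x < y" for x y i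
      proof -
        have x: "x \<in> {a..b}" "\<bar>g x\<bar> \<le> e" and y: "y \<in> {a..b}" "\<bar>g y\<bar> \<le> e"
          and fl: "\<lfloor>(x - a) / d\<rfloor> = \<lfloor>(y - a) / d\<rfloor>" using xy by (auto simp: S_def)
        have "\<bar>(y - a) / d - (x - a) / d\<bar> \<le> 1" using fl by linarith
        then have dxy: "y - x \<le> d" using d xy(3) by (simp add: diff_divide_distrib[symmetric] divide_le_eq)
        obtain \<xi> where \<xi>: "x < \<xi>" "\<xi> < y" "g y - g x = (y - x) * g1 \<xi>"
          using MVT2[OF xy(3), of g g1] g(1) by blast
        obtain \<eta> where \<eta>: "x < \<eta>" "\<eta> < \<xi>" "g1 \<xi> - g1 x = (\<xi> - x) * g2 \<eta>"
          using MVT2[OF \<xi>(1), of g1 g2] g(2) by blast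
        have "\<bar>g1 \<xi> - g1 x\<bar> \<le> d * K"
          unfolding \<eta>(3) abs_mult using \<xi> \<eta> x y dxy by (intro mult_mono g2) auto
        also have "\<dots> = m / 4" using assms by (simp add: d_def)
        finally have c: "\<bar>g1 \<xi> - g1 x\<bar> \<le> m / 4" .
        have "(g x)\<^sup>2 \<le> (m / 2)\<^sup>2" using x True assms(1) by (intro abs_le_square_iff[THEN iffD1]) auto
        then have "(m / 2)\<^sup>2 \<le> (g1 x)\<^sup>2" using lower[OF x(1)] zero_le_power2[of m] power_divide[of m 2 2, simplified] by linarith
        then have "m / 2 \<le> \<bar>g1 x\<bar>" using assms(1) abs_le_square_iff[of "m / 2" "g1 x"] by simp
        then have l: "m / 4 \<le> \<bar>g1 \<xi>\<bar>" using c by linarith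
        have "(y - x) * (m / 4) \<le> (y - x) * \<bar>g1 \<xi>\<bar>" using l xy by (intro mult_left_mono) auto
        also have "\<dots> = \<bar>g y - g x\<bar>" unfolding \<xi>(3) using xy by (simp add: abs_mult)
        also have "\<dots> \<le> 2 * e" using x y by linarith
        finally show ?thesis using assms(1) xy by (simp add: field_simps)
      qed
      have Si: "\<exists>x0. S i \<subseteq> {x0 - 8 * e / m .. x0 + 8 * e / m}" for i
      proof (cases "S i = {}")
        case False
        then obtain x0 where x0: "x0 \<in> S i" by auto
        have "\<bar>x - x0\<bar> \<le> 8 * e / m" if "x \<in> S i" for x
          using close[OF that x0] close[OF x0 that] e assms(1) by (cases x x0 rule: linorder_cases) (auto simp: abs_minus_commute)
        then show ?thesis by (intro exI[of _ x0]) (force simp: abs_le_iff)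
      qed auto
      then obtain x0 where x0: "\<And>i. S i \<subseteq> {x0 i - 8 * e / m .. x0 i + 8 * e / m}" by metis
      have "?S \<subseteq> (\<Union>i\<in>{..n}. {x0 i - 8 * e / m .. x0 i + 8 * e / m})"
      proof
        fix x assume x: "x \<in> ?S"
        define i where "i = nat \<lfloor>(x - a) / d\<rfloor>"
        have "0 \<le> (x - a) / d" using x d by auto
        then have "int i = \<lfloor>(x - a) / d\<rfloor>" by (simp add: i_def)
        then have "x \<in> S i" using x by (simp add: S_def)
        moreover have "(x - a) / d \<le> (b - a) / d" using x d by (intro divide_right_mono) auto
        then have "i \<le> n" unfolding i_def n_def by (intro nat_mono) linarith
        ultimately show "x \<in> (\<Union>i\<in>{..n}. {x0 i - 8 * e / m .. x0 i + 8 * e / m})" using x0 by blast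
      qed
      then have "emeasure lborel ?S \<le> emeasure lborel (\<Union>i\<in>{..n}. {x0 i - 8 * e / m .. x0 i + 8 * e / m})"
        by (intro emeasure_mono) auto
      also have "\<dots> \<le> (\<Sum>i\<in>{..n}. emeasure lborel {x0 i - 8 * e / m .. x0 i + 8 * e / m})"
        by (intro emeasure_subadditive_finite) auto
      also have "\<dots> = (\<Sum>i\<in>{..n}. ennreal (16 * e / m))"
        using e assms(1) by (intro sum.cong refl) (subst emeasure_lborel_Icc, auto simp: field_simps)
      also have "\<dots> = ennreal (real (Suc n) * (16 / m) * e)"
        using e assms(1) by (subst sum_ennreal) (auto simp: field_simps)
      also have "\<dots> \<le> ennreal (C * e)" by (intro ennreal_leI Ce) (simp add: C_def)
      finally show ?thesis .
    qed
  qed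
qed

section \<open>Long free flights\<close>

locale billiard =
  fixes J :: "'j set" and Ob :: "'j \<Rightarrow> plane set" and len :: "'j \<Rightarrow> real" and c :: "'j \<Rightarrow> real \<Rightarrow> plane"
  assumes billiard: "infinite_horizon_billiard J Ob len c"
begin

lemma obstacles:
  "finite J" "J \<noteq> {}" "j \<in> J \<Longrightarrow> open (Ob j)" "j \<in> J \<Longrightarrow> convex (Ob j)" "j \<in> J \<Longrightarrow> C3_boundary (Ob j) (len j) (c j)"
  using billiard unfolding infinite_horizon_billiard_def by blast+

lemma disjoint_closures:
  assumes "j \<in> J" "j' \<in> J" "l \<in> lattice" "l' \<in> lattice" "z \<in> closure ((+) l ` Ob j)" "z \<in> closure ((+) l' ` Ob j')"
  shows "j = j' \<and> l = l'"
proof (rule ccontr)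
  assume "\<not> (j = j' \<and> l = l')"
  then have "closure ((+) l ` Ob j) \<inter> closure ((+) l' ` Ob j') = {}"
    using billiard assms(1-4) unfolding infinite_horizon_billiard_def by blast
  then show False using assms(5,6) by blast
qed

definition tangent :: "'j \<Rightarrow> real \<Rightarrow> plane" where
  "tangent j r = vector_derivative (c j) (at r)"

lemma tangentE:
  assumes j: "j \<in> J"
  obtains c2 c3 where "\<And>r. (c j has_vector_derivative tangent j r) (at r)"
    "\<And>r. (tangent j has_vector_derivative c2 r) (at r)" "\<And>r. (c2 has_vector_derivative c3 r) (at r)"
    "continuous_on UNIV c3" "\<And>r. norm (tangent j r) = 1" "\<And>r. c2 r \<noteq> 0" "0 < len j"
proof (rule C3_boundaryE[OF obstacles(5)[OF j]])
  fix c1 c2 c3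
  assume c: "0 < len j" "\<And>r. (c j has_vector_derivative c1 r) (at r)"
    "\<And>r. (c1 has_vector_derivative c2 r) (at r)" "\<And>r. (c2 has_vector_derivative c3 r) (at r)"
    "continuous_on UNIV c3" "\<And>r. norm (c1 r) = 1" "\<And>r. c2 r \<noteq> 0"
  have "tangent j = c1"
    using vector_derivative_at[OF c(2)] by (simp add: tangent_def fun_eq_iff)
  then show ?thesis using that[of c2 c3] c by simp
qed

lemma obstacle_bounded: "j \<in> J \<Longrightarrow> bounded (Ob j)"
  using bounded_of_compact_frontier[of "Ob j"] obstacles(4) C3_boundary_image[OF obstacles(5)] compact_imp_bounded
  by blast

lemma obstacle_nonempty: "j \<in> J \<Longrightarrow> Ob j \<noteq> {}"
  using C3_boundary_image(3)[OF obstacles(5), of j] by auto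

lemma boundary_point: "j \<in> J \<Longrightarrow> c j r \<in> frontier (Ob j)"
  by (rule C3_boundary_image(4)[OF obstacles(5)])

lemma diameter:
  obtains D where "1 \<le> D" "\<And>j z. j \<in> J \<Longrightarrow> z \<in> closure (Ob j) \<Longrightarrow> norm z \<le> D"
proof -
  have "bounded (\<Union>j\<in>J. closure (Ob j))"
    using obstacles(1) obstacle_bounded by (auto intro!: bounded_UN)
  then obtain B where "\<And>z. z \<in> (\<Union>j\<in>J. closure (Ob j)) \<Longrightarrow> norm z \<le> B" by (auto simp: bounded_iff)
  then show ?thesis using that[of "max 1 B"] by (fastforce simp: le_max_iff_disj)
qed

lemma frontier_closure: "z \<in> frontier S \<Longrightarrow> z \<in> closure S"
  by (simp add: frontier_def)

text \<open>The boundary curve maximises n . z at \<open>c j r\<close>, so \<open>n\<close> is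
  orthogonal to the tangent, which leaves two candidates. The point \<open>z0\<close> of the open
  obstacle lies strictly on the inner side and decides between them.\<close>

lemma normal_unique:
  assumes j: "j \<in> J" and z0: "z0 \<in> Ob j" and n: "norm n = 1" "\<And>z. z \<in> Ob j \<Longrightarrow> n \<bullet> (z - c j r) \<le> 0"
  shows "n = (if perp (tangent j r) \<bullet> (z0 - c j r) < 0 then perp (tangent j r) else - perp (tangent j r))"
proof -
  let ?t = "tangent j r" and ?q = "c j r"
  obtain c2 where d: "\<And>r. (c j has_vector_derivative tangent j r) (at r)" and t: "norm ?t = 1"
    by (rule tangentE[OF j]) blast
  have "n \<bullet> (z - ?q) \<le> 0" if "z \<in> closure (Ob j)" for z
  proof -
    have "closure (Ob j) \<subseteq> {z. n \<bullet> z \<le> n \<bullet> ?q}"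
      using n(2) by (intro closure_minimal closed_halfspace_le) (auto simp: inner_diff_right)
    then show ?thesis using that by (auto simp: inner_diff_right)
  qed
  then have le: "n \<bullet> (c j x - ?q) \<le> 0" for x using boundary_point[OF j] frontier_closure by blast
  have "((\<lambda>x. n \<bullet> (c j x - ?q)) has_real_derivative n \<bullet> ?t) (at r)"
    unfolding has_real_derivative_iff_has_vector_derivative
    using d[of r] by (auto intro!: derivative_eq_intros bounded_linear.has_vector_derivative[OF bounded_linear_inner_right])
  then have nt: "n \<bullet> ?t = 0"
    by (rule DERIV_local_max[of _ _ _ 1]) (use le in auto)
  have eq: "n = cross2 ?t n *\<^sub>R perp ?t"
    using frame_expansion[OF t, of n] nt by (simp add: inner_commute)
  then have "norm n = \<bar>cross2 ?t n\<bar>" by (metis norm_scaleR perp_simps(3) t mult.right_neutral)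
  then have pm: "cross2 ?t n = 1 \<or> cross2 ?t n = - 1" using n(1) by linarith
  have lt: "n \<bullet> (z0 - ?q) < 0"
  proof -
    obtain e where e: "0 < e" "ball z0 e \<subseteq> Ob j" using obstacles(3)[OF j] z0 open_contains_ball by blast
    have "z0 + (e / 2) *\<^sub>R n \<in> Ob j" using e n(1) by (intro subsetD[OF e(2)]) (auto simp: dist_norm)
    from n(2)[OF this] have "n \<bullet> (z0 - ?q) + (e / 2) * (n \<bullet> n) \<le> 0"
      by (simp add: inner_add_right inner_diff_right)
    then show ?thesis using e n(1) by (simp add: norm_eq_1)
  qed
  from pm show ?thesis
  proof
    assume "cross2 ?t n = 1"
    then have "n = perp ?t" using eq by simp
    then show ?thesis using lt by simp
  next
    assume "cross2 ?t n = - 1"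
    then have "n = - perp ?t" using eq by simp
    then show ?thesis using lt by simp
  qed
qed

text \<open>A separating hyperplane supplies the normal, so the \<open>THE\<close> is well defined.
  The sign test against one fixed interior point makes the formula visibly measurable in
  \<open>r\<close>.\<close>

lemma outer_normal_eq:
  assumes j: "j \<in> J" and z0: "z0 \<in> Ob j"
  shows "outer_normal (Ob j) (c j r) =
    (if perp (tangent j r) \<bullet> (z0 - c j r) < 0 then perp (tangent j r) else - perp (tangent j r))"
proof -
  let ?q = "c j r"
  have "?q \<notin> Ob j"
    using boundary_point[OF j, of r] obstacles(3)[OF j] by (simp add: frontier_def interior_open)
  then obtain a b where a: "a \<noteq> 0" "\<And>z. z \<in> Ob j \<Longrightarrow> a \<bullet> z \<le> b" "b \<le> a \<bullet> ?q"
    using separating_hyperplane_sets[of "Ob j" "{?q}"] obstacles(4)[OF j] z0 by auto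
  define n where "n = a /\<^sub>R norm a"
  have n: "norm n = 1" "\<And>z. z \<in> Ob j \<Longrightarrow> n \<bullet> (z - ?q) \<le> 0"
  proof -
    show "norm n = 1" using a(1) by (simp add: n_def)
    fix z assume "z \<in> Ob j"
    then have "a \<bullet> (z - ?q) \<le> 0" using a by (force simp: inner_diff_right)
    then show "n \<bullet> (z - ?q) \<le> 0" using a(1) by (simp add: n_def divide_nonpos_pos mult_nonneg_nonpos)
  qed
  have "outer_normal (Ob j) ?q = n"
    unfolding outer_normal_def
    by (rule the_equality) (use n normal_unique[OF j z0] in blast)+
  then show ?thesis using normal_unique[OF j z0 n] by simp
qed

lemma outer_normal_perp:
  assumes "j \<in> J"
  shows "outer_normal (Ob j) (c j r) = perp (tangent j r) \<or> outer_normal (Ob j) (c j r) = - perp (tangent j r)"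
proof -
  obtain z0 where "z0 \<in> Ob j" using obstacle_nonempty[OF assms] by blast
  from outer_normal_eq[OF assms this] show ?thesis by metis
qed

text \<open>Only the open obstacles are avoided: tangential contacts are permitted, and the set is
  closed, hence Borel.\<close>

definition free_set :: "real \<Rightarrow> phase set" where
  "free_set R = {(q, v). \<forall>s\<in>{0<..R}. \<forall>j\<in>J. \<forall>l\<in>lattice. q + s *\<^sub>R v \<notin> (+) l ` Ob j}"

lemma free_set_closed: "closed (free_set R)"
proof -
  have "free_set R = (\<Inter>s\<in>{0<..R}. \<Inter>j\<in>J. \<Inter>l\<in>lattice. (\<lambda>x. fst x + s *\<^sub>R snd x) -` (- ((+) l ` Ob j)))"
    by (simp add: free_set_def set_eq_iff split_beta)
  also have "closed \<dots>"
    by (intro closed_INT ballI closed_vimage continuous_intros) (auto simp: open_translation obstacles(3))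
  finally show ?thesis .
qed

\<comment> \<open>The values of \<open>THE\<close> and \<open>Inf\<close> on empty predicates are unknown but fixed, so they only affect \<open>D\<close>.\<close>
lemma large_cell_change:
  obtains D where "\<And>q v R. (q, v) \<in> phase_space J Ob \<Longrightarrow> D \<le> R \<Longrightarrow> R < norm (cell_change J Ob (q, v)) \<Longrightarrow>
    (q, v) \<in> free_set (R - D)"
proof -
  obtain B where B: "1 \<le> B" "\<And>j z. j \<in> J \<Longrightarrow> z \<in> closure (Ob j) \<Longrightarrow> norm z \<le> B"
    using diameter by blast
  define k0 :: plane where "k0 = (THE l. False)"
  define t0 :: real where "t0 = Inf {}"
  define D where "D = 6 * B + norm k0 + \<bar>t0\<bar>"
  show ?thesis
  proof (rule that[of "2 * D"])
    fix q v R assume ps: "(q, v) \<in> phase_space J Ob" and R: "2 * D \<le> R" "R < norm (cell_change J Ob (q, v))"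
    have v: "norm v = 1" and qB: "norm q \<le> B"
      using ps B(2) frontier_closure by (auto simp: phase_space_def)
    define S where "S = {s. 0 < s \<and> (\<exists>j\<in>J. \<exists>l\<in>lattice. q + s *\<^sub>R v - l \<in> frontier (Ob j))}"
    define \<tau> where "\<tau> = Inf S"
    define k where "k = cell_change J Ob (q, v)"
    define Q where "Q l \<longleftrightarrow> l \<in> lattice \<and> (\<exists>j\<in>J. q + \<tau> *\<^sub>R v - l \<in> frontier (Ob j))" for l
    have k: "k = (THE l. Q l)"
      by (simp add: k_def cell_change_def Q_def \<tau>_def S_def free_flight_def)
    have shift: "z \<in> closure ((+) l ` Ob j)" if "z - l \<in> frontier (Ob j)" for z l j
    proof -
      have "l + (z - l) \<in> (+) l ` closure (Ob j)" using that frontier_closure by blast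
      then show ?thesis by (simp add: closure_translation)
    qed
    have Dp: "6 * B \<le> D" "norm k0 \<le> D" "\<bar>t0\<bar> \<le> D" "0 < D" using B(1) norm_ge_zero[of k0] unfolding D_def by linarith+
    have "R < norm k" using R by (simp add: k_def)
    have "\<exists>l. Q l"
    proof (rule ccontr)
      assume "\<nexists>l. Q l"
      then have "norm k = norm k0" by (simp add: k k0_def)
      then show False using \<open>R < norm k\<close> R Dp by linarith
    qed
    then obtain l where l: "Q l" by blast
    have "l' = l" if "Q l'" for l'
      using l that shift disjoint_closures[of _ _ l' l "q + \<tau> *\<^sub>R v"] by (auto simp: Q_def)
    then have "k = l" unfolding k using l by blast
    then obtain j where j: "j \<in> J" "q + \<tau> *\<^sub>R v - k \<in> frontier (Ob j)" using l by (auto simp: Q_def)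
    have "norm (q + \<tau> *\<^sub>R v - (q + \<tau> *\<^sub>R v - k)) \<le> norm q + norm (\<tau> *\<^sub>R v) + norm (q + \<tau> *\<^sub>R v - k)"
      by (intro order_trans[OF norm_triangle_ineq4] add_right_mono norm_triangle_ineq)
    then have "norm k \<le> norm q + norm (\<tau> *\<^sub>R v) + norm (q + \<tau> *\<^sub>R v - k)" by simp
    then have "norm k \<le> 2 * B + \<bar>\<tau>\<bar>" using qB v B(2)[OF j(1) frontier_closure[OF j(2)]] by simp
    then have \<tau>: "R - 2 * B < \<bar>\<tau>\<bar>" using \<open>R < norm k\<close> by linarith
    have S: "S \<noteq> {}"
    proof
      assume "S = {}"
      then have "\<tau> = t0" by (simp add: \<tau>_def t0_def)
      then show False using \<tau> R Dp by linarith
    qed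
    then have "0 \<le> \<tau>" unfolding \<tau>_def by (rule cInf_greatest) (auto simp: S_def)
    define R' where "R' = R - 2 * D"
    have R': "R' < \<tau>" "0 \<le> R'" using \<tau> Dp B(1) R \<open>0 \<le> \<tau>\<close> by (auto simp: R'_def)
    have big: "R - 2 * B < \<tau>" "4 * B < R - 2 * B" using \<tau> \<open>0 \<le> \<tau>\<close> R Dp by auto
    have noS: "s \<notin> S" if "s < \<tau>" for s
    proof
      assume "s \<in> S"
      then have "\<tau> \<le> s" unfolding \<tau>_def by (rule cInf_lower) (auto simp: S_def intro!: bdd_belowI[of _ 0])
      then show False using that by simp
    qed
    show "(q, v) \<in> free_set (R - 2 * D)"
      unfolding free_set_def R'_def[symmetric]
    proof (clarify)
      fix s i l z assume s: "s \<in> {0<..R'}" and i: "i \<in> J" and l: "l \<in> lattice" and z: "z \<in> Ob i" "q + s *\<^sub>R v = l + z"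
      \<comment> \<open>The segment touches no frontier before \<tau>. If it entered an obstacle it
        would be contained in it, which is impossible because its points at T and T / 4 are more
        than 2 B apart.\<close>
      define A where "A = (\<lambda>s. q + s *\<^sub>R v) ` {0<..R - 2 * B}"
      have "connected A"
        unfolding A_def by (intro connected_continuous_image continuous_intros) auto
      have sA: "s \<in> {0<..R - 2 * B}" using s Dp B(1) by (auto simp: R'_def)
      have "A \<inter> frontier ((+) l ` Ob i) = {}"
      proof (rule ccontr)
        assume "A \<inter> frontier ((+) l ` Ob i) \<noteq> {}"
        then obtain s' where s': "0 < s'" "s' \<le> R - 2 * B" "q + s' *\<^sub>R v \<in> frontier ((+) l ` Ob i)" by (auto simp: A_def)
        then have "q + s' *\<^sub>R v - l \<in> frontier (Ob i)" by (auto simp: frontier_translation)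
        then have "s' \<in> S" using s'(1) i l by (auto simp: S_def)
        then show False using noS s'(2) big by auto
      qed
      moreover have "A \<inter> (+) l ` Ob i \<noteq> {}" using sA z by (auto simp: A_def intro!: image_eqI[of _ _ s])
      ultimately have sub: "A \<subseteq> (+) l ` Ob i"
        using connected_Int_frontier[OF \<open>connected A\<close>, of "(+) l ` Ob i"] unfolding Diff_eq_empty_iff[symmetric] by metis
      have m: "norm (q + s *\<^sub>R v - l) \<le> B" if "s \<in> {0<..R - 2 * B}" for s
      proof -
        have "q + s *\<^sub>R v \<in> (+) l ` Ob i" using sub that unfolding A_def by blast
        then have "q + s *\<^sub>R v - l \<in> Ob i" by auto
        then show ?thesis using B(2)[OF i] closure_subset by blast
      qed
      define T where "T = R - 2 * B"
      have T: "4 * B < T" using big by (simp add: T_def)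
      have "norm (q + T *\<^sub>R v - l) \<le> B" "norm (q + (T / 4) *\<^sub>R v - l) \<le> B"
        using m[of T] m[of "T / 4"] T B(1) by (auto simp: T_def)
      then have "norm ((q + T *\<^sub>R v - l) - (q + (T / 4) *\<^sub>R v - l)) \<le> B + B"
        using norm_triangle_ineq4[of "q + T *\<^sub>R v - l" "q + (T / 4) *\<^sub>R v - l"] by linarith
      moreover have "(q + T *\<^sub>R v - l) - (q + (T / 4) *\<^sub>R v - l) = (3 * T / 4) *\<^sub>R v"
        by (simp add: algebra_simps scaleR_diff_left[symmetric])
      ultimately show False using v T B(1) by simp
    qed
  qed
qed

text \<open>If \<open>cross2 v (z - q)\<close> took the value \<open>- cross2 v w\<close> at a point
  \<open>z\<close> of the obstacle, then \<open>w + z\<close> would lie on the ray at a time in (0,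
  R]. A connected set of values that misses a number stays on one side of it.\<close>

lemma one_sided:
  assumes D: "\<And>j z. j \<in> J \<Longrightarrow> z \<in> closure (Ob j) \<Longrightarrow> norm z \<le> D"
    and j: "j \<in> J" and q: "q \<in> frontier (Ob j)" and v: "norm v = 1" and free: "(q, v) \<in> free_set R"
    and w: "w \<in> lattice" "2 * D < v \<bullet> w" "v \<bullet> w + 2 * D \<le> R"
  shows "(\<forall>z\<in>closure (Ob j). cross2 v (z - q) \<le> \<bar>cross2 v w\<bar>) \<or>
         (\<forall>z\<in>closure (Ob j). - cross2 v (z - q) \<le> \<bar>cross2 v w\<bar>)"
proof -
  define \<delta> where "\<delta> = cross2 v w"
  have miss: "cross2 v (z - q) \<noteq> - \<delta>" if z: "z \<in> Ob j" for z
  proof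
    assume eq: "cross2 v (z - q) = - \<delta>"
    define s where "s = v \<bullet> (z - q) + v \<bullet> w"
    have "\<bar>v \<bullet> (z - q)\<bar> \<le> norm (z - q)" using Cauchy_Schwarz_ineq2[of v "z - q"] v by simp
    also have "\<dots> \<le> norm z + norm q" by (rule norm_triangle_ineq4)
    also have "\<dots> \<le> D + D"
      using D[OF j subsetD[OF closure_subset z]] D[OF j frontier_closure[OF q]] by (rule add_mono)
    finally have s: "0 < s" "s \<le> R" using w(2,3) by (auto simp: s_def)
    have "w + (z - q) = s *\<^sub>R v"
      using frame_expansion[OF v, of "w + (z - q)"] eq
      by (simp add: cross2_linear(3) \<delta>_def s_def inner_add_right add.commute)
    then have "q + s *\<^sub>R v = w + z" by (simp add: algebra_simps)
    then have "q + s *\<^sub>R v \<in> (+) w ` Ob j" using z by simp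
    moreover have "q + s *\<^sub>R v \<notin> (+) w ` Ob j" using free s j w(1) by (simp add: free_set_def)
    ultimately show False by blast
  qed
  define h where "h z = cross2 v (z - q)" for z
  have cont: "continuous_on UNIV h" unfolding h_def cross2_eq_inner by (intro continuous_intros)
  have "connected (h ` Ob j)"
    by (intro connected_continuous_image continuous_on_subset[OF cont] convex_connected obstacles j) auto
  moreover have "- \<delta> \<notin> h ` Ob j"
  proof
    assume "- \<delta> \<in> h ` Ob j"
    then obtain z where "z \<in> Ob j" "- \<delta> = h z" by (rule imageE)
    then show False using miss[of z] by (simp add: h_def)
  qed
  ultimately have "\<not> (h x \<le> - \<delta> \<and> - \<delta> \<le> h y)" if "x \<in> Ob j" "y \<in> Ob j" for x y
    using that connectedD_interval[of "h ` Ob j" "h x" "h y" "- \<delta>"] by blast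
  then have "(\<forall>z\<in>Ob j. h z \<le> - \<delta>) \<or> (\<forall>z\<in>Ob j. - \<delta> \<le> h z)"
    by (meson linear)
  then show ?thesis
  proof
    assume "\<forall>z\<in>Ob j. h z \<le> - \<delta>"
    then have "closure (Ob j) \<subseteq> {z. h z \<le> - \<delta>}"
      using cont by (intro closure_minimal closed_Collect_le) auto
    then show ?thesis by (force simp: h_def \<delta>_def)
  next
    assume "\<forall>z\<in>Ob j. - \<delta> \<le> h z"
    then have "closure (Ob j) \<subseteq> {z. - \<delta> \<le> h z}"
      using cont by (intro closure_minimal closed_Collect_le) auto
    then show ?thesis by (force simp: h_def \<delta>_def)
  qed
qed

end

lemma cross2_perp [simp]: "norm t = 1 \<Longrightarrow> cross2 (perp t) t = - 1"
  using norm_plane_sq[of t] by (simp add: cross2_def power2_eq_square algebra_simps)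

lemma cross2_frame_sq:
  assumes "norm t = 1"
  shows "(cross2 t w)\<^sup>2 + (cross2 (perp t) w)\<^sup>2 = (norm w)\<^sup>2"
proof -
  have "(cross2 t w)\<^sup>2 + (cross2 (perp t) w)\<^sup>2 = ((t $ 1)\<^sup>2 + (t $ 2)\<^sup>2) * ((w $ 1)\<^sup>2 + (w $ 2)\<^sup>2)"
    by (simp add: cross2_def power2_eq_square algebra_simps)
  then show ?thesis using assms norm_plane_sq[of t] norm_plane_sq[of w] by simp
qed

lemma cross2_has_derivative:
  assumes "(g has_vector_derivative g') (at x)"
  shows "((\<lambda>x. cross2 v (g x)) has_real_derivative cross2 v g') (at x)"
    and "((\<lambda>x. cross2 (g x) w) has_real_derivative cross2 g' w) (at x)"
proof -
  have "cross2 y w = perp (- w) \<bullet> y" for y by (simp add: cross2_def inner_plane)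
  then show "((\<lambda>x. cross2 (g x) w) has_real_derivative cross2 g' w) (at x)"
    unfolding has_real_derivative_iff_has_vector_derivative
    by (simp add: bounded_linear.has_vector_derivative[OF bounded_linear_inner_right assms])
  show "((\<lambda>x. cross2 v (g x)) has_real_derivative cross2 v g') (at x)"
    unfolding has_real_derivative_iff_has_vector_derivative cross2_eq_inner
    by (rule bounded_linear.has_vector_derivative[OF bounded_linear_inner_right assms])
qed

lemma continuous_of_vector_derivative:
  "(\<And>r. (g has_vector_derivative g' r) (at r)) \<Longrightarrow> continuous_on S g"
  by (meson has_vector_derivative_continuous continuous_at_imp_continuous_on)

lemma continuous_norm_bound:
  fixes g :: "real \<Rightarrow> plane"
  assumes "continuous_on UNIV g"
  obtains K where "1 \<le> K" "\<And>x. x \<in> {a..b} \<Longrightarrow> norm (g x) \<le> K"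
proof -
  have "compact (g ` {a..b})"
    by (intro compact_continuous_image continuous_on_subset[OF assms]) auto
  then have "bounded (g ` {a..b})" by (rule compact_imp_bounded)
  then obtain B where B: "\<forall>y\<in>g ` {a..b}. norm y \<le> B" unfolding bounded_iff by blast
  show ?thesis by (rule that[of "max 1 B"]) (use B in \<open>auto simp: le_max_iff_disj\<close>)
qed

section \<open>Starting points of long free segments on one obstacle\<close>

context billiard
begin

text \<open>Outgoing vector when the outer normal is \<open>e\<close> times the rotated tangent.
  Keeping the sign \<open>e\<close> as a parameter avoids fixing the orientation of the boundary
  curve.\<close>

definition direction :: "real \<Rightarrow> 'j \<Rightarrow> real \<Rightarrow> real \<Rightarrow> plane" where
  "direction e j r \<phi> = (e * cos \<phi>) *\<^sub>R perp (tangent j r) + sin \<phi> *\<^sub>R tangent j r"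

lemma norm_tangent: "j \<in> J \<Longrightarrow> norm (tangent j r) = 1"
  by (rule tangentE[of j]) auto

lemma direction_simps:
  assumes j: "j \<in> J" and e: "e = 1 \<or> e = - 1"
  shows "norm (direction e j r \<phi>) = 1" "\<bar>cross2 (direction e j r \<phi>) (tangent j r)\<bar> = \<bar>cos \<phi>\<bar>"
proof -
  let ?t = "tangent j r"
  have t: "norm ?t = 1" by (rule norm_tangent[OF j])
  have "(norm (direction e j r \<phi>))\<^sup>2 = (e\<^sup>2 * (cos \<phi>)\<^sup>2 + (sin \<phi>)\<^sup>2) * ((?t $ 1)\<^sup>2 + (?t $ 2)\<^sup>2)"
    unfolding norm_plane_sq by (simp add: direction_def power2_eq_square algebra_simps)
  also have "\<dots> = 1" using e t norm_plane_sq[of ?t] by auto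
  finally show "norm (direction e j r \<phi>) = 1" by (simp add: power2_eq_1_iff) (use norm_ge_zero[of "direction e j r \<phi>"] in linarith)
  show "\<bar>cross2 (direction e j r \<phi>) ?t\<bar> = \<bar>cos \<phi>\<bar>"
    using e t by (auto simp: direction_def cross2_linear(2) cross2_linear(7))
qed

text \<open>The obstacle rises above the line through the starting point along \<open>v\<close> by
  at most |cross2 v w| = O(1/R), while its boundary crosses that line with slope |cos \<phi>|; so
  cos \<phi> = O(R^(-1/2)). Expanding the tangent in the frame of \<open>v\<close> then shows it to
  be equally close to the direction of \<open>w\<close>.\<close>

lemma collision_estimate:
  assumes j: "j \<in> J"
  obtains W C R0 where "finite W" "\<And>w. w \<in> W \<Longrightarrow> 1 \<le> norm w" "0 < C" "1 \<le> R0"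
    "\<And>R r \<phi> e. R0 \<le> R \<Longrightarrow> r \<in> {0..len j} \<Longrightarrow> e = 1 \<or> e = - 1 \<Longrightarrow> (c j r, direction e j r \<phi>) \<in> free_set R \<Longrightarrow>
       \<exists>w\<in>W. \<bar>cross2 (direction e j r \<phi>) w\<bar> \<le> C / R \<and> \<bar>cos \<phi>\<bar> \<le> C / sqrt R \<and> \<bar>cross2 (tangent j r) w\<bar> \<le> C / sqrt R"
proof -
  obtain D where D: "1 \<le> D" "\<And>j z. j \<in> J \<Longrightarrow> z \<in> closure (Ob j) \<Longrightarrow> norm z \<le> D"
    using diameter by blast
  obtain c2 c3 where d: "\<And>r. (c j has_vector_derivative tangent j r) (at r)"
    "\<And>r. (tangent j has_vector_derivative c2 r) (at r)" "\<And>r. (c2 has_vector_derivative c3 r) (at r)"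
    by (rule tangentE[OF j]) blast
  \<comment> \<open>The interval is widened by 1 on both sides because
    \<open>tangent_height_bound\<close> looks at [r - 1, r + 1].\<close>
  obtain K where K: "1 \<le> K" "\<And>x. x \<in> {- 1..len j + 1} \<Longrightarrow> norm (c2 x) \<le> K"
    by (rule continuous_norm_bound[OF continuous_of_vector_derivative[OF d(3)]]) blast
  obtain z0 \<rho> where z0: "0 < \<rho>" "ball z0 \<rho> \<subseteq> Ob j"
    using obstacle_nonempty[OF j] obstacles(3)[OF j] open_contains_ball by (metis ex_in_conv)
  \<comment> \<open>A segment avoiding the translates of the obstacle avoids those of an inscribed
    disc. The length 2 D + 1 is what \<open>one_sided\<close> asks of v . w.\<close>
  obtain W0 C0 where W0: "finite W0" "W0 \<subseteq> lattice" "0 < C0"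
    "\<And>R x v. 6 \<le> R \<Longrightarrow> norm v = 1 \<Longrightarrow> (\<And>s l. 0 < s \<Longrightarrow> s \<le> R \<Longrightarrow> l \<in> lattice \<Longrightarrow> x + s *\<^sub>R v \<notin> ball (l + z0) \<rho>) \<Longrightarrow>
       \<exists>w\<in>W0. 2 * D + 1 \<le> v \<bullet> w \<and> \<bar>cross2 v w\<bar> \<le> C0 / R"
    by (rule free_directions[OF z0(1)]) blast
  obtain M where M: "\<And>w. w \<in> W0 \<Longrightarrow> norm w \<le> M" "0 \<le> M"
    using finite_imp_bounded[OF W0(1)] by (metis bounded_pos less_imp_le)
  define B where "B = sqrt (2 * K * C0)"
  have B: "0 \<le> B" using K W0(3) by (simp add: B_def)
  define C where "C = C0 + B * (M + 1)"
  have "C = C0 + B * M + B" "0 \<le> B * M" using B M(2) by (auto simp: C_def algebra_simps)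
  then have C: "0 < C" "C0 \<le> C" "B \<le> C" using B W0(3) by linarith+
  show ?thesis
  proof (rule that[of "{w \<in> W0. 1 \<le> norm w}" C "M + 2 * D + 6"])
    show "finite {w \<in> W0. 1 \<le> norm w}" "\<And>w. w \<in> {w \<in> W0. 1 \<le> norm w} \<Longrightarrow> 1 \<le> norm w" "0 < C" "1 \<le> M + 2 * D + 6"
      using W0(1) C M(2) D(1) by auto
    fix R r \<phi> e assume R: "M + 2 * D + 6 \<le> R" and r: "r \<in> {0..len j}" and e: "e = 1 \<or> e = - 1"
      and free: "(c j r, direction e j r \<phi>) \<in> free_set R"
    define v where "v = direction e j r \<phi>"
    note v = direction_simps[OF j e, of r \<phi>, folded v_def]
    have Rp: "1 \<le> R" using R M(2) D(1) by simp
    then have "1 \<le> sqrt R" "0 < sqrt R" by auto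
    then have "sqrt R * 1 \<le> sqrt R * sqrt R" by (intro mult_left_mono) auto
    then have "sqrt R \<le> R" using Rp by simp
    then have sR: "0 < sqrt R" "1 / R \<le> 1 / sqrt R"
      using \<open>0 < sqrt R\<close> Rp by (auto intro!: divide_left_mono)
    have "\<exists>w\<in>W0. 2 * D + 1 \<le> v \<bullet> w \<and> \<bar>cross2 v w\<bar> \<le> C0 / R"
    proof (rule W0(4))
      show "6 \<le> R" using R M(2) D(1) by simp
      fix s l assume s: "0 < s" "s \<le> R" "l \<in> lattice"
      then have "c j r + s *\<^sub>R v \<notin> (+) l ` Ob j" using free j by (simp add: free_set_def v_def)
      moreover have "y \<in> (+) l ` Ob j" if "y \<in> ball (l + z0) \<rho>" for y
      proof -
        have "y - l \<in> ball z0 \<rho>" using that by (simp add: dist_norm diff_diff_eq2 add.commute)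
        then have "y - l \<in> Ob j" using z0(2) by blast
        then show ?thesis by (intro image_eqI[of _ _ "y - l"]) auto
      qed
      ultimately show "c j r + s *\<^sub>R v \<notin> ball (l + z0) \<rho>" by blast
    qed (rule v(1))
    then obtain w where w: "w \<in> W0" "2 * D + 1 \<le> v \<bullet> w" "\<bar>cross2 v w\<bar> \<le> C0 / R" by blast
    have "v \<bullet> w \<le> norm w" using Cauchy_Schwarz_ineq2[of v w] v(1) by simp
    then have vw: "v \<bullet> w \<le> M" "1 \<le> norm w" using M(1)[OF w(1)] w(2) D(1) by auto
    have "(\<forall>z\<in>closure (Ob j). cross2 v (z - c j r) \<le> \<bar>cross2 v w\<bar>) \<or>
         (\<forall>z\<in>closure (Ob j). - cross2 v (z - c j r) \<le> \<bar>cross2 v w\<bar>)"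
      using free w vw R W0(2) unfolding v_def[symmetric]
      by (intro one_sided[OF D(2) j boundary_point[OF j] v(1)]) auto
    then obtain a where a: "\<bar>a\<bar> = 1" "\<And>z. z \<in> closure (Ob j) \<Longrightarrow> a * cross2 v (z - c j r) \<le> \<bar>cross2 v w\<bar>"
      by (metis abs_1 abs_minus_cancel mult_1 mult_minus_left)
    have "(a * cross2 v (tangent j r))\<^sup>2 \<le> 2 * K * \<bar>cross2 v w\<bar>"
    proof (rule tangent_height_bound[where g = "\<lambda>x. a * cross2 v (c j x - c j r)"
          and ?g1.0 = "\<lambda>x. a * cross2 v (tangent j x)" and ?g2.0 = "\<lambda>x. a * cross2 v (c2 x)" and r = r])
      show "((\<lambda>x. a * cross2 v (c j x - c j r)) has_real_derivative a * cross2 v (tangent j x)) (at x)" for x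
        using cross2_has_derivative(1)[OF d(1)[of x], of v]
        by (auto simp: cross2_linear intro!: derivative_eq_intros)
      show "((\<lambda>x. a * cross2 v (tangent j x)) has_real_derivative a * cross2 v (c2 x)) (at x)" for x
        using cross2_has_derivative(1)[OF d(2)[of x], of v] by (auto intro!: derivative_eq_intros)
      show "\<bar>a * cross2 v (c2 x)\<bar> \<le> K" if "x \<in> {r - 1..r + 1}" for x
      proof -
        have "x \<in> {- 1..len j + 1}" using that r by auto
        from K(2)[OF this] show ?thesis using abs_cross2_le[of v "c2 x"] v(1) a(1) by (simp add: abs_mult)
      qed
      show "\<bar>a * cross2 v (tangent j r)\<bar> \<le> 1" using a(1) v(2) by (simp add: abs_mult)
      show "a * cross2 v (c j x - c j r) \<le> \<bar>cross2 v w\<bar>" for x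
        by (rule a(2)) (rule frontier_closure[OF boundary_point[OF j]])
    qed (use K in \<open>auto simp: cross2_def\<close>)
    also have "(a * cross2 v (tangent j r))\<^sup>2 = (cos \<phi>)\<^sup>2"
      using a(1) v(2) by (metis abs_mult mult_1 power2_abs)
    also have "2 * K * \<bar>cross2 v w\<bar> \<le> 2 * K * (C0 / R)" using w(3) K by (intro mult_left_mono) auto
    finally have "(cos \<phi>)\<^sup>2 \<le> 2 * K * C0 / R" by simp
    then have "sqrt ((cos \<phi>)\<^sup>2) \<le> sqrt (2 * K * C0 / R)" by (rule real_sqrt_le_mono)
    then have cos: "\<bar>cos \<phi>\<bar> \<le> B / sqrt R" by (simp add: B_def real_sqrt_divide)
    have "cross2 (tangent j r) w = (v \<bullet> tangent j r) * cross2 v w + cross2 v (tangent j r) * cross2 (perp v) w"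
      using arg_cong[OF frame_expansion[OF v(1), of "tangent j r"], of "\<lambda>z. cross2 z w"] by (simp only: cross2_linear(2))
    then have "\<bar>cross2 (tangent j r) w\<bar> \<le> \<bar>v \<bullet> tangent j r\<bar> * \<bar>cross2 v w\<bar> + \<bar>cos \<phi>\<bar> * \<bar>cross2 (perp v) w\<bar>"
      using abs_triangle_ineq[of "(v \<bullet> tangent j r) * cross2 v w" "cross2 v (tangent j r) * cross2 (perp v) w"] v(2)
      by (simp add: abs_mult)
    also have "\<dots> \<le> 1 * (C0 / R) + (B / sqrt R) * M"
      using Cauchy_Schwarz_ineq2[of v "tangent j r"] v(1) norm_tangent[OF j, of r] w(3) cos
        abs_cross2_le[of "perp v" w] M(1)[OF w(1)] B sR by (intro add_mono mult_mono) auto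
    also have "1 * (C0 / R) \<le> C0 / sqrt R" using mult_left_mono[OF sR(2), of C0] W0(3) by simp
    also have "C0 / sqrt R + (B / sqrt R) * M \<le> C / sqrt R"
      using B sR by (simp add: C_def add_divide_distrib[symmetric] divide_right_mono algebra_simps)
    finally have "\<bar>cross2 (tangent j r) w\<bar> \<le> C / sqrt R" by simp
    moreover have "\<bar>cos \<phi>\<bar> \<le> C / sqrt R"
      using cos divide_right_mono[OF C(3), of "sqrt R"] sR by linarith
    moreover have "\<bar>cross2 v w\<bar> \<le> C / R"
      using w(3) divide_right_mono[OF C(2), of R] Rp by linarith
    ultimately show "\<exists>w\<in>{w \<in> W0. 1 \<le> norm w}. \<bar>cross2 (direction e j r \<phi>) w\<bar> \<le> C / R \<and>
        \<bar>cos \<phi>\<bar> \<le> C / sqrt R \<and> \<bar>cross2 (tangent j r) w\<bar> \<le> C / sqrt R"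
      using w(1) vw(2) by (auto simp: v_def)
  qed
qed

text \<open>In \<phi> the transversal component is A cos \<phi> + B sin \<phi> with A^2 + B^2 =
  |w|^2, so g^2 + g'^2 = |w|^2 \<ge> 1. Neither this bound nor that on g'' involves \<open>r\<close>
  or \<open>e\<close>, so the constant is uniform in them.\<close>

lemma angle_sublevel:
  assumes j: "j \<in> J" and w: "1 \<le> norm w"
  obtains C where "0 < C" "\<And>e r \<eta>. e = 1 \<or> e = - 1 \<Longrightarrow> 0 \<le> \<eta> \<Longrightarrow>
    emeasure lborel {\<phi> \<in> {- (pi / 2)..pi / 2}. \<bar>cross2 (direction e j r \<phi>) w\<bar> \<le> \<eta>} \<le> ennreal (C * \<eta>)"
proof -
  obtain C where C: "0 < C" "\<And>g g1 g2 e. (\<And>x. (g has_real_derivative g1 x) (at x)) \<Longrightarrow>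
      (\<And>x. (g1 has_real_derivative g2 x) (at x)) \<Longrightarrow> (\<And>x. x \<in> {- (pi / 2)..pi / 2} \<Longrightarrow> \<bar>g2 x\<bar> \<le> norm w) \<Longrightarrow>
      (\<And>x. x \<in> {- (pi / 2)..pi / 2} \<Longrightarrow> 1\<^sup>2 \<le> (g x)\<^sup>2 + (g1 x)\<^sup>2) \<Longrightarrow> 0 \<le> e \<Longrightarrow>
      emeasure lborel {x \<in> {- (pi / 2)..pi / 2}. \<bar>g x\<bar> \<le> e} \<le> ennreal (C * e)"
    by (rule sublevel_measure[of 1 "norm w" "- (pi / 2)" "pi / 2"]) (use w in auto)
  show ?thesis
  proof (rule that[OF C(1)])
    fix e r \<eta> :: real assume e: "e = 1 \<or> e = - 1" and \<eta>: "0 \<le> \<eta>"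
    define A where "A = e * cross2 (perp (tangent j r)) w"
    define B where "B = cross2 (tangent j r) w"
    have AB: "A\<^sup>2 + B\<^sup>2 = (norm w)\<^sup>2"
      using cross2_frame_sq[OF norm_tangent[OF j, of r], of w] e by (auto simp: A_def B_def)
    have g: "cross2 (direction e j r \<phi>) w = cos \<phi> * A + sin \<phi> * B" for \<phi>
      by (simp add: direction_def cross2_linear(2) A_def B_def)
    have sum: "(cos x * A + sin x * B)\<^sup>2 + (- sin x * A + cos x * B)\<^sup>2 = (norm w)\<^sup>2" for x
    proof -
      have "(cos x * A + sin x * B)\<^sup>2 + (- sin x * A + cos x * B)\<^sup>2 = ((sin x)\<^sup>2 + (cos x)\<^sup>2) * (A\<^sup>2 + B\<^sup>2)"
        by algebra
      then show ?thesis by (simp add: AB)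
    qed
    show "emeasure lborel {\<phi> \<in> {- (pi / 2)..pi / 2}. \<bar>cross2 (direction e j r \<phi>) w\<bar> \<le> \<eta>} \<le> ennreal (C * \<eta>)"
      unfolding g
    proof (rule C(2)[OF _ _ _ _ \<eta>])
      show "((\<lambda>x. cos x * A + sin x * B) has_real_derivative - sin x * A + cos x * B) (at x)" for x
        by (auto intro!: derivative_eq_intros)
      show "((\<lambda>x. - sin x * A + cos x * B) has_real_derivative - (cos x * A + sin x * B)) (at x)" for x
        by (auto intro!: derivative_eq_intros)
      show "\<bar>- (cos x * A + sin x * B)\<bar> \<le> norm w" for x
      proof -
        have "(cos x * A + sin x * B)\<^sup>2 \<le> (norm w)\<^sup>2"
          using sum[of x] zero_le_power2[of "- sin x * A + cos x * B"] by linarith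
        then show ?thesis using abs_le_square_iff[of "cos x * A + sin x * B" "norm w"] by simp
      qed
      show "1\<^sup>2 \<le> (cos x * A + sin x * B)\<^sup>2 + (- sin x * A + cos x * B)\<^sup>2" for x
        unfolding sum using w by (intro power_mono) auto
    qed
  qed
qed

text \<open>Here the nonzero curvature enters: the derivative of the unit tangent is b times its
  rotation, with |b| bounded below by compactness. So the components of \<open>w\<close> across the
  tangent and along it cannot both be small, and g, g' do not vanish together; the third derivative
  bounds g''.\<close>

lemma tangent_sublevel:
  assumes j: "j \<in> J" and w: "1 \<le> norm w"
  obtains C where "0 < C" "\<And>\<eta>. 0 \<le> \<eta> \<Longrightarrow>
    emeasure lborel {r \<in> {0..len j}. \<bar>cross2 (tangent j r) w\<bar> \<le> \<eta>} \<le> ennreal (C * \<eta>)"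
proof -
  obtain c2 c3 where d: "\<And>r. (tangent j has_vector_derivative c2 r) (at r)" "\<And>r. (c2 has_vector_derivative c3 r) (at r)"
    and c3: "continuous_on UNIV c3" and c2: "\<And>r. c2 r \<noteq> 0" and len: "0 < len j"
    by (rule tangentE[OF j]) blast
  obtain K where K: "1 \<le> K" "\<And>x. x \<in> {0..len j} \<Longrightarrow> norm (c3 x) \<le> K"
    by (rule continuous_norm_bound[OF c3]) blast
  have "continuous_on {0..len j} (\<lambda>r. norm (c2 r))"
    using continuous_of_vector_derivative[OF d(2)] by (intro continuous_intros)
  then obtain r0 where r0: "r0 \<in> {0..len j}" "\<And>r. r \<in> {0..len j} \<Longrightarrow> norm (c2 r0) \<le> norm (c2 r)"
    using continuous_attains_inf[of "{0..len j}" "\<lambda>r. norm (c2 r)"] len by auto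
  \<comment> \<open>Capping at 1 lets m^2 weigh both squares in the identity for |w|^2.\<close>
  define m where "m = min 1 (norm (c2 r0))"
  have m: "0 < m" "m \<le> 1" "m \<le> norm (c2 r0)" using c2 by (auto simp: m_def)
  have Kw: "0 < K * norm w" using K w by (intro mult_pos_pos) auto
  obtain C where C: "0 < C" "\<And>g g1 g2 e. (\<And>x. (g has_real_derivative g1 x) (at x)) \<Longrightarrow>
      (\<And>x. (g1 has_real_derivative g2 x) (at x)) \<Longrightarrow> (\<And>x. x \<in> {0..len j} \<Longrightarrow> \<bar>g2 x\<bar> \<le> K * norm w) \<Longrightarrow>
      (\<And>x. x \<in> {0..len j} \<Longrightarrow> m\<^sup>2 \<le> (g x)\<^sup>2 + (g1 x)\<^sup>2) \<Longrightarrow> 0 \<le> e \<Longrightarrow>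
      emeasure lborel {x \<in> {0..len j}. \<bar>g x\<bar> \<le> e} \<le> ennreal (C * e)"
    by (rule sublevel_measure[OF m(1) Kw, of 0 "len j"]) (use len in auto)
  show ?thesis
  proof (rule that[OF C(1)], rule C(2)[OF cross2_has_derivative(2)[OF d(1)] cross2_has_derivative(2)[OF d(2)]])
    fix x assume x: "x \<in> {0..len j}"
    show "\<bar>cross2 (c3 x) w\<bar> \<le> K * norm w"
      using abs_cross2_le[of "c3 x" w] mult_right_mono[OF K(2)[OF x], of "norm w"] by simp
    let ?t = "tangent j x"
    have t: "norm ?t = 1" by (rule norm_tangent[OF j])
    have "((\<lambda>x. tangent j x \<bullet> tangent j x) has_vector_derivative ?t \<bullet> c2 x + c2 x \<bullet> ?t) (at x)"
      by (rule bounded_bilinear.has_vector_derivative[OF bounded_bilinear_inner d(1) d(1)])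
    moreover have "(\<lambda>x. tangent j x \<bullet> tangent j x) = (\<lambda>_. 1)"
      using norm_tangent[OF j] by (simp add: norm_eq_1)
    ultimately have "?t \<bullet> c2 x + c2 x \<bullet> ?t = 0"
      using vector_derivative_unique_at[of "\<lambda>_. 1 :: real" _ x 0] by auto
    then have "?t \<bullet> c2 x = 0" by (simp add: inner_commute)
    then have eq: "c2 x = cross2 ?t (c2 x) *\<^sub>R perp ?t" using frame_expansion[OF t, of "c2 x"] by simp
    define b where "b = cross2 ?t (c2 x)"
    have b: "norm (c2 x) = \<bar>b\<bar>" using eq t unfolding b_def by (metis norm_scaleR perp_simps(3) mult.right_neutral)
    have "cross2 (c2 x) w = b * cross2 (perp ?t) w"
      using arg_cong[OF eq, of "\<lambda>z. cross2 z w"] cross2_linear(2)[of b "perp ?t" 0 0 w] by (simp add: b_def)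
    moreover have "m\<^sup>2 \<le> b\<^sup>2" using m r0(2)[OF x] b by (simp add: abs_le_square_iff[symmetric])
    then have "m\<^sup>2 * (cross2 (perp ?t) w)\<^sup>2 \<le> b\<^sup>2 * (cross2 (perp ?t) w)\<^sup>2" by (rule mult_right_mono) simp
    moreover have "m\<^sup>2 * (cross2 ?t w)\<^sup>2 \<le> 1 * (cross2 ?t w)\<^sup>2"
      using m by (intro mult_right_mono) (auto simp: power_le_one)
    moreover have "m\<^sup>2 * 1 \<le> m\<^sup>2 * (norm w)\<^sup>2" using w by (intro mult_left_mono) auto
    moreover have "m\<^sup>2 * (norm w)\<^sup>2 = m\<^sup>2 * (cross2 ?t w)\<^sup>2 + m\<^sup>2 * (cross2 (perp ?t) w)\<^sup>2"
      unfolding cross2_frame_sq[OF t, symmetric] by (simp add: algebra_simps)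
    ultimately show "m\<^sup>2 \<le> (cross2 ?t w)\<^sup>2 + (cross2 (c2 x) w)\<^sup>2"
      by (simp add: power_mult_distrib)
  qed
qed


section \<open>The tail of the billiard measure\<close>

definition collision :: "'j \<Rightarrow> real \<times> real \<Rightarrow> phase" where
  "collision j = (\<lambda>(r, \<phi>). (c j r, cos \<phi> *\<^sub>R outer_normal (Ob j) (c j r) + sin \<phi> *\<^sub>R vector_derivative (c j) (at r)))"

lemma continuous_boundary:
  assumes "j \<in> J"
  shows "continuous_on UNIV (c j)" "continuous_on UNIV (tangent j)"
  by (rule tangentE[OF assms], rule continuous_of_vector_derivative, assumption)+

lemma continuous_perp:
  assumes "continuous_on S g"
  shows "continuous_on S (\<lambda>x. perp (g x))"
proof -
  have "perp v = (- (v $ 2)) *\<^sub>R axis 1 1 + (v $ 1) *\<^sub>R axis 2 1" for v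
    by (simp add: vec_eq_iff forall_2 axis_def)
  then show ?thesis using assms by (simp only:) (intro continuous_intros)
qed

lemma collision_measurable:
  assumes j: "j \<in> J"
  shows "collision j \<in> borel_measurable (lborel \<Otimes>\<^sub>M lborel)"
proof -
  obtain z0 where z0: "z0 \<in> Ob j" using obstacle_nonempty[OF j] by blast
  note c = continuous_boundary[OF j]
  have [measurable]: "c j \<in> borel_measurable borel" "tangent j \<in> borel_measurable borel"
    "(\<lambda>r. perp (tangent j r)) \<in> borel_measurable borel"
    using c continuous_perp by (auto intro!: borel_measurable_continuous_onI)
  have "collision j = (\<lambda>z. (c j (fst z), cos (snd z) *\<^sub>R
     (if perp (tangent j (fst z)) \<bullet> (z0 - c j (fst z)) < 0 then perp (tangent j (fst z)) else - perp (tangent j (fst z)))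
     + sin (snd z) *\<^sub>R tangent j (fst z)))"
    by (auto simp: collision_def fun_eq_iff outer_normal_eq[OF j z0] tangent_def)
  also have "\<dots> \<in> borel_measurable (lborel \<Otimes>\<^sub>M lborel)"
    unfolding borel_prod[symmetric] by measurable
  finally show ?thesis .
qed

lemma collision_direction:
  assumes j: "j \<in> J"
  obtains e where "e = 1 \<or> e = - 1" "collision j (r, \<phi>) = (c j r, direction e j r \<phi>)"
  using outer_normal_perp[OF j, of r]
proof
  assume "outer_normal (Ob j) (c j r) = perp (tangent j r)"
  then show ?thesis by (intro that[of 1]) (auto simp: collision_def direction_def tangent_def)
next
  assume "outer_normal (Ob j) (c j r) = - perp (tangent j r)"
  then show ?thesis by (intro that[of "- 1"]) (auto simp: collision_def direction_def tangent_def)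
qed

text \<open>Unnormalised contribution of one obstacle; the total mass is divided out when the
  obstacles are summed.\<close>

definition long_flight_mass :: "'j \<Rightarrow> real \<Rightarrow> ennreal" where
  "long_flight_mass j R = (\<integral>\<^sup>+z. ennreal (cos (snd z)) * indicator ({0..<len j} \<times> {- (pi / 2)..pi / 2}) z *
    indicator (free_set R) (collision j z) \<partial>(lborel \<Otimes>\<^sub>M lborel))"

text \<open>Three factors: the density cos \<phi> is O(R^(-1/2)), for fixed \<open>r\<close> the
  angles have length O(1/R), and the admissible \<open>r\<close> have length O(R^(-1/2)). Their
  product is O(R^(-2)).\<close>

lemma obstacle_tail:
  assumes j: "j \<in> J"
  shows "\<exists>C R0. 0 \<le> C \<and> 1 \<le> R0 \<and> (\<forall>R\<ge>R0. long_flight_mass j R \<le> ennreal (C / R\<^sup>2))"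
proof -
  obtain W C R0 where W: "finite W" "\<And>w. w \<in> W \<Longrightarrow> 1 \<le> norm w" and C: "0 < C" and R0: "1 \<le> R0"
    and est: "\<And>R r \<phi> e. R0 \<le> R \<Longrightarrow> r \<in> {0..len j} \<Longrightarrow> e = 1 \<or> e = - 1 \<Longrightarrow> (c j r, direction e j r \<phi>) \<in> free_set R \<Longrightarrow>
       \<exists>w\<in>W. \<bar>cross2 (direction e j r \<phi>) w\<bar> \<le> C / R \<and> \<bar>cos \<phi>\<bar> \<le> C / sqrt R \<and> \<bar>cross2 (tangent j r) w\<bar> \<le> C / sqrt R"
    by (rule collision_estimate[OF j]) blast
  have "\<forall>w\<in>W. \<exists>A>0. \<forall>e r \<eta>. e = 1 \<or> e = - 1 \<longrightarrow> 0 \<le> \<eta> \<longrightarrow>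
    emeasure lborel {\<phi> \<in> {- (pi / 2)..pi / 2}. \<bar>cross2 (direction e j r \<phi>) w\<bar> \<le> \<eta>} \<le> ennreal (A * \<eta>)"
  proof
    fix w assume "w \<in> W"
    show "\<exists>A>0. \<forall>e r \<eta>. e = 1 \<or> e = - 1 \<longrightarrow> 0 \<le> \<eta> \<longrightarrow>
      emeasure lborel {\<phi> \<in> {- (pi / 2)..pi / 2}. \<bar>cross2 (direction e j r \<phi>) w\<bar> \<le> \<eta>} \<le> ennreal (A * \<eta>)"
      by (rule angle_sublevel[OF j W(2)[OF \<open>w \<in> W\<close>]]) (intro exI conjI allI impI)
  qed
  from bchoice[OF this] obtain A where A': "\<forall>w\<in>W. 0 < A w \<and> (\<forall>e r \<eta>. e = 1 \<or> e = - 1 \<longrightarrow> 0 \<le> \<eta> \<longrightarrow>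
    emeasure lborel {\<phi> \<in> {- (pi / 2)..pi / 2}. \<bar>cross2 (direction e j r \<phi>) w\<bar> \<le> \<eta>} \<le> ennreal (A w * \<eta>))" by (rule exE)
  note A = A'[THEN bspec, THEN conjunct1] A'[THEN bspec, THEN conjunct2, rule_format]
  have "\<forall>w\<in>W. \<exists>B>0. \<forall>\<eta>. 0 \<le> \<eta> \<longrightarrow>
    emeasure lborel {r \<in> {0..len j}. \<bar>cross2 (tangent j r) w\<bar> \<le> \<eta>} \<le> ennreal (B * \<eta>)"
  proof
    fix w assume "w \<in> W"
    show "\<exists>B>0. \<forall>\<eta>. 0 \<le> \<eta> \<longrightarrow>
      emeasure lborel {r \<in> {0..len j}. \<bar>cross2 (tangent j r) w\<bar> \<le> \<eta>} \<le> ennreal (B * \<eta>)"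
      by (rule tangent_sublevel[OF j W(2)[OF \<open>w \<in> W\<close>]]) (intro exI conjI allI impI)
  qed
  from bchoice[OF this] obtain B where B': "\<forall>w\<in>W. 0 < B w \<and> (\<forall>\<eta>. 0 \<le> \<eta> \<longrightarrow>
    emeasure lborel {r \<in> {0..len j}. \<bar>cross2 (tangent j r) w\<bar> \<le> \<eta>} \<le> ennreal (B w * \<eta>))" by (rule exE)
  note B = B'[THEN bspec, THEN conjunct1] B'[THEN bspec, THEN conjunct2, rule_format]
  \<comment> \<open>The sign of the normal at \<open>r\<close> is not controlled, so both signs are
    summed over.\<close>
  define I where "I = W \<times> {1, - 1 :: real}"
  have I: "finite I" using W(1) by (simp add: I_def)
  define C' where "C' = (\<Sum>i\<in>I. C * (A (fst i) * C * (B (fst i) * C)))"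
  have C': "0 \<le> C'" unfolding C'_def
    using A(1) B(1) C by (intro sum_nonneg) (auto simp: I_def intro!: mult_nonneg_nonneg less_imp_le)
  show ?thesis
  proof (rule exI[of _ C'], rule exI[of _ R0], intro conjI allI impI C' R0)
    fix R assume R: "R0 \<le> R"
    then have Rp: "0 < R" "0 < sqrt R" "sqrt R * sqrt R = R" using R0 by auto
    define S where "S i = {z \<in> {0..len j} \<times> {- (pi / 2)..pi / 2}. \<bar>cross2 (tangent j (fst z)) (fst i)\<bar> \<le> C / sqrt R \<and>
        \<bar>cross2 (direction (snd i) j (fst z) (snd z)) (fst i)\<bar> \<le> C / R}" for i :: "plane \<times> real"
    have Sm: "S i \<in> sets (lborel \<Otimes>\<^sub>M lborel)" for i
    proof -
      have c1: "continuous_on UNIV (\<lambda>z::real \<times> real. tangent j (fst z))"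
        by (rule continuous_on_compose2[OF continuous_boundary(2)[OF j]]) (auto intro!: continuous_intros)
      have c2: "continuous_on UNIV (\<lambda>z::real \<times> real. cross2 (tangent j (fst z)) (fst i))"
        unfolding cross2_eq_inner by (intro continuous_intros continuous_perp c1)
      have c3: "continuous_on UNIV (\<lambda>z::real \<times> real. cross2 (direction (snd i) j (fst z) (snd z)) (fst i))"
        unfolding cross2_eq_inner direction_def by (intro continuous_intros continuous_perp c1)
      have "closed (({0..len j} \<times> {- (pi / 2)..pi / 2}) \<inter> {z. \<bar>cross2 (tangent j (fst z)) (fst i)\<bar> \<le> C / sqrt R} \<inter>
        {z. \<bar>cross2 (direction (snd i) j (fst z) (snd z)) (fst i)\<bar> \<le> C / R})"
        by (intro closed_Int closed_Times closed_Collect_le continuous_intros c2 c3)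
      also have "\<dots> = S i" by (auto simp: S_def)
      finally show ?thesis unfolding lborel_prod by simp
    qed
    have SM: "emeasure (lborel \<Otimes>\<^sub>M lborel) (S i) \<le> ennreal (A (fst i) * C * (B (fst i) * C) / (R * sqrt R))" if i: "i \<in> I" for i
    proof -
      have iW: "fst i \<in> W" "snd i = 1 \<or> snd i = - 1" using i by (auto simp: I_def)
      let ?T = "{r \<in> {0..len j}. \<bar>cross2 (tangent j r) (fst i)\<bar> \<le> C / sqrt R}"
      have "closed ({0..len j} \<inter> {r. \<bar>cross2 (tangent j r) (fst i)\<bar> \<le> C / sqrt R})"
        unfolding cross2_eq_inner
        by (intro closed_Int closed_Collect_le continuous_intros continuous_perp continuous_boundary(2)[OF j])
      also have "{0..len j} \<inter> {r. \<bar>cross2 (tangent j r) (fst i)\<bar> \<le> C / sqrt R} = ?T" by auto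
      finally have T: "?T \<in> sets lborel" by simp
      have "emeasure (lborel \<Otimes>\<^sub>M lborel) (S i) = (\<integral>\<^sup>+r. emeasure lborel (Pair r -` S i) \<partial>lborel)"
        by (rule lborel.emeasure_pair_measure_alt[OF Sm])
      also have "\<dots> \<le> (\<integral>\<^sup>+r. ennreal (A (fst i) * (C / R)) * indicator ?T r \<partial>lborel)"
      proof (rule nn_integral_mono)
        fix r
        show "emeasure lborel (Pair r -` S i) \<le> ennreal (A (fst i) * (C / R)) * indicator ?T r"
        proof (cases "r \<in> ?T")
          case True
          then have "Pair r -` S i = {\<phi> \<in> {- (pi / 2)..pi / 2}. \<bar>cross2 (direction (snd i) j r \<phi>) (fst i)\<bar> \<le> C / R}"
            by (auto simp: S_def)
          then show ?thesis using A(2)[OF iW, of "C / R" r] C Rp True by simp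
        next
          case False
          then have "Pair r -` S i = {}" by (auto simp: S_def)
          then show ?thesis by simp
        qed
      qed
      also have "\<dots> = ennreal (A (fst i) * (C / R)) * emeasure lborel ?T"
        by (rule nn_integral_cmult_indicator[OF T])
      also have "\<dots> \<le> ennreal (A (fst i) * (C / R)) * ennreal (B (fst i) * (C / sqrt R))"
        using B(2)[OF iW(1), of "C / sqrt R"] C Rp by (intro mult_left_mono) auto
      also have "\<dots> = ennreal (A (fst i) * C * (B (fst i) * C) / (R * sqrt R))"
        using A(1)[OF iW(1)] B(1)[OF iW(1)] C Rp by (subst ennreal_mult[symmetric]) auto
      finally show ?thesis .
    qed
    have "long_flight_mass j R
      \<le> (\<integral>\<^sup>+z. (\<Sum>i\<in>I. ennreal (C / sqrt R) * indicator (S i) z) \<partial>(lborel \<Otimes>\<^sub>M lborel))"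
      unfolding long_flight_mass_def
    proof (rule nn_integral_mono)
      fix z :: "real \<times> real"
      show "ennreal (cos (snd z)) * indicator ({0..<len j} \<times> {- (pi / 2)..pi / 2}) z * indicator (free_set R) (collision j z)
        \<le> (\<Sum>i\<in>I. ennreal (C / sqrt R) * indicator (S i) z)"
      proof (cases "z \<in> {0..<len j} \<times> {- (pi / 2)..pi / 2} \<and> collision j z \<in> free_set R")
        case True
        obtain r \<phi> where z: "z = (r, \<phi>)" by (cases z)
        obtain e where e: "e = 1 \<or> e = - 1" "collision j (r, \<phi>) = (c j r, direction e j r \<phi>)"
          by (rule collision_direction[OF j])
        have r: "r \<in> {0..len j}" "\<phi> \<in> {- (pi / 2)..pi / 2}" using True by (auto simp: z)
        have "(c j r, direction e j r \<phi>) \<in> free_set R" using True unfolding z e(2) by blast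
        from est[OF R r(1) e(1) this] obtain w where w: "w \<in> W" "\<bar>cross2 (direction e j r \<phi>) w\<bar> \<le> C / R"
          "\<bar>cos \<phi>\<bar> \<le> C / sqrt R" "\<bar>cross2 (tangent j r) w\<bar> \<le> C / sqrt R" by (elim bexE conjE)
        have wI: "(w, e) \<in> I" using w(1) e(1) by (auto simp: I_def)
        have zS: "z \<in> S (w, e)" using r w by (auto simp: S_def z)
        have "ennreal (cos (snd z)) \<le> ennreal (C / sqrt R)" using w(3) by (intro ennreal_leI) (simp add: z)
        also have "\<dots> = ennreal (C / sqrt R) * indicator (S (w, e)) z" using zS by simp
        also have "\<dots> \<le> (\<Sum>i\<in>I. ennreal (C / sqrt R) * indicator (S i) z)"
          by (rule member_le_sum[OF wI _ I]) simp
        finally show ?thesis using True by simp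
      qed auto
    qed
    also have "\<dots> = (\<Sum>i\<in>I. ennreal (C / sqrt R) * emeasure (lborel \<Otimes>\<^sub>M lborel) (S i))"
      using Sm by (subst nn_integral_sum) (auto simp: nn_integral_cmult_indicator)
    also have "\<dots> \<le> (\<Sum>i\<in>I. ennreal (C / sqrt R) * ennreal (A (fst i) * C * (B (fst i) * C) / (R * sqrt R)))"
      by (intro sum_mono mult_left_mono SM) auto
    also have "\<dots> = (\<Sum>i\<in>I. ennreal (C * (A (fst i) * C * (B (fst i) * C)) / R\<^sup>2))"
    proof (intro sum.cong refl)
      fix i assume i: "i \<in> I"
      then have p: "0 < A (fst i)" "0 < B (fst i)" using A(1) B(1) by (auto simp: I_def)
      have "sqrt R * (R * sqrt R) = R * (sqrt R * sqrt R)" by simp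
      also have "\<dots> = R\<^sup>2" using Rp(3) by (simp add: power2_eq_square)
      finally have sq: "sqrt R * (R * sqrt R) = R\<^sup>2" .
      show "ennreal (C / sqrt R) * ennreal (A (fst i) * C * (B (fst i) * C) / (R * sqrt R)) =
        ennreal (C * (A (fst i) * C * (B (fst i) * C)) / R\<^sup>2)"
        using p C Rp by (subst ennreal_mult[symmetric]) (auto simp: sq[symmetric])
    qed
    also have "\<dots> = ennreal (C' / R\<^sup>2)"
    proof -
      have "0 \<le> C * (A (fst i) * C * (B (fst i) * C)) / R\<^sup>2" if "i \<in> I" for i
      proof -
        have "fst i \<in> W" using that by (auto simp: I_def)
        from A(1)[OF this] B(1)[OF this] show ?thesis using C by simp
      qed
      then show ?thesis unfolding C'_def sum_divide_distrib by (rule sum_ennreal)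
    qed
    finally show "long_flight_mass j R \<le> ennreal (C' / R\<^sup>2)" .
  qed
qed

lemma billiard_measure_tail:
  obtains C R0 where "0 \<le> C" "1 \<le> R0"
    "\<And>R. R0 \<le> R \<Longrightarrow> emeasure (billiard_measure J Ob len c) (free_set R) \<le> ennreal (C / R\<^sup>2)"
proof -
  have "\<forall>j\<in>J. \<exists>CR. 0 \<le> fst CR \<and> 1 \<le> snd CR \<and> (\<forall>R\<ge>snd CR.
    long_flight_mass j R \<le> ennreal (fst CR / R\<^sup>2))"
  proof
    fix j assume "j \<in> J"
    from obstacle_tail[OF this] obtain C R0 where "0 \<le> C \<and> 1 \<le> R0 \<and> (\<forall>R\<ge>R0.
      long_flight_mass j R \<le> ennreal (C / R\<^sup>2))" by (elim exE)
    then show "\<exists>CR. 0 \<le> fst CR \<and> 1 \<le> snd CR \<and> (\<forall>R\<ge>snd CR.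
      long_flight_mass j R \<le> ennreal (fst CR / R\<^sup>2))"
      by (intro exI[of _ "(C, R0)"]) (unfold fst_conv snd_conv)
  qed
  from bchoice[OF this] obtain CR where CR: "\<forall>j\<in>J. 0 \<le> fst (CR j) \<and> 1 \<le> snd (CR j) \<and> (\<forall>R\<ge>snd (CR j).
    long_flight_mass j R \<le> ennreal (fst (CR j) / R\<^sup>2))" by (rule exE)
  define C R0 where "C j = fst (CR j)" and "R0 j = snd (CR j)" for j
  have C: "\<And>j. j \<in> J \<Longrightarrow> 0 \<le> C j" using CR by (simp add: C_def)
  have tail: "long_flight_mass j R \<le> ennreal (C j / R\<^sup>2)"
    if "j \<in> J" "R0 j \<le> R" for j R
    using CR that by (simp add: C_def R0_def)
  define \<Lambda> where "\<Lambda> = 2 * (\<Sum>i\<in>J. len i)"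
  have \<Lambda>: "0 \<le> \<Lambda>" unfolding \<Lambda>_def
    by (intro mult_nonneg_nonneg sum_nonneg) (auto intro: less_imp_le elim: tangentE)
  define N where "N = count_space J \<Otimes>\<^sub>M (lborel \<Otimes>\<^sub>M lborel :: (real \<times> real) measure)"
  define g where "g = (\<lambda>(j, r, \<phi>). ennreal (cos \<phi> / \<Lambda>) * indicator ({0..<len j} \<times> {- (pi / 2)..pi / 2}) (r, \<phi>))"
  define \<Phi> where "\<Phi> = (\<lambda>(j, z). collision j z)"
  have bm: "billiard_measure J Ob len c = distr (density N g) borel \<Phi>"
    unfolding billiard_measure_def N_def g_def \<Phi>_def \<Lambda>_def collision_def by (simp add: split_beta')
  have \<Phi>m [measurable]: "\<Phi> \<in> borel_measurable N"
    unfolding N_def \<Phi>_def using obstacles(1)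
    by (intro measurable_pair_measure_countable1) (auto simp: countable_finite collision_measurable)
  have gm [measurable]: "g \<in> borel_measurable N"
    unfolding N_def g_def using obstacles(1)
    by (intro measurable_pair_measure_countable1) (auto simp: countable_finite split_beta')
  have fm [measurable]: "free_set R \<in> sets borel" for R using free_set_closed by auto
  have sf: "sigma_finite_measure (lborel \<Otimes>\<^sub>M lborel :: (real \<times> real) measure)"
    unfolding lborel_prod by (rule lborel.sigma_finite_measure_axioms)
  define R1 where "R1 = Max (insert 1 (R0 ` J))"
  have R1: "1 \<le> R1" "\<And>j. j \<in> J \<Longrightarrow> R0 j \<le> R1" using obstacles(1) by (auto simp: R1_def)
  have scale: "ennreal (cos x / \<Lambda>) = ennreal (1 / \<Lambda>) * ennreal (cos x)" for x
    using \<Lambda> by (subst ennreal_mult'[symmetric]) auto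
  show ?thesis
  proof (rule that[of "(1 / \<Lambda>) * (\<Sum>j\<in>J. C j)" R1])
    show "0 \<le> 1 / \<Lambda> * (\<Sum>j\<in>J. C j)" using C \<Lambda> by (auto intro!: mult_nonneg_nonneg divide_nonneg_nonneg sum_nonneg)
    fix R assume R: "R1 \<le> R"
    have [measurable]: "(\<lambda>x. indicator (free_set R) (\<Phi> x) :: ennreal) \<in> borel_measurable N"
      by (rule measurable_compose[OF \<Phi>m borel_measurable_indicator[OF fm]])
    have prodm: "(\<lambda>x. g x * indicator (free_set R) (\<Phi> x)) \<in> borel_measurable N"
      by measurable
    have "emeasure (billiard_measure J Ob len c) (free_set R) = (\<integral>\<^sup>+x. g x * indicator (free_set R) (\<Phi> x) \<partial>N)"
    proof -
      have "emeasure (billiard_measure J Ob len c) (free_set R) = emeasure (density N g) (\<Phi> -` free_set R \<inter> space N)"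
        unfolding bm by (subst emeasure_distr) auto
      also have "\<dots> = (\<integral>\<^sup>+x. g x * indicator (\<Phi> -` free_set R \<inter> space N) x \<partial>N)"
        by (rule emeasure_density) measurable
      also have "\<dots> = (\<integral>\<^sup>+x. g x * indicator (free_set R) (\<Phi> x) \<partial>N)"
        by (intro nn_integral_cong) (auto simp: indicator_def)
      finally show ?thesis .
    qed
    also have "\<dots> = (\<integral>\<^sup>+j. \<integral>\<^sup>+z. g (j, z) * indicator (free_set R) (\<Phi> (j, z)) \<partial>(lborel \<Otimes>\<^sub>M lborel) \<partial>count_space J)"
      unfolding N_def
      by (rule sigma_finite_measure.nn_integral_fst[OF sf, symmetric]) (rule prodm[unfolded N_def])
    also have "\<dots> = (\<Sum>j\<in>J. \<integral>\<^sup>+z. g (j, z) * indicator (free_set R) (\<Phi> (j, z)) \<partial>(lborel \<Otimes>\<^sub>M lborel))"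
      by (rule nn_integral_count_space_finite[OF obstacles(1)])
    also have "\<dots> \<le> (\<Sum>j\<in>J. ennreal (1 / \<Lambda>) * ennreal (C j / R\<^sup>2))"
    proof (rule sum_mono)
      fix j assume j: "j \<in> J"
      have [measurable]: "collision j \<in> borel_measurable (lborel \<Otimes>\<^sub>M lborel)" by (rule collision_measurable[OF j])
      have "(\<integral>\<^sup>+z. g (j, z) * indicator (free_set R) (\<Phi> (j, z)) \<partial>(lborel \<Otimes>\<^sub>M lborel))
        = (\<integral>\<^sup>+z. ennreal (1 / \<Lambda>) * (ennreal (cos (snd z)) * indicator ({0..<len j} \<times> {- (pi / 2)..pi / 2}) z *
            indicator (free_set R) (collision j z)) \<partial>(lborel \<Otimes>\<^sub>M lborel))"
        by (intro nn_integral_cong) (simp add: g_def \<Phi>_def split_beta' scale mult.assoc)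
      also have "\<dots> = ennreal (1 / \<Lambda>) * long_flight_mass j R"
        unfolding long_flight_mass_def by (rule nn_integral_cmult) measurable
      also have "\<dots> \<le> ennreal (1 / \<Lambda>) * ennreal (C j / R\<^sup>2)"
        using R R1(2)[OF j] by (intro mult_left_mono tail[OF j]) auto
      finally show "(\<integral>\<^sup>+z. g (j, z) * indicator (free_set R) (\<Phi> (j, z)) \<partial>(lborel \<Otimes>\<^sub>M lborel)) \<le> ennreal (1 / \<Lambda>) * ennreal (C j / R\<^sup>2)" .
    qed
    also have "\<dots> = ennreal ((1 / \<Lambda>) * (\<Sum>j\<in>J. C j) / R\<^sup>2)"
    proof -
      have "(\<Sum>j\<in>J. ennreal (1 / \<Lambda>) * ennreal (C j / R\<^sup>2)) = (\<Sum>j\<in>J. ennreal (1 / \<Lambda> * (C j / R\<^sup>2)))"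
        using C \<Lambda> by (intro sum.cong refl ennreal_mult[symmetric]) auto
      also have "\<dots> = ennreal (\<Sum>j\<in>J. 1 / \<Lambda> * (C j / R\<^sup>2))"
        using C \<Lambda> by (intro sum_ennreal) (auto intro!: mult_nonneg_nonneg divide_nonneg_nonneg)
      also have "(\<Sum>j\<in>J. 1 / \<Lambda> * (C j / R\<^sup>2)) = (1 / \<Lambda>) * (\<Sum>j\<in>J. C j) / R\<^sup>2"
        by (simp add: sum_distrib_left sum_divide_distrib)
      finally show ?thesis .
    qed
    finally show "emeasure (billiard_measure J Ob len c) (free_set R) \<le> ennreal (1 / \<Lambda> * (\<Sum>j\<in>J. C j) / R\<^sup>2)" .
  qed (rule R1(1))
qed

end

section \<open>Moments of the displacement\<close>

text \<open>Dyadic decomposition above \<open>T\<close>: the contribution of 2^k T < g \<le> 2^(k+1)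
  T is at most a constant times 2^((s - 2) k), a geometric series of ratio below 1 as s < 2.\<close>

lemma (in prob_space) moments_of_quadratic_tail:
  fixes g :: "'a \<Rightarrow> real"
  assumes [measurable]: "g \<in> borel_measurable M" and g0: "\<And>x. 0 \<le> g x"
    and tail: "\<And>R. T \<le> R \<Longrightarrow> emeasure M {x \<in> space M. R < g x} \<le> ennreal (C / R\<^sup>2)"
    and C: "0 \<le> C" and T: "1 \<le> T" and s: "1 \<le> s" "s < 2"
  shows "(\<integral>\<^sup>+x. ennreal (g x powr s) \<partial>M) < \<infinity>"
proof -
  define a where "a k = 2 ^ k * T" for k :: nat
  have a: "1 \<le> a k" "T \<le> a k" "0 < a k" for k
  proof -
    have "1 * T \<le> 2 ^ k * T" using T by (intro mult_right_mono) auto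
    then show "1 \<le> a k" "T \<le> a k" "0 < a k" using T unfolding a_def by linarith+
  qed
  let ?E = "\<lambda>k. {x \<in> space M. a k < g x}"
  define b where "b k = a (Suc k) powr s * (C / (a k)\<^sup>2)" for k
  define q where "q = 2 powr (s - 2)"
  have q: "0 < q" "q < 1" using s powr_less_mono[of "s - 2" 0 2] by (auto simp: q_def)
  have bq: "b k = 2 powr s * C * T powr (s - 2) * q ^ k" for k
  proof -
    have "a (Suc k) powr s = 2 powr s * (a k) powr s"
      unfolding a_def using T by (simp add: powr_mult mult.assoc)
    moreover have "(a k) powr s / (a k)\<^sup>2 = (a k) powr (s - 2)"
      using a(3)[of k] by (simp add: powr_diff)
    moreover have "(a k) powr (s - 2) = T powr (s - 2) * q ^ k"
      unfolding a_def q_def using T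
      by (simp add: powr_mult powr_realpow[symmetric] powr_powr mult.commute)
    moreover have "b k = C * (a (Suc k) powr s / (a k)\<^sup>2)" by (simp add: b_def)
    moreover have "2 powr s * (a k) powr s / (a k)\<^sup>2 = 2 powr s * ((a k) powr s / (a k)\<^sup>2)" by simp
    ultimately show ?thesis by (simp only: mult_ac)
  qed
  have sb: "summable b" unfolding bq[abs_def] using q by (intro summable_mult summable_geometric) auto
  have "(\<integral>\<^sup>+x. ennreal (g x powr s) \<partial>M) \<le> (\<integral>\<^sup>+x. ennreal (T powr s) + (\<Sum>k. ennreal (a (Suc k) powr s) * indicator (?E k) x) \<partial>M)"
  proof (rule nn_integral_mono)
    fix x assume x: "x \<in> space M"
    show "ennreal (g x powr s) \<le> ennreal (T powr s) + (\<Sum>k. ennreal (a (Suc k) powr s) * indicator (?E k) x)"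
    proof (cases "g x \<le> T")
      case True
      then have "ennreal (g x powr s) \<le> ennreal (T powr s)"
        using g0 s by (intro ennreal_leI powr_mono2) auto
      then show ?thesis by (rule add_increasing2[OF zero_le])
    next
      case False
      obtain m where m: "g x < 2 ^ m" using real_arch_pow[of 2 "g x"] by auto
      also have "2 ^ m \<le> a m" using T mult_left_mono[of 1 T "2 ^ m"] by (simp add: a_def)
      finally have "g x \<le> a m" by simp
      define n where "n = (LEAST m. g x \<le> a m)"
      have n: "g x \<le> a n" unfolding n_def by (rule LeastI) fact
      have "n \<noteq> 0" using n False by (cases n) (auto simp: a_def)
      then obtain k where k: "n = Suc k" by (cases n) auto
      have "\<not> g x \<le> a k" using not_less_Least[of k "\<lambda>m. g x \<le> a m"] by (simp add: n_def[symmetric] k)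
      then have "x \<in> ?E k" using x by simp
      have "ennreal (g x powr s) \<le> ennreal (a (Suc k) powr s)"
        using n k g0 s by (intro ennreal_leI powr_mono2) auto
      also have "\<dots> = (\<Sum>k\<in>{k}. ennreal (a (Suc k) powr s) * indicator (?E k) x)" using \<open>x \<in> ?E k\<close> by simp
      also have "\<dots> \<le> (\<Sum>k. ennreal (a (Suc k) powr s) * indicator (?E k) x)"
        by (rule sum_le_suminf) auto
      also have "\<dots> \<le> ennreal (T powr s) + \<dots>" by (rule add_increasing[OF zero_le order_refl])
      finally show ?thesis .
    qed
  qed
  also have "\<dots> = ennreal (T powr s) + (\<Sum>k. ennreal (a (Suc k) powr s) * emeasure M (?E k))"
    by (subst nn_integral_add) (auto simp: emeasure_space_1 nn_integral_suminf nn_integral_cmult_indicator)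
  also have "\<dots> \<le> ennreal (T powr s) + (\<Sum>k. ennreal (b k))"
  proof (intro add_left_mono suminf_le summableI)
    fix k
    have "ennreal (a (Suc k) powr s) * emeasure M (?E k) \<le> ennreal (a (Suc k) powr s) * ennreal (C / (a k)\<^sup>2)"
      by (intro mult_left_mono tail a) auto
    also have "\<dots> = ennreal (b k)" using C unfolding b_def by (intro ennreal_mult[symmetric]) auto
    finally show "ennreal (a (Suc k) powr s) * emeasure M (?E k) \<le> ennreal (b k)" .
  qed
  also have "(\<Sum>k. ennreal (b k)) = ennreal (suminf b)"
    using sb by (rule suminf_ennreal2[rotated]) (use C in \<open>simp add: b_def\<close>)
  also have "ennreal (T powr s) + ennreal (suminf b) < \<infinity>" by simp
  finally show ?thesis .
qed

text \<open>Every base point lies on a stable curve, whose forward images are regular curves inside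
  phase space. This gives membership at every point of the tower, not just at almost every
  one.\<close>

lemma stable_orbit_in_phase_space:
  assumes "hyperbolic_product_structure J Ob \<Gamma>u \<Gamma>s" "z \<in> tower (product_set \<Gamma>u \<Gamma>s) R"
  shows "tower_projection J Ob z \<in> phase_space J Ob"
proof -
  obtain x l where z: "z = (x, l)" by (cases z)
  then obtain \<gamma> where \<gamma>: "\<gamma> \<in> \<Gamma>s" "x \<in> \<gamma>" using assms(2) by (auto simp: tower_def product_set_def)
  then obtain K \<rho> where "stable_curve J Ob K \<rho> \<gamma>"
    using assms(1) unfolding hyperbolic_product_structure_def by blast
  then have "regular_curve J Ob ((billiard_map J Ob ^^ l) ` \<gamma>)" unfolding stable_curve_def by blast
  then show ?thesis using \<gamma>(2) by (auto simp: z tower_projection_def regular_curve_def)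
qed

text \<open>The tail is computed upstairs: \<open>\<mu>bar\<close> projects both to the collapsed
  tower and to the billiard measure, and on its tower the displacement is the cell change, whose
  large values force long free flights.\<close>

lemma displacement_moments:
  assumes billiard: "infinite_horizon_billiard J Ob len c"
    and tower: "young_tower J Ob len c \<Gamma>u \<Gamma>s \<P> R \<mu>bar"
    and collapse: "measure_preserving_map \<mu>bar \<mu>\<Delta> (map_prod \<pi> id)" and prob: "prob_space \<mu>\<Delta>"
    and \<kappa>: "\<And>z. z \<in> tower (product_set \<Gamma>u \<Gamma>s) R \<Longrightarrow>
               \<kappa> (map_prod \<pi> id z) = cell_change J Ob (tower_projection J Ob z)"
    and \<kappa>m: "\<kappa> \<in> borel_measurable \<mu>\<Delta>" and s: "1 \<le> s" "s < 2"
  shows "(\<integral>\<^sup>+x. ennreal (norm (\<kappa> x) powr s) \<partial>\<mu>\<Delta>) < \<infinity>"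
proof -
  interpret billiard J Ob len c by unfold_locales (rule billiard)
  interpret prob_space \<mu>\<Delta> by (rule prob)
  obtain D where D: "\<And>q v R. (q, v) \<in> phase_space J Ob \<Longrightarrow> D \<le> R \<Longrightarrow> R < norm (cell_change J Ob (q, v)) \<Longrightarrow>
    (q, v) \<in> free_set (R - D)"
    using large_cell_change by blast
  obtain C R0 where C: "0 \<le> C" "1 \<le> R0"
    "\<And>R. R0 \<le> R \<Longrightarrow> emeasure (billiard_measure J Ob len c) (free_set R) \<le> ennreal (C / R\<^sup>2)"
    by (rule billiard_measure_tail) blast
  \<comment> \<open>For r \<ge> T this gives r - D \<ge> r/2 \<ge> R0, so the shift by
    \<open>D\<close> only costs the factor 4.\<close>
  define T where "T = 2 * \<bar>D\<bar> + 2 * R0"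
  have hyp: "hyperbolic_product_structure J Ob \<Gamma>u \<Gamma>s"
    and sets: "sets \<mu>bar = sets (restrict_space (borel \<Otimes>\<^sub>M count_space UNIV) (tower (product_set \<Gamma>u \<Gamma>s) R))"
    and proj: "tower_projection J Ob \<in> measurable \<mu>bar (billiard_measure J Ob len c)"
      "distr \<mu>bar (billiard_measure J Ob len c) (tower_projection J Ob) = billiard_measure J Ob len c"
    using tower by (auto simp: young_tower_def measure_preserving_map_def)
  have space: "space \<mu>bar = tower (product_set \<Gamma>u \<Gamma>s) R"
    using sets_eq_imp_space_eq[OF sets] by (simp add: space_restrict_space space_pair_measure)
  have coll: "map_prod \<pi> id \<in> measurable \<mu>bar \<mu>\<Delta>" "distr \<mu>bar \<mu>\<Delta> (map_prod \<pi> id) = \<mu>\<Delta>"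
    using collapse by (auto simp: measure_preserving_map_def)
  show ?thesis
  proof (rule moments_of_quadratic_tail[of "\<lambda>x. norm (\<kappa> x)" T "4 * C"])
    show "(\<lambda>x. norm (\<kappa> x)) \<in> borel_measurable \<mu>\<Delta>" using \<kappa>m by measurable
    show "0 \<le> 4 * C" "1 \<le> T" using C by (auto simp: T_def)
    fix r assume r: "T \<le> r"
    let ?A = "{x \<in> space \<mu>\<Delta>. r < norm (\<kappa> x)}"
    have A: "?A \<in> sets \<mu>\<Delta>" using \<kappa>m by measurable
    have fm: "free_set (r - D) \<in> sets (billiard_measure J Ob len c)"
      using free_set_closed by (simp add: billiard_measure_def)
    have "emeasure \<mu>\<Delta> ?A = emeasure \<mu>bar (map_prod \<pi> id -` ?A \<inter> space \<mu>bar)"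
      using emeasure_distr[OF coll(1) A] by (simp only: coll(2))
    also have "\<dots> \<le> emeasure \<mu>bar (tower_projection J Ob -` free_set (r - D) \<inter> space \<mu>bar)"
    proof (rule emeasure_mono)
      show "map_prod \<pi> id -` ?A \<inter> space \<mu>bar \<subseteq> tower_projection J Ob -` free_set (r - D) \<inter> space \<mu>bar"
      proof
        fix z assume z: "z \<in> map_prod \<pi> id -` ?A \<inter> space \<mu>bar"
        then have zt: "z \<in> tower (product_set \<Gamma>u \<Gamma>s) R" and big: "r < norm (\<kappa> (map_prod \<pi> id z))"
          by (auto simp: space)
        obtain q v where qv: "tower_projection J Ob z = (q, v)" by (cases "tower_projection J Ob z")
        have "(q, v) \<in> free_set (r - D)"
        proof (rule D)
          show "(q, v) \<in> phase_space J Ob" using stable_orbit_in_phase_space[OF hyp zt] by (simp add: qv)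
          show "D \<le> r" using r C(2) by (simp add: T_def)
          show "r < norm (cell_change J Ob (q, v))" using big by (simp add: \<kappa>[OF zt] qv)
        qed
        then show "z \<in> tower_projection J Ob -` free_set (r - D) \<inter> space \<mu>bar" using z by (simp add: qv)
      qed
      show "tower_projection J Ob -` free_set (r - D) \<inter> space \<mu>bar \<in> sets \<mu>bar"
        by (rule measurable_sets[OF proj(1) fm])
    qed
    also have "\<dots> = emeasure (billiard_measure J Ob len c) (free_set (r - D))"
      using emeasure_distr[OF proj(1) fm] by (simp only: proj(2))
    also have "\<dots> \<le> ennreal (C / (r - D)\<^sup>2)"
      using r C(2) by (intro C(3)) (simp add: T_def)
    also have "\<dots> \<le> ennreal (4 * C / r\<^sup>2)"
    proof (rule ennreal_leI)
      have rp: "0 < r" "r / 2 \<le> r - D" using r C(2) by (auto simp: T_def)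
      then have "(r / 2)\<^sup>2 \<le> (r - D)\<^sup>2" by (intro power_mono) auto
      then have "C / (r - D)\<^sup>2 \<le> C / (r / 2)\<^sup>2" using rp C(1) by (intro divide_left_mono) auto
      then show "C / (r - D)\<^sup>2 \<le> 4 * C / r\<^sup>2" by (simp add: power_divide mult.commute)
    qed
    finally show "emeasure \<mu>\<Delta> ?A \<le> ennreal (4 * C / r\<^sup>2)" .
  qed (use s in auto)
qed

lemma bounded_operator_zero:
  "bounded_operator M N (Lp_norm M s) (\<lambda>_ _. 0)"
proof -
  have "Lp_norm M s (\<lambda>_. 0) = 0" by (simp add: Lp_norm_def)
  then have "op_norm N (Lp_norm M s) (\<lambda>_ _. 0) \<le> 0"
    unfolding op_norm_def by (intro SUP_least) simp
  then show ?thesis using \<open>Lp_norm M s (\<lambda>_. 0) = 0\<close> by (simp add: bounded_operator_def)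
qed

theorem proposition3p1:
  fixes J :: "'j set" and Ob :: "'j \<Rightarrow> plane set"
    and len :: "'j \<Rightarrow> real" and c :: "'j \<Rightarrow> real \<Rightarrow> plane"
    and \<Gamma>u \<Gamma>s \<P> :: "phase set set" and R :: "phase \<Rightarrow> nat"
    and \<mu>bar :: "(phase \<times> nat) measure" and \<pi> :: "phase \<Rightarrow> 'y"
    and \<mu>Y :: "'y measure" and \<Y> :: "'y set set" and \<sigma> :: "'y \<Rightarrow> nat" and F :: "'y \<Rightarrow> 'y"
    and \<mu>\<Delta> :: "('y \<times> nat) measure" and \<kappa>hat :: "'y \<times> nat \<Rightarrow> plane"
    and \<D> :: "('y \<times> nat) set set" and \<alpha> :: "'y \<times> nat \<Rightarrow> real" and \<beta> C\<alpha> :: real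
    and f :: "'y \<times> nat \<Rightarrow> 'y \<times> nat" and P :: "('y \<times> nat) operator"
    and s0 :: "'y \<times> nat \<Rightarrow> 'y \<times> nat \<Rightarrow> enat"
  assumes billiard: "infinite_horizon_billiard J Ob len c"
    and tower: "young_tower J Ob len c \<Gamma>u \<Gamma>s \<P> R \<mu>bar"
    and one_dim: "one_dim_tower \<mu>Y \<Y> \<sigma> F \<mu>\<Delta>"
    and collapse: "collapses_stable_curves J Ob \<Gamma>u \<Gamma>s \<P> R \<mu>bar \<pi> \<mu>Y \<Y> \<sigma> F \<mu>\<Delta>"
    and \<kappa>hat: "\<forall>z \<in> tower (product_set \<Gamma>u \<Gamma>s) R.
                 \<kappa>hat (map_prod \<pi> id z) = cell_change J Ob (tower_projection J Ob z)"
    and partition: "young_partition (space \<mu>Y) \<Y> \<sigma> F \<D>"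
    and f: "f = tower_map \<sigma> F"
    and s0: "s0 = separation_time \<D> f"
    and P: "P = transfer_op (space \<mu>\<Delta>) f \<alpha>"
    and transfer: "\<alpha> \<in> borel_measurable \<mu>\<Delta>" "is_transfer_op \<mu>\<Delta> f P"
    and \<beta>: "0 < \<beta>" "\<beta> < 1"
    and \<alpha>_regular: "\<forall>x\<in>space \<mu>\<Delta>. \<forall>y\<in>space \<mu>\<Delta>. s0 x y \<ge> 1 \<longrightarrow>
                      \<bar>\<alpha> x - \<alpha> y\<bar> \<le> C\<alpha> * epower \<beta> (s0 x y + 1)"
  shows "\<exists>Pr' :: 2 \<Rightarrow> ('y \<times> nat) operator.
    (\<forall>s\<in>{1..<2}. \<forall>i. bounded_operator \<mu>\<Delta> (B0_norm \<mu>\<Delta> \<beta> s0) (Lp_norm \<mu>\<Delta> s) (Pr' i)) \<and>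
    (\<forall>p>2. \<forall>\<epsilon>>0.
       summable (\<lambda>l. exp (p * real l * \<epsilon>) * measure \<mu>\<Delta> {z \<in> space \<mu>\<Delta>. snd z = l}) \<longrightarrow>
       (\<forall>\<beta>0 \<theta> lam Pr Nt.
          spectral_decomposition \<mu>\<Delta> (B_norm \<mu>\<Delta> \<beta> s0 \<epsilon>) (twisted_op P \<kappa>hat) \<beta>0 \<theta> lam Pr Nt \<longrightarrow>
          (\<forall>p'\<in>{1..<4/3}. \<forall>\<gamma>\<in>{1<..<min (2 * ((p - 1) / p)) (4 / p' - 2)}.
             \<exists>C>0. \<forall>\<^sub>F t in at 0.
               op_norm (B0_norm \<mu>\<Delta> \<beta> s0) (Lp_norm \<mu>\<Delta> p')
                 (\<lambda>h x. Pr t h x - Pr 0 h x - (\<Sum>i\<in>UNIV. of_real (t $ i) * Pr' i h x))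
               \<le> ennreal (C * norm t powr \<gamma>))))"
proof (cases "\<exists>p>2. \<exists>\<epsilon>>0. \<exists>\<beta>0 \<theta> lam Pr Nt.
    summable (\<lambda>l. exp (p * real l * \<epsilon>) * measure \<mu>\<Delta> {z \<in> space \<mu>\<Delta>. snd z = l}) \<and>
    spectral_decomposition \<mu>\<Delta> (B_norm \<mu>\<Delta> \<beta> s0 \<epsilon>) (twisted_op P \<kappa>hat) \<beta>0 \<theta> lam Pr Nt")
  case False
  show ?thesis
  proof (rule exI[of _ "\<lambda>_ _ _. 0"], intro conjI ballI allI impI bounded_operator_zero)
    fix p \<epsilon> \<beta>0 \<theta> lam Pr Nt p' \<gamma>
    assume "2 < p" "0 < \<epsilon>" "summable (\<lambda>l. exp (p * real l * \<epsilon>) * measure \<mu>\<Delta> {z \<in> space \<mu>\<Delta>. snd z = l})"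
      "spectral_decomposition \<mu>\<Delta> (B_norm \<mu>\<Delta> \<beta> s0 \<epsilon>) (twisted_op P \<kappa>hat) \<beta>0 \<theta> lam Pr Nt"
    then have "\<exists>p>2. \<exists>\<epsilon>>0. \<exists>\<beta>0 \<theta> lam Pr Nt.
      summable (\<lambda>l. exp (p * real l * \<epsilon>) * measure \<mu>\<Delta> {z \<in> space \<mu>\<Delta>. snd z = l}) \<and>
      spectral_decomposition \<mu>\<Delta> (B_norm \<mu>\<Delta> \<beta> s0 \<epsilon>) (twisted_op P \<kappa>hat) \<beta>0 \<theta> lam Pr Nt"
      by (intro exI conjI)
    with False show "\<exists>C>0. \<forall>\<^sub>F t in at 0. op_norm (B0_norm \<mu>\<Delta> \<beta> s0) (Lp_norm \<mu>\<Delta> p')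
      (\<lambda>h x. Pr t h x - Pr 0 h x - (\<Sum>i\<in>UNIV. of_real (t $ i) * 0)) \<le> ennreal (C * norm t powr \<gamma>)"
      by (rule notE)
  qed
next
  case True
  \<comment> \<open>One fixed decomposition yields the measurability of the displacement and the
    boundedness of the operator; the expansion below is then proved for an arbitrary decomposition
    with the same operator.\<close>
  then obtain p1 \<epsilon>1 \<beta>1 \<theta>1 lam1 Pr1 Nt1 where p1: "2 < p1" "0 < \<epsilon>1"
    and sm1: "summable (\<lambda>l. exp (p1 * real l * \<epsilon>1) * measure \<mu>\<Delta> {z \<in> space \<mu>\<Delta>. snd z = l})"
    and dec1: "spectral_decomposition \<mu>\<Delta> (B_norm \<mu>\<Delta> \<beta> s0 \<epsilon>1) (twisted_op P \<kappa>hat) \<beta>1 \<theta>1 lam1 Pr1 Nt1"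
    by (elim exE conjE)
  interpret collapsed_tower \<mu>Y \<Y> \<sigma> F \<mu>\<Delta> \<D> \<beta> f s0
    by unfold_locales (fact one_dim partition f s0 \<beta>)+
  have \<kappa>m: "\<kappa>hat \<in> borel_measurable \<mu>\<Delta>"
  proof (rule displacement_measurable[OF transfer(1) p1(2)])
    fix t assume "t \<in> square pi"
    then show "bounded_operator \<mu>\<Delta> (B_norm \<mu>\<Delta> \<beta> s0 \<epsilon>1) (B_norm \<mu>\<Delta> \<beta> s0 \<epsilon>1)
        (twisted_op (transfer_op (space \<mu>\<Delta>) f \<alpha>) \<kappa>hat t)"
      using dec1 unfolding spectral_decomposition_def P by blast
  qed
  have collapse_preserving: "measure_preserving_map \<mu>bar \<mu>\<Delta> (map_prod \<pi> id)"
    using collapse by (simp add: collapses_stable_curves_def Let_def)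
  interpret prob_space \<mu>\<Delta> by (rule prob_tower)
  interpret tower_transfer \<mu>\<Delta> f P \<kappa>hat \<beta> s0
  proof unfold_locales
    fix s :: real assume s: "1 \<le> s" "s < 2"
    show "(\<integral>\<^sup>+x. ennreal (norm (\<kappa>hat x) powr s) \<partial>\<mu>\<Delta>) < \<infinity>"
      by (rule displacement_moments[OF billiard tower collapse_preserving prob_tower \<kappa>hat[rule_format] \<kappa>m s])
  qed (fact snd_measurable f_preserving transfer(2) \<kappa>m)+
  show ?thesis
  proof (rule exI[of _ derivative_op], intro conjI allI ballI impI)
    fix s :: real and i :: 2 assume "s \<in> {1..<2}"
    then show "bounded_operator \<mu>\<Delta> (B0_norm \<mu>\<Delta> \<beta> s0) (Lp_norm \<mu>\<Delta> s) (derivative_op i)"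
      by (intro derivative_op_bounded[OF dec1 p1 sm1]) auto
  next
    fix p \<epsilon> \<beta>0 \<theta> lam Pr Nt p' \<gamma>
    assume p: "2 < p" "0 < \<epsilon>" and sm: "summable (\<lambda>l. exp (p * real l * \<epsilon>) * measure \<mu>\<Delta> {z \<in> space \<mu>\<Delta>. snd z = l})"
      and dec: "spectral_decomposition \<mu>\<Delta> (B_norm \<mu>\<Delta> \<beta> s0 \<epsilon>) (twisted_op P \<kappa>hat) \<beta>0 \<theta> lam Pr Nt"
      and p': "p' \<in> {1..<4 / 3}" and \<gamma>: "\<gamma> \<in> {1<..<min (2 * ((p - 1) / p)) (4 / p' - 2)}"
    have "2 / p' \<le> 2" using p' by (simp add: divide_le_eq)
    then have "4 / p' - 2 \<le> 2 / p'" by simp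
    then have "\<gamma> < 2 / p'" using \<gamma> by auto
    then show "\<exists>C>0. \<forall>\<^sub>F t in at 0. op_norm (B0_norm \<mu>\<Delta> \<beta> s0) (Lp_norm \<mu>\<Delta> p')
        (\<lambda>h x. Pr t h x - Pr 0 h x - (\<Sum>i\<in>UNIV. of_real (t $ i) * derivative_op i h x)) \<le> ennreal (C * norm t powr \<gamma>)"
      using p' \<gamma> by (intro projector_expansion_op_norm[OF dec p sm]) auto
  qed
qed

end
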